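(* For $p,q,r,u,v \in \mathbb{N}$, \begin{align*} & \zeta_2(2p,s,2q,2r,2u,2v;G_2)+\zeta_2(2p,2q,s,2r,2v,2u;G_2)\\ & +\zeta_2(2u,2r,s,2q,2v,2p;G_2)+\zeta_2(2u,s,2r,2q,2p,2v;G_2) \\ & +\zeta_2(2v,2r,2q,s,2u,2p;G_2)+\zeta_2(2v,2q,2r,s,2p,2u;G_2) \\ & +I_1+I_2+\cdots+I_8=0 \end{align*} holds for all $s \in \mathbb{C}$ except for singularities of functions on the left-hand side, where, with $w_k:=s+2p+2q+2r+2u+2v-2k$ and $$\Lambda_k:=2^{-2k}\zeta(2k)\{\zeta(w_k)+\phi(w_k)\}+(1-2^{-2k})\zeta(2k)\{\zeta(w_k)-\phi(w_k)\},$$ the functions $I_1,\dots,I_8$ of $s$ are defined as follows: \begin{align*} I_1 & =-2\sum_{k=0}^{p}\zeta(2k)\zeta(w_k)\sum_{\sigma=0}^{2p-2k}\binom{\sigma+2v-1}{\sigma}\sum_{\rho =0}^{2p-2k-\sigma}\binom{\rho +2u-1}{\rho }\sum_{\omega =0}^{2p-2k-\sigma-\rho }\binom{\omega +2r-1}{\omega } \\ & \quad\times \binom{2p+2q-1-2k-\sigma-\rho -\omega }{2q-1}2^{\sigma-2r-\omega }3^{-2u-2v-\sigma-\rho }\\ & \ -2\sum_{k=0}^{v}\Lambda_k\sum_{\sigma=0}^{2p-1}\binom{\sigma+2v-2k}{\sigma}\sum_{\rho =0}^{2p-1-\sigma}\binom{\rho +2u-1}{\rho }\sum_{\omega =0}^{2p-1-\sigma-\rho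 }\binom{\omega +2r-1}{\omega } \\ & \quad\times \binom{2p+2q-2-\sigma-\rho -\omega }{2q-1}2^{\sigma-2r-\omega }3^{-2u-2v+2k-\sigma-\rho -1}; \end{align*} \begin{align*} I_2 & =-2\sum_{k=0}^{u}\zeta(2k)\zeta(w_k)\sum_{\sigma=0}^{2u-2k}\binom{\sigma+2v-1}{\sigma}\sum_{\rho =0}^{2p-1}\binom{\rho +2u-2k-\sigma}{\rho }\sum_{\omega =0}^{2p-1-\rho }\binom{\omega +2r-1}{\omega } \\ & \quad\times \binom{2p+2q-2-\rho -\omega }{2q-1}2^{\sigma-2r-\omega }3^{-2u-2v+2k-\rho -1}\\ & \ -2\sum_{k=0}^{v}\Lambda_k\sum_{\sigma=0}^{2u-1}\binom{\sigma+2v-2k}{\sigma}\sum_{\rho =0}^{2p-1}\binom{\rho +2u-1-\sigma}{\rho }\sum_{\omega =0}^{2p-1-\rho }\binom{\omega +2r-1}{\omega } \\ & \quad\times \binom{2p+2q-2-\rho -\omega }{2q-1}2^{\sigma-2r-\omega }3^{-2u-2v+2k-\rho -1}; \end{align*} \begin{align*} I_3 & =-2\sum_{k=0}^{q}\zeta(2k)\zeta(w_k)\sum_{\sigma=0}^{2q-2k}\binom{\sigma+2v-1}{\sigma}\sum_{\rho =0}^{2q-2k-\sigma}\binom{\rho +2u-1}{\rho }\sum_{\omega =0}^{2q-2k-\sigma-\rho }\binom{\omega +2r-1}{\omega } \\ & \quad\times \binom{2p+2q-1-2k-\sigma-\rho -\omega }{2p-1}(-1)^{\sigma+\rho +\omega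 }2^{\sigma-2u-\rho }\\ & \ +2\sum_{k=0}^{v}\Lambda_k\sum_{\sigma=0}^{2q-1}\binom{\sigma+2v-2k}{\sigma}\sum_{\rho =0}^{2q-1-\sigma}\binom{\rho +2u-1}{\rho }\sum_{\omega =0}^{2q-1-\sigma-\rho }\binom{\omega +2r-1}{\omega } \\ & \quad\times \binom{2p+2q-2-\sigma-\rho -\omega }{2p-1}(-1)^{\sigma+\rho +\omega }2^{\sigma-2u-\rho }; \end{align*} \begin{align*} I_4 & =2\sum_{k=0}^{u}\zeta(2k)\zeta(w_k)\sum_{\sigma=0}^{2u-2k}\binom{\sigma+2v-1}{\sigma}\sum_{\rho =0}^{2q-1}\binom{\rho +2u-2k-\sigma}{\rho }\sum_{\omega =0}^{2q-1-\rho }\binom{\omega +2r-1}{\omega } \\ & \quad\times \binom{2p+2q-2-\rho -\omega }{2p-1}(-1)^{\rho +\omega }2^{-2u+2k+2\sigma-\rho -1}3^{-2v-\sigma}\\ & \ +2\sum_{k=0}^{v}\Lambda_k\sum_{\sigma=0}^{2u-1}\binom{\sigma+2v-2k}{\sigma}\sum_{\rho =0}^{2q-1}\binom{\rho +2u-1-\sigma}{\rho }\sum_{\omega =0}^{2q-1-\rho }\binom{\omega +2r-1}{\omega } \\ & \quad\times \binom{2p+2q-2-\rho -\omega }{2p-1}(-1)^{\rho +\omega }2^{-2u+2\sigma-\rho }3^{-2v+2k-\sigma-1}; \end{align*} \begin{align*} I_5 & =-2\sum_{k=0}^{r}\zeta(2k)\zeta(w_k)\sum_{\sigma=0}^{2r-2k}\binom{\sigma+2v-1}{\sigma}\sum_{\rho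 =0}^{2r-2k-\sigma}\binom{\rho +2u-1}{\rho }\sum_{\omega =0}^{2p-1}\binom{\omega +2r-2k-\sigma-\rho }{\omega } \\ & \quad\times \binom{2p+2q-2-\omega }{2q-1}(-1)^\rho 2^{-2r+2k+2\sigma+\rho -\omega -1}\\ & \ -2\sum_{k=0}^{v}\Lambda_k\sum_{\sigma=0}^{2r-1}\binom{\sigma+2v-2k}{\sigma}\sum_{\rho =0}^{2r-1-\sigma}\binom{\rho +2u-1}{\rho }\sum_{\omega =0}^{2p-1}\binom{\omega +2r-1-\sigma-\rho }{\omega } \\ & \quad\times \binom{2p+2q-2-\omega }{2q-1}(-1)^\rho 2^{-2r+2\sigma+\rho -\omega }; \end{align*} \begin{align*} I_6 & =2\sum_{k=0}^{u}\zeta(2k)\zeta(w_k)\sum_{\sigma=0}^{2u-2k}\binom{\sigma+2v-1}{\sigma}\sum_{\rho =0}^{2r-1}\binom{\rho +2u-2k-\sigma}{\rho }\sum_{\omega =0}^{2p-1}\binom{\omega +2r-1-\rho }{\omega } \\ & \quad\times \binom{2p+2q-2-\omega }{2q-1}(-1)^\rho 2^{-2r+\sigma+\rho -\omega }3^{-2v-\sigma}\\ & \ +2\sum_{k=0}^{v}\Lambda_k\sum_{\sigma=0}^{2u-1}\binom{\sigma+2v-2k}{\sigma}\sum_{\rho =0}^{2r-1}\binom{\rho +2u-1-\sigma}{\rho }\sum_{\omega =0}^{2p-1}\binom{\omega +2r-1-\rho }{\omega } \\ & \quad\times \binom{2p+2q-2-\omega }{2q-1}(-1)^\rho 2^{-2r+\sigma+\rho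 -\omega }3^{-2v+2k-\sigma-1}; \end{align*} \begin{align*} I_7 & =2\sum_{k=0}^{r}\zeta(2k)\zeta(w_k)\sum_{\sigma=0}^{2r-2k}\binom{\sigma+2v-1}{\sigma}\sum_{\rho =0}^{2r-2k-\sigma}\binom{\rho +2u-1}{\rho }\sum_{\omega =0}^{2q-1}\binom{\omega +2r-2k-\sigma-\rho }{\omega } \\ & \quad\times \binom{2p+2q-2-\omega }{2p-1}(-1)^{\rho +\omega }2^{\sigma}\\ & \ +2\sum_{k=0}^{v}\Lambda_k\sum_{\sigma=0}^{2r-1}\binom{\sigma+2v-2k}{\sigma}\sum_{\rho =0}^{2r-1-\sigma}\binom{\rho +2u-1}{\rho }\sum_{\omega =0}^{2q-1}\binom{\omega +2r-1-\sigma-\rho }{\omega } \\ & \quad\times \binom{2p+2q-2-\omega }{2p-1}(-1)^{\rho +\omega }2^{\sigma}; \end{align*} \begin{align*} I_8 & =-2\sum_{k=0}^{u}\zeta(2k)\zeta(w_k)\sum_{\sigma=0}^{2u-2k}\binom{\sigma+2v-1}{\sigma}\sum_{\rho =0}^{2r-1}\binom{\rho +2u-2k-\sigma}{\rho }\sum_{\omega =0}^{2q-1}\binom{\omega +2r-1-\rho }{\omega } \\ & \quad\times \binom{2p+2q-2-\omega }{2p-1}(-1)^{\rho +\omega }2^{\sigma}3^{-2v-\sigma}\\ & \ -2\sum_{k=0}^{v}\Lambda_k\sum_{\sigma=0}^{2u-1}\binom{\sigma+2v-2k}{\sigma}\sum_{\rho =0}^{2r-1}\binom{\rho +2u-1-\sigma}{\rho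 }\sum_{\omega =0}^{2q-1}\binom{\omega +2r-1-\rho }{\omega } \\ & \quad\times \binom{2p+2q-2-\omega }{2p-1}(-1)^{\rho +\omega }2^{\sigma}3^{-2v+2k-\sigma-1}. \end{align*}
   Context: $\mathbb{N}$ is the set of positive integers. $\zeta$ is the Riemann zeta-function (meromorphically continued; in particular $\zeta(0)=-\tfrac12$), and $\phi(s)=(2^{1-s}-1)\zeta(s)$ is the continuation of $\sum_{n\ge1}(-1)^n n^{-s}$. The zeta-function of the root system of type $G_2$ is $$\zeta_2(s_1,s_2,s_3,s_4,s_5,s_6;G_2)=\sum_{m=1}^\infty\sum_{n=1}^\infty\frac{1}{m^{s_1}n^{s_2}(m+n)^{s_3}(m+2n)^{s_4}(m+3n)^{s_5}(2m+3n)^{s_6}}$$ in its region of absolute convergence, and is understood elsewhere by its meromorphic continuation to $\mathbb{C}^6$, whose possible singularities lie on $s_1+s_3+s_4+s_5+s_6=1-l$, $s_2+s_3+s_4+s_5+s_6=1-l$ ($l=0,1,2,\dots$) and $s_1+\cdots+s_6=2$. *)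

theory Defs
  imports "HOL-Complex_Analysis.Complex_Analysis"
begin

definition zeta :: "complex \<Rightarrow> complex" where
  "zeta = (THE f. f holomorphic_on - {1} \<and>
     (\<forall>s. Re s > 1 \<longrightarrow> (\<lambda>n. 1 / of_nat (Suc n) powr s) sums f s) \<and> f 1 = 0)"
  (* the value at the pole 1 is a convention that makes the function unique *)

definition phi :: "complex \<Rightarrow> complex" where
  "phi = remove_sings (\<lambda>s. (2 powr (1 - s) - 1) * zeta s)"
  (* remove_sings supplies the value at the removable singularity 1 *)

type_synonym complex6 = "complex \<times> complex \<times> complex \<times> complex \<times> complex \<times> complex"

text \<open>Holomorphy in six variables: Frechet differentiable with complex-linear derivative.\<close>

definition holomorphic6_on :: "(complex6 \<Rightarrow> complex) \<Rightarrow> complex6 set \<Rightarrow> bool" where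
  "holomorphic6_on f U \<longleftrightarrow> open U \<and>
     (\<forall>z\<in>U. \<exists>a1 a2 a3 a4 a5 a6. (f has_derivative
        (\<lambda>(h1, h2, h3, h4, h5, h6). a1 * h1 + a2 * h2 + a3 * h3 + a4 * h4 + a5 * h5 + a6 * h6)) (at z))"

text \<open>Local quotient of holomorphic functions; the value of the function at points of
  indeterminacy or at poles is unconstrained.\<close>

definition meromorphic6 :: "(complex6 \<Rightarrow> complex) \<Rightarrow> bool" where
  "meromorphic6 f \<longleftrightarrow> (\<forall>z. \<exists>W g h. z \<in> W \<and> connected W \<and> holomorphic6_on g W \<and> holomorphic6_on h W \<and>
     (\<exists>x\<in>W. h x \<noteq> 0) \<and> (\<forall>x\<in>W. h x \<noteq> 0 \<longrightarrow> f x = g x / h x))"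

definition G2_term :: "complex6 \<Rightarrow> nat \<times> nat \<Rightarrow> complex" where
  "G2_term = (\<lambda>(s1, s2, s3, s4, s5, s6) (m, n).
     1 / (of_nat m powr s1 * of_nat n powr s2 * of_nat (m + n) powr s3 *
          of_nat (m + 2 * n) powr s4 * of_nat (m + 3 * n) powr s5 * of_nat (2 * m + 3 * n) powr s6))"

definition G2_possible_singularities :: "complex6 set" where
  "G2_possible_singularities = {(s1, s2, s3, s4, s5, s6).
     (\<exists>l::nat. s1 + s3 + s4 + s5 + s6 = 1 - of_nat l) \<or>
     (\<exists>l::nat. s2 + s3 + s4 + s5 + s6 = 1 - of_nat l) \<or>
     s1 + s2 + s3 + s4 + s5 + s6 = 2}"

text \<open>Any two functions satisfying the following predicate agree off the (closed, nowhere dense)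
  set of possible singularities, whose complement is connected.\<close>

definition G2_continuation :: "(complex6 \<Rightarrow> complex) \<Rightarrow> bool" where
  "G2_continuation f \<longleftrightarrow> meromorphic6 f \<and> holomorphic6_on f (- G2_possible_singularities) \<and>
     (\<forall>z. (\<lambda>x. norm (G2_term z x)) summable_on ({1..} \<times> {1..}) \<longrightarrow> f z = infsum (G2_term z) ({1..} \<times> {1..}))"

text \<open>A possible singularity at which the continuation nevertheless extends holomorphically is
  regular, and \<open>zeta_G2\<close> takes the value of that extension there.  The value does not depend on
  the continuation chosen: two continuations that are both holomorphic near a point agree at it.
  That a continuation exists is a theorem about the series and is not built into the definitions:
  if there were none, every point would be singular.\<close>

definition G2_regular_value :: "complex6 \<Rightarrow> complex \<Rightarrow> bool" where
  "G2_regular_value z c \<longleftrightarrow> (\<exists>f U. G2_continuation f \<and> z \<in> U \<and> holomorphic6_on f U \<and> f z = c)"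

definition zeta_G2_singular :: "complex6 \<Rightarrow> bool" where
  "zeta_G2_singular z \<longleftrightarrow> (\<nexists>c. G2_regular_value z c)"

definition zeta_G2 :: "complex6 \<Rightarrow> complex" where
  "zeta_G2 z = (THE c. G2_regular_value z c)"

text \<open>The functions of one variable obtained by restricting \<open>zeta_G2\<close> to a line \<open>L\<close>.  The line may
  meet the singular set at a point at which the restriction has only a removable singularity
  (for instance where the residue along a polar hyperplane happens to vanish); such a point is not
  a singularity of the restriction, and the restriction takes its limit as value there.  The first
  conjunct of the second definition says that the restriction is defined near \<open>s\<close>.\<close>

definition zeta_G2_line :: "(complex \<Rightarrow> complex6) \<Rightarrow> complex \<Rightarrow> complex" where
  "zeta_G2_line L = remove_sings (\<lambda>t. zeta_G2 (L t))"

definition zeta_G2_line_regular :: "(complex \<Rightarrow> complex6) \<Rightarrow> complex \<Rightarrow> bool" where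
  "zeta_G2_line_regular L s \<longleftrightarrow>
     (\<forall>\<^sub>F t in at s. \<not> zeta_G2_singular (L t)) \<and> zeta_G2_line L analytic_on {s}"

definition wk :: "nat \<Rightarrow> nat \<Rightarrow> nat \<Rightarrow> nat \<Rightarrow> nat \<Rightarrow> complex \<Rightarrow> nat \<Rightarrow> complex" where
  "wk p q r u v s k = s + 2 * of_nat p + 2 * of_nat q + 2 * of_nat r + 2 * of_nat u + 2 * of_nat v - 2 * of_nat k"

definition Lam :: "nat \<Rightarrow> nat \<Rightarrow> nat \<Rightarrow> nat \<Rightarrow> nat \<Rightarrow> complex \<Rightarrow> nat \<Rightarrow> complex" where
  "Lam p q r u v s k =
     2 powi (- 2 * int k) * zeta (2 * of_nat k) * (zeta (wk p q r u v s k) + phi (wk p q r u v s k)) +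
     (1 - 2 powi (- 2 * int k)) * zeta (2 * of_nat k) * (zeta (wk p q r u v s k) - phi (wk p q r u v s k))"

text \<open>In the definitions below every natural-number subtraction is exact within the ranges of
  summation when all parameters are positive.  Each function
  below is, for fixed parameters, a linear combination of \<open>zeta (wk ...)\<close> and \<open>phi (wk ...)\<close>
  with coefficients independent of \<open>s\<close>, so if its poles at some \<open>wk ... = 1\<close> cancel then the
  conventional value of \<open>zeta\<close> at 1 cancels too, and the function is analytic there as it stands.\<close>

definition I1 :: "nat \<Rightarrow> nat \<Rightarrow> nat \<Rightarrow> nat \<Rightarrow> nat \<Rightarrow> complex \<Rightarrow> complex" where
  "I1 p q r u v s =
     - 2 * (\<Sum>k=0..p. zeta (2 * of_nat k) * zeta (wk p q r u v s k) *
         (\<Sum>\<sigma>=0..2 * p - 2 * k. of_nat ((\<sigma> + 2 * v - 1) choose \<sigma>) *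
         (\<Sum>\<rho>=0..2 * p - 2 * k - \<sigma>. of_nat ((\<rho> + 2 * u - 1) choose \<rho>) *
         (\<Sum>\<omega>=0..2 * p - 2 * k - \<sigma> - \<rho>. of_nat ((\<omega> + 2 * r - 1) choose \<omega>) *
           of_nat ((2 * p + 2 * q - 1 - 2 * k - \<sigma> - \<rho> - \<omega>) choose (2 * q - 1)) * 2 powi (int \<sigma> - 2 * int r - int \<omega>) * 3 powi (- 2 * int u - 2 * int v - int \<sigma> - int \<rho>)))))
     - 2 * (\<Sum>k=0..v. Lam p q r u v s k *
         (\<Sum>\<sigma>=0..2 * p - 1. of_nat ((\<sigma> + 2 * v - 2 * k) choose \<sigma>) *
         (\<Sum>\<rho>=0..2 * p - 1 - \<sigma>. of_nat ((\<rho> + 2 * u - 1) choose \<rho>) *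
         (\<Sum>\<omega>=0..2 * p - 1 - \<sigma> - \<rho>. of_nat ((\<omega> + 2 * r - 1) choose \<omega>) *
           of_nat ((2 * p + 2 * q - 2 - \<sigma> - \<rho> - \<omega>) choose (2 * q - 1)) * 2 powi (int \<sigma> - 2 * int r - int \<omega>) * 3 powi (- 2 * int u - 2 * int v + 2 * int k - int \<sigma> - int \<rho> - 1)))))"

definition I2 :: "nat \<Rightarrow> nat \<Rightarrow> nat \<Rightarrow> nat \<Rightarrow> nat \<Rightarrow> complex \<Rightarrow> complex" where
  "I2 p q r u v s =
     - 2 * (\<Sum>k=0..u. zeta (2 * of_nat k) * zeta (wk p q r u v s k) *
         (\<Sum>\<sigma>=0..2 * u - 2 * k. of_nat ((\<sigma> + 2 * v - 1) choose \<sigma>) *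
         (\<Sum>\<rho>=0..2 * p - 1. of_nat ((\<rho> + 2 * u - 2 * k - \<sigma>) choose \<rho>) *
         (\<Sum>\<omega>=0..2 * p - 1 - \<rho>. of_nat ((\<omega> + 2 * r - 1) choose \<omega>) *
           of_nat ((2 * p + 2 * q - 2 - \<rho> - \<omega>) choose (2 * q - 1)) * 2 powi (int \<sigma> - 2 * int r - int \<omega>) * 3 powi (- 2 * int u - 2 * int v + 2 * int k - int \<rho> - 1)))))
     - 2 * (\<Sum>k=0..v. Lam p q r u v s k *
         (\<Sum>\<sigma>=0..2 * u - 1. of_nat ((\<sigma> + 2 * v - 2 * k) choose \<sigma>) *
         (\<Sum>\<rho>=0..2 * p - 1. of_nat ((\<rho> + 2 * u - 1 - \<sigma>) choose \<rho>) *
         (\<Sum>\<omega>=0..2 * p - 1 - \<rho>. of_nat ((\<omega> + 2 * r - 1) choose \<omega>) *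
           of_nat ((2 * p + 2 * q - 2 - \<rho> - \<omega>) choose (2 * q - 1)) * 2 powi (int \<sigma> - 2 * int r - int \<omega>) * 3 powi (- 2 * int u - 2 * int v + 2 * int k - int \<rho> - 1)))))"

definition I3 :: "nat \<Rightarrow> nat \<Rightarrow> nat \<Rightarrow> nat \<Rightarrow> nat \<Rightarrow> complex \<Rightarrow> complex" where
  "I3 p q r u v s =
     - 2 * (\<Sum>k=0..q. zeta (2 * of_nat k) * zeta (wk p q r u v s k) *
         (\<Sum>\<sigma>=0..2 * q - 2 * k. of_nat ((\<sigma> + 2 * v - 1) choose \<sigma>) *
         (\<Sum>\<rho>=0..2 * q - 2 * k - \<sigma>. of_nat ((\<rho> + 2 * u - 1) choose \<rho>) *
         (\<Sum>\<omega>=0..2 * q - 2 * k - \<sigma> - \<rho>. of_nat ((\<omega> + 2 * r - 1) choose \<omega>) *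
           of_nat ((2 * p + 2 * q - 1 - 2 * k - \<sigma> - \<rho> - \<omega>) choose (2 * p - 1)) * (- 1) ^ (\<sigma> + \<rho> + \<omega>) * 2 powi (int \<sigma> - 2 * int u - int \<rho>)))))
     + 2 * (\<Sum>k=0..v. Lam p q r u v s k *
         (\<Sum>\<sigma>=0..2 * q - 1. of_nat ((\<sigma> + 2 * v - 2 * k) choose \<sigma>) *
         (\<Sum>\<rho>=0..2 * q - 1 - \<sigma>. of_nat ((\<rho> + 2 * u - 1) choose \<rho>) *
         (\<Sum>\<omega>=0..2 * q - 1 - \<sigma> - \<rho>. of_nat ((\<omega> + 2 * r - 1) choose \<omega>) *
           of_nat ((2 * p + 2 * q - 2 - \<sigma> - \<rho> - \<omega>) choose (2 * p - 1)) * (- 1) ^ (\<sigma> + \<rho> + \<omega>) * 2 powi (int \<sigma> - 2 * int u - int \<rho>)))))"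

definition I4 :: "nat \<Rightarrow> nat \<Rightarrow> nat \<Rightarrow> nat \<Rightarrow> nat \<Rightarrow> complex \<Rightarrow> complex" where
  "I4 p q r u v s =
     2 * (\<Sum>k=0..u. zeta (2 * of_nat k) * zeta (wk p q r u v s k) *
         (\<Sum>\<sigma>=0..2 * u - 2 * k. of_nat ((\<sigma> + 2 * v - 1) choose \<sigma>) *
         (\<Sum>\<rho>=0..2 * q - 1. of_nat ((\<rho> + 2 * u - 2 * k - \<sigma>) choose \<rho>) *
         (\<Sum>\<omega>=0..2 * q - 1 - \<rho>. of_nat ((\<omega> + 2 * r - 1) choose \<omega>) *
           of_nat ((2 * p + 2 * q - 2 - \<rho> - \<omega>) choose (2 * p - 1)) * (- 1) ^ (\<rho> + \<omega>) * 2 powi (- 2 * int u + 2 * int k + 2 * int \<sigma> - int \<rho> - 1) * 3 powi (- 2 * int v - int \<sigma>)))))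
     + 2 * (\<Sum>k=0..v. Lam p q r u v s k *
         (\<Sum>\<sigma>=0..2 * u - 1. of_nat ((\<sigma> + 2 * v - 2 * k) choose \<sigma>) *
         (\<Sum>\<rho>=0..2 * q - 1. of_nat ((\<rho> + 2 * u - 1 - \<sigma>) choose \<rho>) *
         (\<Sum>\<omega>=0..2 * q - 1 - \<rho>. of_nat ((\<omega> + 2 * r - 1) choose \<omega>) *
           of_nat ((2 * p + 2 * q - 2 - \<rho> - \<omega>) choose (2 * p - 1)) * (- 1) ^ (\<rho> + \<omega>) * 2 powi (- 2 * int u + 2 * int \<sigma> - int \<rho>) * 3 powi (- 2 * int v + 2 * int k - int \<sigma> - 1)))))"

definition I5 :: "nat \<Rightarrow> nat \<Rightarrow> nat \<Rightarrow> nat \<Rightarrow> nat \<Rightarrow> complex \<Rightarrow> complex" where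
  "I5 p q r u v s =
     - 2 * (\<Sum>k=0..r. zeta (2 * of_nat k) * zeta (wk p q r u v s k) *
         (\<Sum>\<sigma>=0..2 * r - 2 * k. of_nat ((\<sigma> + 2 * v - 1) choose \<sigma>) *
         (\<Sum>\<rho>=0..2 * r - 2 * k - \<sigma>. of_nat ((\<rho> + 2 * u - 1) choose \<rho>) *
         (\<Sum>\<omega>=0..2 * p - 1. of_nat ((\<omega> + 2 * r - 2 * k - \<sigma> - \<rho>) choose \<omega>) *
           of_nat ((2 * p + 2 * q - 2 - \<omega>) choose (2 * q - 1)) * (- 1) ^ \<rho> * 2 powi (- 2 * int r + 2 * int k + 2 * int \<sigma> + int \<rho> - int \<omega> - 1)))))
     - 2 * (\<Sum>k=0..v. Lam p q r u v s k *
         (\<Sum>\<sigma>=0..2 * r - 1. of_nat ((\<sigma> + 2 * v - 2 * k) choose \<sigma>) *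
         (\<Sum>\<rho>=0..2 * r - 1 - \<sigma>. of_nat ((\<rho> + 2 * u - 1) choose \<rho>) *
         (\<Sum>\<omega>=0..2 * p - 1. of_nat ((\<omega> + 2 * r - 1 - \<sigma> - \<rho>) choose \<omega>) *
           of_nat ((2 * p + 2 * q - 2 - \<omega>) choose (2 * q - 1)) * (- 1) ^ \<rho> * 2 powi (- 2 * int r + 2 * int \<sigma> + int \<rho> - int \<omega>)))))"

definition I6 :: "nat \<Rightarrow> nat \<Rightarrow> nat \<Rightarrow> nat \<Rightarrow> nat \<Rightarrow> complex \<Rightarrow> complex" where
  "I6 p q r u v s =
     2 * (\<Sum>k=0..u. zeta (2 * of_nat k) * zeta (wk p q r u v s k) *
         (\<Sum>\<sigma>=0..2 * u - 2 * k. of_nat ((\<sigma> + 2 * v - 1) choose \<sigma>) *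
         (\<Sum>\<rho>=0..2 * r - 1. of_nat ((\<rho> + 2 * u - 2 * k - \<sigma>) choose \<rho>) *
         (\<Sum>\<omega>=0..2 * p - 1. of_nat ((\<omega> + 2 * r - 1 - \<rho>) choose \<omega>) *
           of_nat ((2 * p + 2 * q - 2 - \<omega>) choose (2 * q - 1)) * (- 1) ^ \<rho> * 2 powi (- 2 * int r + int \<sigma> + int \<rho> - int \<omega>) * 3 powi (- 2 * int v - int \<sigma>)))))
     + 2 * (\<Sum>k=0..v. Lam p q r u v s k *
         (\<Sum>\<sigma>=0..2 * u - 1. of_nat ((\<sigma> + 2 * v - 2 * k) choose \<sigma>) *
         (\<Sum>\<rho>=0..2 * r - 1. of_nat ((\<rho> + 2 * u - 1 - \<sigma>) choose \<rho>) *
         (\<Sum>\<omega>=0..2 * p - 1. of_nat ((\<omega> + 2 * r - 1 - \<rho>) choose \<omega>) *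
           of_nat ((2 * p + 2 * q - 2 - \<omega>) choose (2 * q - 1)) * (- 1) ^ \<rho> * 2 powi (- 2 * int r + int \<sigma> + int \<rho> - int \<omega>) * 3 powi (- 2 * int v + 2 * int k - int \<sigma> - 1)))))"

definition I7 :: "nat \<Rightarrow> nat \<Rightarrow> nat \<Rightarrow> nat \<Rightarrow> nat \<Rightarrow> complex \<Rightarrow> complex" where
  "I7 p q r u v s =
     2 * (\<Sum>k=0..r. zeta (2 * of_nat k) * zeta (wk p q r u v s k) *
         (\<Sum>\<sigma>=0..2 * r - 2 * k. of_nat ((\<sigma> + 2 * v - 1) choose \<sigma>) *
         (\<Sum>\<rho>=0..2 * r - 2 * k - \<sigma>. of_nat ((\<rho> + 2 * u - 1) choose \<rho>) *
         (\<Sum>\<omega>=0..2 * q - 1. of_nat ((\<omega> + 2 * r - 2 * k - \<sigma> - \<rho>) choose \<omega>) *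
           of_nat ((2 * p + 2 * q - 2 - \<omega>) choose (2 * p - 1)) * (- 1) ^ (\<rho> + \<omega>) * 2 powi (int \<sigma>)))))
     + 2 * (\<Sum>k=0..v. Lam p q r u v s k *
         (\<Sum>\<sigma>=0..2 * r - 1. of_nat ((\<sigma> + 2 * v - 2 * k) choose \<sigma>) *
         (\<Sum>\<rho>=0..2 * r - 1 - \<sigma>. of_nat ((\<rho> + 2 * u - 1) choose \<rho>) *
         (\<Sum>\<omega>=0..2 * q - 1. of_nat ((\<omega> + 2 * r - 1 - \<sigma> - \<rho>) choose \<omega>) *
           of_nat ((2 * p + 2 * q - 2 - \<omega>) choose (2 * p - 1)) * (- 1) ^ (\<rho> + \<omega>) * 2 powi (int \<sigma>)))))"

definition I8 :: "nat \<Rightarrow> nat \<Rightarrow> nat \<Rightarrow> nat \<Rightarrow> nat \<Rightarrow> complex \<Rightarrow> complex" where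
  "I8 p q r u v s =
     - 2 * (\<Sum>k=0..u. zeta (2 * of_nat k) * zeta (wk p q r u v s k) *
         (\<Sum>\<sigma>=0..2 * u - 2 * k. of_nat ((\<sigma> + 2 * v - 1) choose \<sigma>) *
         (\<Sum>\<rho>=0..2 * r - 1. of_nat ((\<rho> + 2 * u - 2 * k - \<sigma>) choose \<rho>) *
         (\<Sum>\<omega>=0..2 * q - 1. of_nat ((\<omega> + 2 * r - 1 - \<rho>) choose \<omega>) *
           of_nat ((2 * p + 2 * q - 2 - \<omega>) choose (2 * p - 1)) * (- 1) ^ (\<rho> + \<omega>) * 2 powi (int \<sigma>) * 3 powi (- 2 * int v - int \<sigma>)))))
     - 2 * (\<Sum>k=0..v. Lam p q r u v s k *
         (\<Sum>\<sigma>=0..2 * u - 1. of_nat ((\<sigma> + 2 * v - 2 * k) choose \<sigma>) *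
         (\<Sum>\<rho>=0..2 * r - 1. of_nat ((\<rho> + 2 * u - 1 - \<sigma>) choose \<rho>) *
         (\<Sum>\<omega>=0..2 * q - 1. of_nat ((\<omega> + 2 * r - 1 - \<rho>) choose \<omega>) *
           of_nat ((2 * p + 2 * q - 2 - \<omega>) choose (2 * p - 1)) * (- 1) ^ (\<rho> + \<omega>) * 2 powi (int \<sigma>) * 3 powi (- 2 * int v + 2 * int k - int \<sigma> - 1)))))"

end

theory Submission
  imports Defs
begin

text \<open>On each of the six lines the series converges absolutely for \<open>Re s > 2\<close>, and the six domains of
  summation are the chambers into which the zeros of the linear forms divide the half plane of pairs \<open>(n, m)\<close>
  with \<open>n \<ge> 1\<close>. Hence the six series add up to the sum over \<open>n \<ge> 1\<close> of \<open>n powr (-s)\<close> times the sum of a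
  rational function of \<open>m / n\<close>, with poles at \<open>0, -1, -2, -3, -3/2\<close>, over all integers \<open>m\<close> off the poles.
  Expanding it in partial fractions, a principal part of even order \<open>2k\<close> contributes \<open>2 \<zeta>(2k)\<close>, one of odd
  order cancels under \<open>m \<mapsto> -m\<close>, and omitting the poles from the sum contributes minus the constant Laurent
  coefficient, which is the case \<open>k = 0\<close> because \<open>2 \<zeta>(0) = -1\<close>. At the pole \<open>-3/2\<close> the parity of \<open>n\<close>
  matters, which produces \<open>\<Lambda>\<^sub>k\<close>. The functions \<open>I\<^sub>1, \<dots>, I\<^sub>8\<close> collect the Laurent coefficients computed by
  splitting off one pole after the other. The identity extends to all \<open>s\<close> by analytic continuation along the
  lines, each of which meets the possible singularities in a countable set.\<close>

section \<open>Continuation of the zeta function\<close>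

text \<open>Principal parts of order one are not absolutely summable, so for fixed \<open>n\<close>
  the sum over \<open>m\<close> is evaluated through limits of sums over symmetric windows, and the
  unconditional sum furnished by the chambers is identified with that limit. Partial fractions are
  proved for formal power series instead of values: the constant coefficient gives the usual
  decomposition, while the higher coefficients, taken at a further pole, are the Laurent
  coefficients there. This is what produces nested sums with one level for each pole split off.
  Since \<open>zeta\<close> is a definite description, a continuation has to be built before
  anything can be said about it, including its value at 0. In six variables no continuation is
  built: regularity at \<open>s\<close> supplies one, and its uniqueness is reduced to one variable
  by restriction to complex lines. The exceptional set is controlled by countability alone: its
  complement in the plane is connected and meets every disc.\<close>

lemma holomorphic_on_series:
  fixes u :: "nat \<Rightarrow> complex \<Rightarrow> complex"
  assumes "open S" and "\<And>n. u n holomorphic_on S"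
    and bound: "\<And>x. x \<in> S \<Longrightarrow> \<exists>d>0. cball x d \<subseteq> S \<and>
      (\<exists>M. summable M \<and> (\<forall>n. \<forall>y\<in>cball x d. norm (u n y) \<le> M n))"
  shows "(\<lambda>s. \<Sum>n. u n s) holomorphic_on S" and "\<And>s. s \<in> S \<Longrightarrow> summable (\<lambda>n. u n s)"
proof -
  show "(\<lambda>s. \<Sum>n. u n s) holomorphic_on S"
  proof (rule holomorphic_uniform_sequence[OF \<open>open S\<close>])
    show "(\<lambda>s. \<Sum>i<n. u i s) holomorphic_on S" for n
      by (intro holomorphic_intros assms)
    show "\<exists>d>0. cball x d \<subseteq> S \<and>
        uniform_limit (cball x d) (\<lambda>n s. \<Sum>i<n. u i s) (\<lambda>s. \<Sum>n. u n s) sequentially"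
      if x: "x \<in> S" for x
    proof -
      obtain d M where "d > 0" "cball x d \<subseteq> S" "summable M" "\<forall>n. \<forall>y\<in>cball x d. norm (u n y) \<le> M n"
        using bound[OF x] by blast
      moreover from this have "uniform_limit (cball x d) (\<lambda>n s. \<Sum>i<n. u i s) (\<lambda>s. \<Sum>n. u n s) sequentially"
        by (intro Weierstrass_m_test) auto
      ultimately show ?thesis by blast
    qed
  qed
  show "summable (\<lambda>n. u n s)" if s: "s \<in> S" for s
  proof -
    obtain d M where "d > 0" "summable M" "\<forall>n. \<forall>y\<in>cball s d. norm (u n y) \<le> M n"
      using bound[OF s] by blast
    then show ?thesis by (intro summable_comparison_test[of "\<lambda>n. u n s" M]) auto
  qed
qed

section \<open>Binomial remainders and convergence in half planes\<close>

lemma norm_of_nat_powr: "n > 0 \<Longrightarrow> norm (of_nat n powr s :: complex) = real n powr Re s"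
  by (subst norm_powr_real_powr) auto

lemma summable_Suc_powr: "a < -1 \<Longrightarrow> summable (\<lambda>n. real (Suc n) powr a)"
  using summable_Suc_iff[of "\<lambda>n. real n powr a"] summable_real_powr_iff[of a] by simp

text \<open>Error of the binomial expansion of \<open>(N + 1) powr (1 - s)\<close> in powers of
  \<open>N = Suc n\<close>, cut off after the term \<open>k = K\<close>. Each further term gains one
  power of \<open>N\<close>, so the sum of the errors over \<open>n\<close> converges one unit
  further to the left.\<close>

definition zeta_rem :: "nat \<Rightarrow> nat \<Rightarrow> complex \<Rightarrow> complex" where
  "zeta_rem K n s = of_nat (Suc (Suc n)) powr (1 - s) -
     (\<Sum>k\<le>K. ((1 - s) gchoose k) * of_nat (Suc n) powr (1 - s - of_nat k))"

text \<open>Taylor's formula along the real segment from 0 to 1. There \<open>1 + y\<close> lies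
  between 1 and 2, which yields the power of 2 whatever the sign of the exponent;
  \<open>Suc K\<close> is what remains of \<open>fact (Suc K) / fact K\<close>.\<close>

lemma norm_binomial_remainder_le:
  fixes z :: complex and x :: real
  assumes x: "0 \<le> x" "x \<le> 1"
  shows "norm ((1 + of_real x) powr z - (\<Sum>k\<le>K. (z gchoose k) * of_real x ^ k)) \<le>
    (real (Suc K) * norm (z gchoose Suc K) * 2 powr \<bar>Re z - real (Suc K)\<bar>) * x ^ Suc K"
proof -
  define S where "S = closed_segment 0 (1::complex)"
  have S: "Im y = 0 \<and> 0 \<le> Re y \<and> Re y \<le> 1" if "y \<in> S" for y
    using that by (auto simp: S_def closed_segment_def)
  \<comment> \<open>\<open>f i\<close> is the \<open>i\<close>-th derivative of
    \<open>(1 + y) powr z\<close>: the factor \<open>fact i * (z gchoose i)\<close> is the falling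
    factorial that differentiation produces.\<close>
  define f where "f = (\<lambda>i y. fact i * (z gchoose i) * (1 + y) powr (z - of_nat i))"
  have "norm (f 0 (of_real x) - (\<Sum>i\<le>K. f i 0 * (of_real x - 0) ^ i / fact i)) \<le>
      (fact (Suc K) * norm (z gchoose Suc K) * 2 powr \<bar>Re z - real (Suc K)\<bar>) * norm (of_real x - (0::complex)) ^ Suc K / fact K"
  proof (rule complex_Taylor)
    show "convex S" by (simp add: S_def)
    show "(f i has_field_derivative f (Suc i) y) (at y within S)" if "y \<in> S" for i y
    proof -
      have "1 + y \<notin> \<real>\<^sub>\<le>\<^sub>0"
        using S[OF that] by (auto simp: complex_nonpos_Reals_iff)
      then have "((\<lambda>y. (1 + y) powr (z - of_nat i)) has_field_derivative
          (z - of_nat i) * (1 + y) powr (z - of_nat i - 1)) (at y within S)"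
        by (auto intro!: derivative_eq_intros)
      then have "(f i has_field_derivative fact i * (z gchoose i) *
          ((z - of_nat i) * (1 + y) powr (z - of_nat i - 1))) (at y within S)"
        unfolding f_def by (rule DERIV_cmult)
      moreover have "fact i * (z gchoose i) * ((z - of_nat i) * (1 + y) powr (z - of_nat i - 1)) = f (Suc i) y"
      proof -
        have "fact i * (z gchoose i) * (z - of_nat i) = fact (Suc i) * (z gchoose Suc i)"
          by (simp add: gbinomial_prod_rev del: of_nat_Suc)
        then have "fact i * (z gchoose i) * (z - of_nat i) * (1 + y) powr (z - of_nat (Suc i)) = f (Suc i) y"
          by (simp only: f_def)
        moreover have "z - of_nat (Suc i) = z - of_nat i - 1" by simp
        ultimately show ?thesis by (simp only: mult.assoc)
      qed
      ultimately show ?thesis by simp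
    qed
    show "norm (f (Suc K) y) \<le> fact (Suc K) * norm (z gchoose Suc K) * 2 powr \<bar>Re z - real (Suc K)\<bar>"
      if "y \<in> S" for y
    proof -
      have y: "1 + y = of_real (1 + Re y)" using S[OF that] by (simp add: complex_eq_iff)
      have "norm ((1 + y) powr (z - of_nat (Suc K))) = (1 + Re y) powr (Re z - real (Suc K))"
        unfolding y using S[OF that] by (subst norm_powr_real_powr) auto
      also have "\<dots> \<le> (1 + Re y) powr \<bar>Re z - real (Suc K)\<bar>"
        using S[OF that] by (intro powr_mono) auto
      also have "\<dots> \<le> 2 powr \<bar>Re z - real (Suc K)\<bar>"
        using S[OF that] by (intro powr_mono2) auto
      finally show ?thesis
        by (simp add: f_def norm_mult mult_left_mono del: of_nat_Suc fact_Suc)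
    qed
    show "0 \<in> S" by (simp add: S_def)
    show "of_real x \<in> S" using x
      by (auto simp: S_def closed_segment_def scaleR_conv_of_real intro!: exI[of _ x])
  qed
  moreover have "f 0 (of_real x) = (1 + of_real x) powr z" by (simp add: f_def)
  moreover have "f i 0 * (of_real x - 0) ^ i / fact i = (z gchoose i) * of_real x ^ i" for i
    by (simp add: f_def)
  ultimately show ?thesis using x by (simp add: mult_ac)
qed

lemma norm_zeta_rem_le:
  "norm (zeta_rem K n s) \<le> real (Suc K) * norm ((1 - s) gchoose Suc K) * 2 powr \<bar>Re s + real K\<bar> *
     real (Suc n) powr (- Re s - real K)"
proof -
  define N where "N = real (Suc n)"
  have N: "N \<ge> 1" by (simp add: N_def)
  \<comment> \<open>Splitting off \<open>N powr (1 - s)\<close> reduces the estimate to the binomial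
    remainder at \<open>x = 1 / N\<close>.\<close>
  have "of_nat (Suc (Suc n)) = (of_real N * (1 + of_real (1 / N)) :: complex)"
    using of_nat_neq_0[of n, where ?'a = complex] by (simp add: N_def distrib_left del: of_nat_Suc) simp
  moreover have "(1 :: complex) + of_real (1/N) = of_real (1 + 1/N)" by simp
  ultimately have "of_nat (Suc (Suc n)) powr (1 - s) = of_real N powr (1 - s) * (1 + of_real (1/N)) powr (1 - s)"
    using N by (simp only: powr_times_real) (simp add: powr_times_real)
  moreover have "of_nat (Suc n) powr (1 - s - of_nat k) = of_real N powr (1 - s) * of_real (1/N) ^ k" for k
    using N by (simp add: powr_diff N_def powr_nat' power_divide del: of_nat_Suc)
  ultimately have "zeta_rem K n s = of_real N powr (1 - s) *
      ((1 + of_real (1/N)) powr (1 - s) - (\<Sum>k\<le>K. ((1 - s) gchoose k) * of_real (1/N) ^ k))"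
    unfolding zeta_rem_def by (simp add: algebra_simps sum_distrib_left)
  also have "norm \<dots> \<le> N powr (1 - Re s) *
     ((real (Suc K) * norm ((1 - s) gchoose Suc K) * 2 powr \<bar>Re (1 - s) - real (Suc K)\<bar>) * (1/N) ^ Suc K)"
    unfolding norm_mult
    using N by (intro mult_mono norm_binomial_remainder_le) (auto simp: norm_powr_real_powr)
  also have "\<dots> = real (Suc K) * norm ((1 - s) gchoose Suc K) * 2 powr \<bar>Re s + real K\<bar> * (N powr (1 - Re s) * (1/N) ^ Suc K)"
  proof -
    have "\<bar>Re (1 - s) - real (Suc K)\<bar> = \<bar>Re s + real K\<bar>" by simp
    then show ?thesis by (simp only: mult_ac)
  qed
  also have "N powr (1 - Re s) * (1/N) ^ Suc K = N powr (- Re s - real K)"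
  proof -
    have "(1/N) ^ Suc K = N powr (- real (Suc K))"
      using N by (simp add: powr_minus powr_realpow power_inverse divide_inverse del: of_nat_Suc power_Suc)
    then show ?thesis using N by (simp add: powr_add[symmetric])
  qed
  finally show ?thesis by (simp add: N_def)
qed

lemma summable_zeta_rem: "Re s > 1 - real K \<Longrightarrow> summable (\<lambda>n. zeta_rem K n s)"
  and holomorphic_zeta_rem: "(\<lambda>s. \<Sum>n. zeta_rem K n s) holomorphic_on {s. Re s > 1 - real K}"
proof -
  define S where "S = {s. Re s > 1 - real K}"
  have open_S: "open S" by (simp add: S_def open_halfspace_Re_gt)
  have hol: "zeta_rem K n holomorphic_on S" for n
    unfolding zeta_rem_def[abs_def] gbinomial_prod_rev
    by (intro holomorphic_intros) auto
  have bound: "\<exists>d>0. cball x d \<subseteq> S \<and>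
      (\<exists>M. summable M \<and> (\<forall>n. \<forall>y\<in>cball x d. norm (zeta_rem K n y) \<le> M n))" if x: "x \<in> S" for x
  proof -
    \<comment> \<open>Half the distance to the boundary line: on the disc the exponent of
      \<open>Suc n\<close> stays at most \<open>- 1 - d\<close>, which gives one summable majorant
      for all points.\<close>
    define d where "d = (Re x - (1 - real K)) / 2"
    have d: "d > 0" using x by (simp add: d_def S_def)
    have Re_ge: "Re y \<ge> 1 - real K + d" if "y \<in> cball x d" for y
    proof -
      have "\<bar>Re x - Re y\<bar> \<le> d"
        using that abs_Re_le_cmod[of "x - y"] by (simp add: dist_norm)
      then have "Re x - Re y \<le> d" by linarith
      moreover have "Re x = 1 - real K + 2 * d" by (simp add: d_def field_simps)
      ultimately show ?thesis by linarith
    qed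
    \<comment> \<open>The part of the bound that does not depend on \<open>n\<close>. The
      generalised binomial coefficient is a polynomial in \<open>y\<close>, so \<open>g\<close> is
      continuous and hence bounded on the compact disc.\<close>
    define g where "g = (\<lambda>y. real (Suc K) * norm ((1 - y) gchoose Suc K) * 2 powr \<bar>Re y + real K\<bar>)"
    have "continuous_on (cball x d) g"
      unfolding g_def gbinomial_prod_rev
      by (intro continuous_intros) (auto simp del: fact_Suc of_nat_Suc)
    then have "bounded (g ` cball x d)"
      by (intro compact_imp_bounded compact_continuous_image) auto
    then obtain C where C: "\<And>y. y \<in> cball x d \<Longrightarrow> norm (g y) \<le> C"
      unfolding bounded_iff by blast
    have "norm (zeta_rem K n y) \<le> C * real (Suc n) powr (- 1 - d)" if y: "y \<in> cball x d" for n y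
    proof -
      have "norm (zeta_rem K n y) \<le> g y * real (Suc n) powr (- Re y - real K)"
        unfolding g_def by (rule norm_zeta_rem_le)
      also have "\<dots> \<le> C * real (Suc n) powr (- 1 - d)"
      proof (rule mult_mono)
        show "g y \<le> C" using C[OF y] by simp
        show "real (Suc n) powr (- Re y - real K) \<le> real (Suc n) powr (- 1 - d)"
          using Re_ge[OF y] by (intro powr_mono) auto
        show "0 \<le> C" using C[OF y] norm_ge_zero order_trans by blast
      qed simp
      finally show ?thesis .
    qed
    moreover have "summable (\<lambda>n. C * real (Suc n) powr (- 1 - d))"
      using d by (intro summable_mult summable_Suc_powr) auto
    moreover have "cball x d \<subseteq> S" using Re_ge d by (force simp: S_def)
    ultimately show ?thesis using d by blast
  qed
  show "(\<lambda>s. \<Sum>n. zeta_rem K n s) holomorphic_on {s. Re s > 1 - real K}"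
    using holomorphic_on_series(1)[OF open_S hol bound] by (simp add: S_def)
  show "summable (\<lambda>n. zeta_rem K n s)" if "Re s > 1 - real K"
    using holomorphic_on_series(2)[OF open_S hol bound] that by (simp add: S_def)
qed

lemma summable_zeta: "Re s > 1 \<Longrightarrow> summable (\<lambda>n. 1 / of_nat (Suc n) powr s :: complex)"
  and holomorphic_zeta_series:
    "(\<lambda>s. \<Sum>n. 1 / of_nat (Suc n) powr s :: complex) holomorphic_on {s. Re s > 1}"
proof -
  define S where "S = {s. Re s > 1}"
  have open_S: "open S" by (simp add: S_def open_halfspace_Re_gt)
  have hol: "(\<lambda>s. 1 / of_nat (Suc n) powr s :: complex) holomorphic_on S" for n
    by (intro holomorphic_intros) (auto simp del: of_nat_Suc)
  have bound: "\<exists>d>0. cball x d \<subseteq> S \<and>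
      (\<exists>M. summable M \<and> (\<forall>n. \<forall>y\<in>cball x d. norm (1 / of_nat (Suc n) powr y :: complex) \<le> M n))" if x: "x \<in> S" for x
  proof -
    define d where "d = (Re x - 1) / 2"
    have d: "d > 0" using x by (simp add: d_def S_def)
    have Re_ge: "Re y \<ge> 1 + d" if "y \<in> cball x d" for y
    proof -
      have "\<bar>Re x - Re y\<bar> \<le> d"
        using that abs_Re_le_cmod[of "x - y"] by (simp add: dist_norm)
      then have "Re x - Re y \<le> d" by linarith
      moreover have "Re x = 1 + 2 * d" by (simp add: d_def field_simps)
      ultimately show ?thesis by linarith
    qed
    have "norm (1 / of_nat (Suc n) powr y :: complex) \<le> real (Suc n) powr (- 1 - d)" if y: "y \<in> cball x d" for n y
    proof -
      have "norm (1 / of_nat (Suc n) powr y :: complex) = real (Suc n) powr (- Re y)"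
        by (simp add: norm_divide norm_inverse norm_of_nat_powr powr_minus divide_inverse del: of_nat_Suc)
      also have "\<dots> \<le> real (Suc n) powr (- 1 - d)"
        using Re_ge[OF y] by (intro powr_mono) auto
      finally show ?thesis .
    qed
    moreover have "summable (\<lambda>n. real (Suc n) powr (- 1 - d))"
      using d by (intro summable_Suc_powr) auto
    moreover have "cball x d \<subseteq> S" using Re_ge d by (force simp: S_def)
    ultimately show ?thesis using d by blast
  qed
  show "(\<lambda>s. \<Sum>n. 1 / of_nat (Suc n) powr s :: complex) holomorphic_on {s. Re s > 1}"
    using holomorphic_on_series(1)[OF open_S hol bound] by (simp add: S_def)
  show "summable (\<lambda>n. 1 / of_nat (Suc n) powr s :: complex)" if "Re s > 1"
    using holomorphic_on_series(2)[OF open_S hol bound] that by (simp add: S_def)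
qed

text \<open>Summing \<open>n powr (1 - s) - (n + 1) powr (1 - s)\<close> over \<open>n\<close> telescopes to 1; expanding the
  second power binomially expresses \<open>(s - 1) \<zeta>(s)\<close> through \<open>\<zeta>(s + 1), \<zeta>(s + 2), \<dots>\<close>.\<close>

lemma zeta_series_recurrence:
  fixes s :: complex
  defines "Z \<equiv> \<lambda>s. \<Sum>n. 1 / of_nat (Suc n) powr s :: complex"
  assumes s: "Re s > 1" and K: "K > 0"
  shows "(s - 1) * Z s = 1 + (\<Sum>n. zeta_rem K n s) + (\<Sum>k=2..K. ((1 - s) gchoose k) * Z (s + of_nat k - 1))"
proof -
  have Z: "(\<lambda>n. of_nat (Suc n) powr (1 - (s + of_nat k))) sums Z (s + of_nat k - 1)" if "k > 0" for k
  proof -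
    have "(\<lambda>n. 1 / of_nat (Suc n) powr (s + of_nat k - 1)) sums Z (s + of_nat k - 1)"
      unfolding Z_def using that s by (intro summable_sums summable_zeta) auto
    moreover have "1 / of_nat (Suc n) powr (s + of_nat k - 1) = (of_nat (Suc n) powr (1 - (s + of_nat k)) :: complex)" for n
    proof -
      have e: "1 - (s + of_nat k) = - (s + of_nat k - 1)" by simp
      show ?thesis unfolding e powr_minus by (simp only: divide_inverse mult_1)
    qed
    ultimately show ?thesis by (simp only:)
  qed
  have rem: "(\<lambda>n. zeta_rem K n s) sums (\<Sum>n. zeta_rem K n s)"
    using s K by (intro summable_sums summable_zeta_rem) auto
  have "(\<lambda>n. (of_nat (Suc n) :: complex) powr (1 - s)) \<longlonglongrightarrow> 0"
  proof (rule tendsto_norm_zero_cancel)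
    have "((\<lambda>n. real (Suc n) powr (1 - Re s)) \<longlongrightarrow> 0) sequentially"
      using s by (intro tendsto_neg_powr filterlim_compose[OF filterlim_real_sequentially filterlim_Suc]) auto
    then show "(\<lambda>n. norm ((of_nat (Suc n) :: complex) powr (1 - s))) \<longlonglongrightarrow> 0"
      by (simp add: norm_of_nat_powr del: of_nat_Suc)
  qed
  from telescope_sums'[OF this]
  have "(\<lambda>n. of_nat (Suc n) powr (1 - s) - of_nat (Suc (Suc n)) powr (1 - s)) sums (1 :: complex)"
    by simp
  moreover have "(\<lambda>n. of_nat (Suc n) powr (1 - s) - of_nat (Suc (Suc n)) powr (1 - s)) sums
      (- (\<Sum>k=1..K. ((1 - s) gchoose k) * Z (s + of_nat k - 1)) - (\<Sum>n. zeta_rem K n s))"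
  proof -
    have "(\<lambda>n. - (\<Sum>k=1..K. ((1 - s) gchoose k) * of_nat (Suc n) powr (1 - (s + of_nat k))) - zeta_rem K n s) sums
        (- (\<Sum>k=1..K. ((1 - s) gchoose k) * Z (s + of_nat k - 1)) - (\<Sum>n. zeta_rem K n s))"
      by (intro sums_diff sums_minus sums_sum sums_mult Z rem) auto
    moreover have "- (\<Sum>k=1..K. ((1 - s) gchoose k) * of_nat (Suc n) powr (1 - (s + of_nat k))) - zeta_rem K n s
        = of_nat (Suc n) powr (1 - s) - of_nat (Suc (Suc n)) powr (1 - s)" for n
    proof -
      \<comment> \<open>The term \<open>k = 0\<close> of the expansion is the first power of the
        difference and disappears against it. The term \<open>k = 1\<close> is split off later and
        becomes the left-hand side.\<close>
      have "{..K} = insert 0 {1..K}" by auto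
      then show ?thesis by (simp add: zeta_rem_def diff_diff_eq del: of_nat_Suc)
    qed
    ultimately show ?thesis by (simp only:)
  qed
  ultimately have "- (\<Sum>k=1..K. ((1 - s) gchoose k) * Z (s + of_nat k - 1)) - (\<Sum>n. zeta_rem K n s) = 1"
    using sums_unique2 by blast
  moreover have "{1..K} = insert 1 {2..K}" using K by auto
  then have "(\<Sum>k=1..K. ((1 - s) gchoose k) * Z (s + of_nat k - 1)) =
      (1 - s) * Z s + (\<Sum>k=2..K. ((1 - s) gchoose k) * Z (s + of_nat k - 1))" by simp
  ultimately have "- ((1 - s) * Z s + (\<Sum>k=2..K. ((1 - s) gchoose k) * Z (s + of_nat k - 1))) -
      (\<Sum>n. zeta_rem K n s) = 1" by simp
  then show ?thesis by algebra
qed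

text \<open>Multiplication by \<open>s - 1\<close> removes the pole, and extracting the factor
  \<open>s + k - 2\<close> from \<open>(1 - s) gchoose k\<close> turns every shifted zeta value of
  the recurrence into a value of \<open>Z\<close> without dividing by a function of
  \<open>s\<close>. The right-hand side then refers to \<open>Z\<close> only at points at least one
  unit further right, so each application gains a strip of width 1. The recurrence is part of the
  conclusion because special values are read off from it.\<close>

lemma zeta_series_continuation:
  defines "\<zeta> \<equiv> \<lambda>s. \<Sum>n. 1 / of_nat (Suc n) powr s :: complex"
  obtains Z where "Z holomorphic_on UNIV" "\<And>s. Re s > 1 \<Longrightarrow> Z s = (s - 1) * \<zeta> s"
    and "\<And>K s. K > 0 \<Longrightarrow> Re s > 1 - real K \<Longrightarrow> Z s = 1 + (\<Sum>n. zeta_rem K n s) +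
          (\<Sum>k=2..K. - ((1 - s) gchoose (k - 1)) / of_nat k * Z (s + of_nat k - 1))"
proof -
  define H where "H = (\<lambda>m. {s::complex. Re s > 1 - real m})"
  define rhs where "rhs = (\<lambda>K Z s. 1 + (\<Sum>n. zeta_rem K n s) +
          (\<Sum>k=2..K. - ((1 - s) gchoose (k - 1)) / of_nat k * Z (s + of_nat k - 1 :: complex)))"
  have H: "open (H m)" "connected (H m)" for m
    unfolding H_def by (auto intro: open_halfspace_Re_gt convex_connected convex_halfspace_Re_gt)
  have H_mono: "H m \<subseteq> H n" if "m \<le> n" for m n using that by (auto simp: H_def)
  have H0: "H 0 = {s. Re s > 1}" by (simp add: H_def)
  then have "2 \<in> H 0" by simp
  then have H0_ne: "H 0 \<noteq> {}" by blast
  have rhs_hol: "rhs K Z holomorphic_on H K" if "Z holomorphic_on H (K - 1)" "K > 0" for K Z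
  proof -
    have "(\<lambda>s. Z (s + of_nat k - 1)) holomorphic_on H K" if "k \<in> {2..K}" for k
    proof -
      have "(Z \<circ> (\<lambda>s. s + of_nat k - 1)) holomorphic_on H K"
        using that \<open>K > 0\<close> by (intro holomorphic_on_compose_gen[OF _ \<open>Z holomorphic_on H (K - 1)\<close>] holomorphic_intros)
          (auto simp: H_def)
      then show ?thesis by (simp add: comp_def)
    qed
    moreover have "(\<lambda>s. \<Sum>n. zeta_rem K n s) holomorphic_on H K"
      unfolding H_def by (rule holomorphic_zeta_rem)
    ultimately show ?thesis
      unfolding rhs_def gbinomial_prod_rev
      by (intro holomorphic_on_add holomorphic_on_sum holomorphic_on_mult) (auto intro!: holomorphic_intros)
  qed
  have rhs_eq: "rhs K Z s = (s - 1) * \<zeta> s"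
    if Z: "\<And>s. s \<in> H 0 \<Longrightarrow> Z s = (s - 1) * \<zeta> s" and s: "s \<in> H 0" and K: "K > 0" for K Z s
  proof -
    have "((1 - s) gchoose k) * \<zeta> (s + of_nat k - 1) = - ((1 - s) gchoose (k - 1)) / of_nat k * Z (s + of_nat k - 1)"
      if k: "k \<in> {2..K}" for k
    proof -
      obtain j where j: "k = Suc j" using k by (cases k) auto
      have C: "(1 - s) gchoose Suc j = ((1 - s) gchoose j) * (1 - s - of_nat j) / of_nat (Suc j)"
        by (simp add: gbinomial_prod_rev)
      have "(1 - s) gchoose k = - ((1 - s) gchoose (k - 1)) / of_nat k * (s + of_nat k - 1 - 1)"
      proof -
        have e: "s + of_nat k - 1 - 1 = - (1 - s - of_nat j)" by (simp add: j)
        show ?thesis unfolding e by (simp only: j C minus_mult_minus diff_Suc_1 minus_divide_left[symmetric] times_divide_eq_left)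
      qed
      moreover have "Z (s + of_nat k - 1) = (s + of_nat k - 1 - 1) * \<zeta> (s + of_nat k - 1)"
        using s k by (intro Z) (auto simp: H_def)
      ultimately show ?thesis by (simp only: mult.assoc)
    qed
    then show ?thesis
      using zeta_series_recurrence[of s K] s K by (simp add: rhs_def \<zeta>_def H0)
  qed
  have "\<exists>Z. Z holomorphic_on H m \<and> (\<forall>s\<in>H 0. Z s = (s - 1) * \<zeta> s)" for m
  proof (induction m)
    case 0
    have "\<zeta> holomorphic_on H 0"
      unfolding \<zeta>_def H0 by (rule holomorphic_zeta_series)
    then show ?case by (intro exI[of _ "\<lambda>s. (s - 1) * \<zeta> s"]) (auto intro!: holomorphic_intros)
  next
    case (Suc m)
    then obtain Z where "Z holomorphic_on H m" "\<forall>s\<in>H 0. Z s = (s - 1) * \<zeta> s" by blast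
    then show ?case using rhs_hol[of Z "Suc m"] rhs_eq[of Z _ "Suc m"]
      by (intro exI[of _ "rhs (Suc m) Z"]) auto
  qed
  then have "\<forall>m. \<exists>Z. Z holomorphic_on H m \<and> (\<forall>s\<in>H 0. Z s = (s - 1) * \<zeta> s)" by blast
  from choice[OF this]
  obtain Y where "\<forall>m. Y m holomorphic_on H m \<and> (\<forall>s\<in>H 0. Y m s = (s - 1) * \<zeta> s)" ..
  then have Y: "Y m holomorphic_on H m" "s \<in> H 0 \<Longrightarrow> Y m s = (s - 1) * \<zeta> s" for m s
    by simp_all
  have Y_eq: "Y m s = Y n s" if "m \<le> n" "s \<in> H m" for m n s
  proof (rule analytic_continuation_open[of "H 0" "H m" "Y m" "Y n"])
    show "Y n holomorphic_on H m"
      using Y(1) H_mono[OF \<open>m \<le> n\<close>] by (rule holomorphic_on_subset)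
    show "H 0 \<subseteq> H m" by (rule H_mono) simp
  qed (use Y that(2) in \<open>simp_all add: H H0_ne\<close>)
  \<comment> \<open>A point \<open>s\<close> lies in \<open>H m\<close> exactly when
    \<open>m > 1 - Re s\<close>. The chosen index satisfies this, and by \<open>Y_eq\<close> every
    other admissible index gives the same value.\<close>
  define Z where "Z = (\<lambda>s. Y (nat \<lceil>2 - Re s\<rceil>) s)"
  have Z_eq: "Z s = Y m s" if "s \<in> H m" for m s
  proof -
    define N where "N = nat \<lceil>2 - Re s\<rceil>"
    have "s \<in> H N"
      using real_nat_ceiling_ge[of "2 - Re s"] by (auto simp: H_def N_def)
    then have "Y N s = Y m s"
      using Y_eq[of m N s, OF _ that] Y_eq[of N m s] nat_le_linear[of m N] by argo
    then show ?thesis by (simp add: Z_def N_def)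
  qed
  have Z_hol: "Z holomorphic_on H m" for m
    using Y(1)[of m] by (rule holomorphic_transform) (simp add: Z_eq)
  have "s \<in> (\<Union>m. H m)" for s
    using real_nat_ceiling_ge[of "2 - Re s"] by (auto simp: H_def intro!: exI[of _ "nat \<lceil>2 - Re s\<rceil>"])
  then have "(\<Union>m. H m) = UNIV" by blast
  moreover have "Z holomorphic_on (\<Union>m. H m)"
    using Z_hol H by (intro holomorphic_on_UN_open) auto
  ultimately have Z_UNIV: "Z holomorphic_on UNIV" by simp
  have Z_zeta: "Z s = (s - 1) * \<zeta> s" if "s \<in> H 0" for s
    using Z_eq[OF that] Y(2)[OF that] by simp
  have Z_rhs: "Z s = rhs K Z s" if "K > 0" "s \<in> H K" for K s
  proof (rule analytic_continuation_open[of "H 0" "H K" Z "rhs K Z"])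
    show "rhs K Z holomorphic_on H K" by (rule rhs_hol) (simp_all add: Z_hol that)
    show "H 0 \<subseteq> H K" by (rule H_mono) simp
    show "Z z = rhs K Z z" if "z \<in> H 0" for z
      using Z_zeta[OF that] rhs_eq[of Z z K] Z_zeta that \<open>K > 0\<close> by simp
  qed (use Z_hol that(2) in \<open>simp_all add: H H0_ne\<close>)
  show ?thesis
  proof (rule that[of Z])
    show "Z s = 1 + (\<Sum>n. zeta_rem K n s) +
          (\<Sum>k=2..K. - ((1 - s) gchoose (k - 1)) / of_nat k * Z (s + of_nat k - 1))"
      if "K > 0" "Re s > 1 - real K" for K s
      using Z_rhs[of K s] that unfolding rhs_def H_def by blast
  qed (use Z_UNIV Z_zeta H0 in auto)
qed

text \<open>The description defining \<open>zeta\<close> is met by \<open>Z s / (s - 1)\<close> with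
  value 0 at 1; uniqueness is the identity theorem on the connected punctured plane.\<close>

lemma zeta_properties:
  shows holomorphic_zeta: "zeta holomorphic_on - {1}"
    and zeta_sums: "\<And>s. Re s > 1 \<Longrightarrow> (\<lambda>n. 1 / of_nat (Suc n) powr s) sums zeta s"
    and zeta_0: "zeta 0 = - 1 / 2"
proof -
  obtain Z where Z: "Z holomorphic_on UNIV"
    and Z_eq: "\<And>s. Re s > 1 \<Longrightarrow> Z s = (s - 1) * (\<Sum>n. 1 / of_nat (Suc n) powr s)"
    and Z_rec: "\<And>K s. K > 0 \<Longrightarrow> Re s > 1 - real K \<Longrightarrow> Z s = 1 + (\<Sum>n. zeta_rem K n s) +
          (\<Sum>k=2..K. - ((1 - s) gchoose (k - 1)) / of_nat k * Z (s + of_nat k - 1))"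
    using zeta_series_continuation by blast
  define f where "f = (\<lambda>s. if s = 1 then 0 else Z s / (s - 1))"
  have f_hol: "f holomorphic_on - {1}"
  proof (rule holomorphic_transform)
    show "(\<lambda>s. Z s / (s - 1)) holomorphic_on - {1}"
      using Z by (intro holomorphic_intros) (auto intro: holomorphic_on_subset)
  qed (simp add: f_def)
  have f_sums: "(\<lambda>n. 1 / of_nat (Suc n) powr s) sums f s" if "Re s > 1" for s
  proof -
    have "s \<noteq> 1" using that by auto
    then have "f s = (\<Sum>n. 1 / of_nat (Suc n) powr s)" using Z_eq[OF that] by (simp add: f_def)
    then show ?thesis using summable_zeta[OF that] by (simp only: summable_sums)
  qed
  have "zeta = f"
    unfolding zeta_def
  proof (rule the_equality)
    show "f holomorphic_on - {1} \<and> (\<forall>s. Re s > 1 \<longrightarrow> (\<lambda>n. 1 / of_nat (Suc n) powr s) sums f s) \<and> f 1 = 0"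
      using f_hol f_sums by (simp add: f_def)
  next
    fix g :: "complex \<Rightarrow> complex"
    assume g: "g holomorphic_on - {1} \<and> (\<forall>s. Re s > 1 \<longrightarrow> (\<lambda>n. 1 / of_nat (Suc n) powr s) sums g s) \<and> g 1 = 0"
    have off_1: "g s = f s" if "s \<noteq> 1" for s
    proof (rule analytic_continuation_open[of "{s. Re s > 1}" "- {1}" g f])
      show "open {s. Re s > 1}" by (rule open_halfspace_Re_gt)
      have "2 \<in> {s. Re s > 1}" by simp
      then show "{s. Re s > 1} \<noteq> {}" by blast
      show "connected (- {1::complex})"
        by (simp add: connected_punctured_universe)
      show "g z = f z" if "z \<in> {s. Re s > 1}" for z
        using that g f_sums[of z] sums_unique2 by blast
    qed (use g f_hol that in auto)
    show "g = f"
    proof (rule ext)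
      show "g s = f s" for s
        using off_1[of s] g by (cases "s = 1") (auto simp: f_def)
    qed
  qed
  show "zeta holomorphic_on - {1}"
    using f_hol \<open>zeta = f\<close> by simp
  show "(\<lambda>n. 1 / of_nat (Suc n) powr s) sums zeta s" if "Re s > 1" for s
    using f_sums that \<open>zeta = f\<close> by simp
  \<comment> \<open>At \<open>s = 1\<close> and \<open>s = 0\<close> the exponent
    \<open>1 - s\<close> is 0 or 1, so the binomial expansion terminates and every remainder
    vanishes. The recurrence then gives \<open>Z 1 = 1\<close> and \<open>Z 0 = 1 / 2\<close>, and
    dividing by \<open>s - 1 = - 1\<close> gives the value of \<open>zeta\<close> at 0.\<close>
  have "zeta_rem 1 n 1 = 0" for n
    by (simp add: zeta_rem_def gbinomial_prod_rev del: of_nat_Suc)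
  then have "Z 1 = 1" using Z_rec[of 1 1] by simp
  moreover have "zeta_rem 2 n 0 = 0" for n
    using of_nat_neq_0[of n, where ?'a = complex]
    by (simp add: zeta_rem_def numeral_2_eq_2 gbinomial_prod_rev powr_nat')
  then have "Z 0 = 1 - 1 / 2 * Z 1" using Z_rec[of 2 0] by simp
  ultimately show "zeta 0 = - 1 / 2" by (simp add: \<open>zeta = f\<close> f_def)
qed

section \<open>Partial fractions\<close>

definition pole_fps :: "complex \<Rightarrow> nat \<Rightarrow> complex fps" where
  "pole_fps c n = Abs_fps (\<lambda>i. (-1) ^ i * of_nat ((n + i - 1) choose i) / c ^ (n + i))"
  (* the expansion of (c + X) ^ (-n); junk for c = 0 *)

lemma pole_fps_nth: "pole_fps c n $ i = (-1) ^ i * of_nat ((n + i - 1) choose i) / c ^ (n + i)"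
  by (simp add: pole_fps_def)

text \<open>True for every \<open>c\<close>: \<open>(i - 1) choose i\<close> vanishes for
  \<open>i > 0\<close>, and truncated subtraction makes it 1 at \<open>i = 0\<close>.\<close>

lemma pole_fps_0 [simp]: "pole_fps c 0 = 1"
proof (rule fps_ext)
  show "pole_fps c 0 $ i = 1 $ i" for i
    by (cases i) (simp_all add: pole_fps_nth)
qed

text \<open>Pascal's rule, read as multiplication of a series by \<open>c + X\<close>. The
  coefficientwise form is needed on its own because the coefficients of partial fractions obey the
  same relation.\<close>

lemma pole_fps_Suc_nth:
  assumes "c \<noteq> 0"
  shows "c * pole_fps c (Suc n) $ i + (if i = 0 then 0 else pole_fps c (Suc n) $ (i - 1)) = pole_fps c n $ i"
proof (cases i)
  case 0
  then show ?thesis using assms by (simp add: pole_fps_nth)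
next
  case (Suc j)
  have "c * ((-1) ^ Suc j * of_nat ((n + Suc j) choose Suc j) / c ^ (n + j + 2)) +
        (-1) ^ j * of_nat ((n + j) choose j) / c ^ (n + j + 1) =
      (-1) ^ Suc j * (of_nat ((n + Suc j) choose Suc j) - of_nat ((n + j) choose j)) / c ^ (n + j + 1)"
    using assms by (simp add: field_simps)
  moreover have "of_nat ((n + Suc j) choose Suc j) - of_nat ((n + j) choose j) =
      (of_nat ((n + j) choose Suc j) :: complex)" by simp
  ultimately show ?thesis by (simp add: Suc pole_fps_nth)
qed

lemma pole_fps_Suc:
  assumes "c \<noteq> 0"
  shows "(fps_const c + fps_X) * pole_fps c (Suc n) = pole_fps c n"
proof (rule fps_ext)
  show "((fps_const c + fps_X) * pole_fps c (Suc n)) $ i = pole_fps c n $ i" for i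
    using pole_fps_Suc_nth[OF assms, of n i] by (simp add: distrib_right)
qed

lemma pole_fps_nth_0: "pole_fps c n $ 0 = 1 / c ^ n"
  by (simp add: pole_fps_nth)

text \<open>Induction on \<open>m + n\<close>: multiplying the product by
  \<open>d - c = (d + X) - (c + X)\<close> gives a difference of two products, each with one
  exponent lowered. The coefficients are those of one factor expanded at the pole of the other, for
  instance of \<open>(d + X) ^ (-n)\<close> in powers of \<open>c + X\<close>. The case
  \<open>m = n = 0\<close> is excluded because the constant 1 is not a sum of principal
  parts.\<close>

lemma pole_fps_mult:
  assumes "c \<noteq> 0" "d \<noteq> 0" "c \<noteq> d" "m + n > 0"
  shows "pole_fps c m * pole_fps d n =
    (\<Sum>i=1..m. fps_const (pole_fps (d - c) n $ (m - i)) * pole_fps c i) +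
    (\<Sum>i=1..n. fps_const (pole_fps (c - d) m $ (n - i)) * pole_fps d i)"
  using \<open>m + n > 0\<close>
proof (induction "m + n" arbitrary: m n rule: less_induct)
  case less
  show ?case
  proof (cases "m = 0 \<or> n = 0")
    case True
    have single: "(\<Sum>i=1..k. fps_const ((1 :: complex fps) $ (k - i)) * f i) = f k" if "k > 0" for k and f :: "nat \<Rightarrow> complex fps"
    proof -
      have "(\<Sum>i=1..k. fps_const ((1 :: complex fps) $ (k - i)) * f i) = (\<Sum>i\<in>{k}. f i)"
        using that by (intro sum.mono_neutral_cong_right) auto
      then show ?thesis by simp
    qed
    show ?thesis
    proof (cases "m = 0")
      case True
      then show ?thesis using less.prems single[of n "pole_fps d"] by simp
    next
      case False
      with \<open>m = 0 \<or> n = 0\<close> have "n = 0" by simp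
      then show ?thesis using less.prems single[of m "pole_fps c"] by simp
    qed
  next
    case False
    then obtain k l where m: "m = Suc k" and n: "n = Suc l" by (metis not0_implies_Suc)
    have IH1: "pole_fps c (Suc k) * pole_fps d l =
      (\<Sum>i=1..Suc k. fps_const (pole_fps (d - c) l $ (Suc k - i)) * pole_fps c i) +
      (\<Sum>i=1..l. fps_const (pole_fps (c - d) (Suc k) $ (l - i)) * pole_fps d i)"
      by (rule less.hyps) (auto simp: m n)
    have IH2: "pole_fps c k * pole_fps d (Suc l) =
      (\<Sum>i=1..k. fps_const (pole_fps (d - c) (Suc l) $ (k - i)) * pole_fps c i) +
      (\<Sum>i=1..Suc l. fps_const (pole_fps (c - d) k $ (Suc l - i)) * pole_fps d i)"
      by (rule less.hyps) (auto simp: m n)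
    \<comment> \<open>The difference of a sum from each induction hypothesis collapses to
      \<open>x\<close> times a single sum by the Pascal relation. The shorter sum has no term at
      \<open>Suc K\<close>, which matches the case \<open>i = 0\<close> of that relation.\<close>
    have part: "(\<Sum>i=1..Suc K. fps_const (pole_fps x L $ (Suc K - i)) * f i) -
        (\<Sum>i=1..K. fps_const (pole_fps x (Suc L) $ (K - i)) * f i) =
        fps_const x * (\<Sum>i=1..Suc K. fps_const (pole_fps x (Suc L) $ (Suc K - i)) * f i)"
      if "x \<noteq> 0" for x K L and f :: "nat \<Rightarrow> complex fps"
    proof -
      have "(\<Sum>i=1..K. fps_const (pole_fps x (Suc L) $ (K - i)) * f i) =
          (\<Sum>i=1..Suc K. fps_const (if Suc K - i = 0 then 0 else pole_fps x (Suc L) $ (Suc K - i - 1)) * f i)"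
        by (rule sum.mono_neutral_cong_left) auto
      then show ?thesis
        by (simp only: sum_subtractf[symmetric] sum_distrib_left, intro sum.cong refl)
          (subst pole_fps_Suc_nth[OF that, symmetric],
            simp add: algebra_simps flip: fps_const_add fps_const_mult)
    qed
    have "fps_const (d - c) * (pole_fps c m * pole_fps d n) =
        pole_fps c m * ((fps_const d + fps_X) * pole_fps d n) - (fps_const c + fps_X) * pole_fps c m * pole_fps d n"
      by (simp add: algebra_simps flip: fps_const_sub)
    also have "\<dots> = pole_fps c (Suc k) * pole_fps d l - pole_fps c k * pole_fps d (Suc l)"
      by (simp only: m n pole_fps_Suc[OF \<open>c \<noteq> 0\<close>] pole_fps_Suc[OF \<open>d \<noteq> 0\<close>])
    also have "\<dots> = fps_const (d - c) * ((\<Sum>i=1..m. fps_const (pole_fps (d - c) n $ (m - i)) * pole_fps c i) +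
        (\<Sum>i=1..n. fps_const (pole_fps (c - d) m $ (n - i)) * pole_fps d i))"
    proof -
      have P1: "(\<Sum>i=1..Suc k. fps_const (pole_fps (d - c) l $ (Suc k - i)) * pole_fps c i) -
          (\<Sum>i=1..k. fps_const (pole_fps (d - c) (Suc l) $ (k - i)) * pole_fps c i) =
          fps_const (d - c) * (\<Sum>i=1..m. fps_const (pole_fps (d - c) n $ (m - i)) * pole_fps c i)"
        unfolding m n using \<open>c \<noteq> d\<close> by (intro part) simp
      have P2: "(\<Sum>i=1..Suc l. fps_const (pole_fps (c - d) k $ (Suc l - i)) * pole_fps d i) -
          (\<Sum>i=1..l. fps_const (pole_fps (c - d) (Suc k) $ (l - i)) * pole_fps d i) =
          fps_const (c - d) * (\<Sum>i=1..n. fps_const (pole_fps (c - d) m $ (n - i)) * pole_fps d i)"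
        unfolding m n using \<open>c \<noteq> d\<close> by (intro part) simp
      have regroup: "w + x - (y + z) = (w - y) - (z - x)" for w x y z :: "complex fps" by simp
      have minus: "fps_const (c - d) = - fps_const (d - c)" by simp
      show ?thesis
        unfolding IH1 IH2 regroup P1 P2 minus distrib_left by (simp only: mult_minus_left diff_minus_eq_add)
    qed
    finally show ?thesis using \<open>c \<noteq> d\<close> by simp
  qed
qed

text \<open>For \<open>j \<le> e a\<close>, this is the coefficient of \<open>(x - a) ^ (-j)\<close> in the Laurent expansion at \<open>a\<close> of
  the product of all \<open>(x - b) ^ (- e b)\<close> with \<open>b \<in> A\<close>.\<close>

definition laurent_coeff :: "complex set \<Rightarrow> (complex \<Rightarrow> nat) \<Rightarrow> complex \<Rightarrow> nat \<Rightarrow> complex" where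
  "laurent_coeff A e a j = (\<Prod>b\<in>A - {a}. pole_fps (a - b) (e b)) $ (e a - j)"

text \<open>A further pole \<open>a\<close> multiplies the Taylor series at \<open>b\<close> by the
  one of \<open>(x - a) ^ (- e a)\<close>, so the old coefficients are convolved with
  \<open>pole_fps (b - a) (e a)\<close>. Counting by pole order instead of Taylor index reverses the
  summation.\<close>

lemma laurent_coeff_insert:
  assumes "finite A" "a \<notin> A" "b \<in> A" "1 \<le> i" "i \<le> e b"
  shows "laurent_coeff (insert a A) e b i =
    (\<Sum>j=i..e b. laurent_coeff A e b j * pole_fps (b - a) (e a) $ (j - i))"
proof -
  have "insert a A - {b} = insert a (A - {b})" using assms by auto
  then have "laurent_coeff (insert a A) e b i =
      ((\<Prod>b'\<in>A - {b}. pole_fps (b - b') (e b')) * pole_fps (b - a) (e a)) $ (e b - i)"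
    using assms by (simp add: laurent_coeff_def mult.commute)
  also have "\<dots> = (\<Sum>j=0..e b - i. (\<Prod>b'\<in>A - {b}. pole_fps (b - b') (e b')) $ j *
      pole_fps (b - a) (e a) $ (e b - i - j))"
    by (rule fps_mult_nth)
  also have "\<dots> = (\<Sum>j=i..e b. laurent_coeff A e b j * pole_fps (b - a) (e a) $ (j - i))"
    unfolding laurent_coeff_def using assms
    by (intro sum.reindex_bij_witness[of _ "\<lambda>j. e b - j" "\<lambda>j. e b - j"]) (auto simp: add.commute)
  finally show ?thesis .
qed

lemma sum_triangle_swap:
  fixes f :: "nat \<Rightarrow> nat \<Rightarrow> 'a :: comm_monoid_add"
  shows "(\<Sum>j=1..n. \<Sum>i=1..j. f i j) = (\<Sum>i=1..n. \<Sum>j=i..n. f i j)"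
proof -
  have "(\<Sum>j=1..n. \<Sum>i=1..j. f i j) = (\<Sum>j=1..n. \<Sum>i=1..n. if i \<le> j then f i j else 0)"
    by (intro sum.cong refl sum.mono_neutral_cong_left) auto
  also have "\<dots> = (\<Sum>i=1..n. \<Sum>j=1..n. if i \<le> j then f i j else 0)" by (rule sum.swap)
  also have "\<dots> = (\<Sum>i=1..n. \<Sum>j=i..n. f i j)"
    by (intro sum.cong refl sum.mono_neutral_cong_right) auto
  finally show ?thesis .
qed

lemma fps_const_sum: "fps_const (\<Sum>i\<in>I. f i) = (\<Sum>i\<in>I. fps_const (f i :: 'a :: comm_monoid_add))"
  by (induction I rule: infinite_finite_induct) (auto simp flip: fps_const_add)

text \<open>The rational function is expanded around a centre \<open>z\<close> off the poles, with
  \<open>X = x - z\<close>. The induction splits off one pole at a time and needs the whole series,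
  since the principal part at the new pole is read from higher coefficients.\<close>

theorem partial_fractions_fps:
  assumes "finite A" "A \<noteq> {}" "\<And>a. a \<in> A \<Longrightarrow> e a > 0" "z \<notin> A"
  shows "(\<Prod>b\<in>A. pole_fps (z - b) (e b)) =
    (\<Sum>a\<in>A. \<Sum>j=1..e a. fps_const (laurent_coeff A e a j) * pole_fps (z - a) j)"
  using assms
proof (induction A arbitrary: z rule: finite_ne_induct)
  case (singleton a)
  have "(\<Sum>j=1..e a. fps_const ((1 :: complex fps) $ (e a - j)) * pole_fps (z - a) j) = (\<Sum>j\<in>{e a}. pole_fps (z - a) j)"
    using singleton by (intro sum.mono_neutral_cong_right) auto
  then show ?case by (simp add: laurent_coeff_def)
next
  case (insert a A)
  have IH: "(\<Prod>b\<in>A. pole_fps (w - b) (e b)) =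
    (\<Sum>b\<in>A. \<Sum>j=1..e b. fps_const (laurent_coeff A e b j) * pole_fps (w - b) j)" if "w \<notin> A" for w
    using insert.IH[OF _ that] insert.prems by simp
  have two: "pole_fps (z - b) j * pole_fps (z - a) (e a) =
      (\<Sum>i=1..j. fps_const (pole_fps (b - a) (e a) $ (j - i)) * pole_fps (z - b) i) +
      (\<Sum>i=1..e a. fps_const (pole_fps (a - b) j $ (e a - i)) * pole_fps (z - a) i)"
    if "b \<in> A" for b j
  proof -
    have "z \<noteq> b" "z \<noteq> a" "a \<noteq> b" using that insert by auto
    then show ?thesis
      using pole_fps_mult[of "z - b" "z - a" j "e a"] insert.prems(1)[of a] by simp
  qed
  \<comment> \<open>The new pole \<open>a\<close> is itself an admissible centre for the induction
    hypothesis. The Taylor coefficients of the old product there are the Laurent coefficients of the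
    enlarged product at \<open>a\<close>.\<close>
  have at_a: "(\<Sum>b\<in>A. \<Sum>j=1..e b. laurent_coeff A e b j * pole_fps (a - b) j $ (e a - i)) =
      laurent_coeff (insert a A) e a i" for i
  proof -
    have "insert a A - {a} = A" using insert by auto
    then show ?thesis
      using arg_cong[OF IH[of a], of "\<lambda>f. fps_nth f (e a - i)"] insert
      by (simp add: laurent_coeff_def fps_sum_nth)
  qed
  have "(\<Prod>b\<in>insert a A. pole_fps (z - b) (e b)) =
      (\<Sum>b\<in>A. \<Sum>j=1..e b. fps_const (laurent_coeff A e b j) * (pole_fps (z - b) j * pole_fps (z - a) (e a)))"
    using insert by (simp add: IH sum_distrib_left mult_ac)
  also have "\<dots> = (\<Sum>b\<in>A. \<Sum>j=1..e b. \<Sum>i=1..j. fps_const (laurent_coeff A e b j * pole_fps (b - a) (e a) $ (j - i)) * pole_fps (z - b) i) +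
      (\<Sum>b\<in>A. \<Sum>j=1..e b. \<Sum>i=1..e a. fps_const (laurent_coeff A e b j * pole_fps (a - b) j $ (e a - i)) * pole_fps (z - a) i)"
    by (simp add: two distrib_left sum_distrib_left sum.distrib mult.assoc flip: fps_const_mult)
  also have "(\<Sum>b\<in>A. \<Sum>j=1..e b. \<Sum>i=1..j. fps_const (laurent_coeff A e b j * pole_fps (b - a) (e a) $ (j - i)) * pole_fps (z - b) i) =
      (\<Sum>b\<in>A. \<Sum>i=1..e b. fps_const (laurent_coeff (insert a A) e b i) * pole_fps (z - b) i)"
  proof (rule sum.cong[OF refl])
    fix b assume b: "b \<in> A"
    show "(\<Sum>j=1..e b. \<Sum>i=1..j. fps_const (laurent_coeff A e b j * pole_fps (b - a) (e a) $ (j - i)) * pole_fps (z - b) i) =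
      (\<Sum>i=1..e b. fps_const (laurent_coeff (insert a A) e b i) * pole_fps (z - b) i)"
      unfolding sum_triangle_swap
      using insert b by (intro sum.cong refl)
        (simp add: laurent_coeff_insert sum_distrib_right fps_const_sum)
  qed
  also have "(\<Sum>b\<in>A. \<Sum>j=1..e b. \<Sum>i=1..e a. fps_const (laurent_coeff A e b j * pole_fps (a - b) j $ (e a - i)) * pole_fps (z - a) i) =
      (\<Sum>i=1..e a. fps_const (laurent_coeff (insert a A) e a i) * pole_fps (z - a) i)"
  proof -
    have "(\<Sum>b\<in>A. \<Sum>j=1..e b. \<Sum>i=1..e a. F b j i) = (\<Sum>i=1..e a. \<Sum>b\<in>A. \<Sum>j=1..e b. F b j i)"
      for F :: "complex \<Rightarrow> nat \<Rightarrow> nat \<Rightarrow> complex fps"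
    proof -
      have "(\<Sum>b\<in>A. \<Sum>j=1..e b. \<Sum>i=1..e a. F b j i) = (\<Sum>b\<in>A. \<Sum>i=1..e a. \<Sum>j=1..e b. F b j i)"
        by (rule sum.cong[OF refl]) (rule sum.swap)
      also have "\<dots> = (\<Sum>i=1..e a. \<Sum>b\<in>A. \<Sum>j=1..e b. F b j i)" by (rule sum.swap)
      finally show ?thesis .
    qed
    then show ?thesis by (simp only: at_a[symmetric] fps_const_sum sum_distrib_right)
  qed
  finally show ?case using insert by (simp add: add.commute)
qed

corollary partial_fractions:
  assumes "finite A" "A \<noteq> {}" "\<And>a. a \<in> A \<Longrightarrow> e a > 0" "z \<notin> A"
  shows "(\<Prod>b\<in>A. 1 / (z - b) ^ e b) = (\<Sum>a\<in>A. \<Sum>j=1..e a. laurent_coeff A e a j / (z - a) ^ j)"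
proof -
  have "(\<Prod>b\<in>A. pole_fps (z - b) (e b)) $ 0 = (\<Prod>b\<in>A. pole_fps (z - b) (e b) $ 0)"
    by (induction A rule: infinite_finite_induct) auto
  then show ?thesis
    using arg_cong[OF partial_fractions_fps[of A e z], of "\<lambda>f. fps_nth f 0"] assms
    by (simp add: fps_sum_nth pole_fps_nth_0)
qed

text \<open>With \<open>c = a - b\<close>, both sides are the constant Laurent coefficient at
  \<open>a\<close> of \<open>(x - a) ^ (-n) * (x - b) ^ (-j)\<close>: on the left by expanding the
  second factor, on the right as the value at \<open>a\<close> of the principal part at
  \<open>b\<close>. The computation comes down to the hockey-stick identity for binomial
  coefficients.\<close>

lemma pole_fps_nth_eq_sum:
  assumes "c \<noteq> 0" "j > 0"
  shows "pole_fps c j $ n = (\<Sum>i=1..j. pole_fps (- c) n $ (j - i) / c ^ i)"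
proof -
  obtain k where k: "j = Suc k" using assms by (cases j) auto
  have "(\<Sum>i=1..j. pole_fps (- c) n $ (j - i) / c ^ i) = (\<Sum>m\<le>k. pole_fps (- c) n $ m / c ^ (j - m))"
    by (rule sum.reindex_bij_witness[of _ "\<lambda>m. j - m" "\<lambda>i. j - i"]) (auto simp: k)
  also have "\<dots> = (\<Sum>m\<le>k. (-1) ^ n / c ^ (n + j) * of_nat ((n + m - 1) choose m))"
  proof (intro sum.cong refl)
    fix m assume m: "m \<in> {..k}"
    have "(- c) ^ (n + m) = (-1) ^ n * (-1) ^ m * c ^ (n + m)"
      by (subst power_minus) (simp add: power_add)
    moreover have "c ^ (n + j) = c ^ (n + m) * c ^ (j - m)" using m k by (simp flip: power_add)
    moreover have "((-1) ^ m * (-1 :: complex) ^ m) = 1" by (simp flip: power_mult_distrib)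
    ultimately show "pole_fps (- c) n $ m / c ^ (j - m) = (-1) ^ n / c ^ (n + j) * of_nat ((n + m - 1) choose m)"
      using assms by (simp add: pole_fps_nth field_simps) 
  qed
  also have "\<dots> = (-1) ^ n / c ^ (n + j) * of_nat (\<Sum>m\<le>k. (n + m - 1) choose m)"
    by (simp add: sum_distrib_left)
  also have "(\<Sum>m\<le>k. (n + m - 1) choose m) = (n + k) choose k"
    by (induction k) simp_all
  also have "(n + k) choose k = (n + k) choose n"
    by (simp add: binomial_symmetric[of k "n + k"])
  also have "(-1) ^ n / c ^ (n + j) * of_nat ((n + k) choose n) = pole_fps c j $ n"
    by (simp add: pole_fps_nth k add_ac)
  finally show ?thesis by (rule sym)
qed

text \<open>The product is the sum of its principal parts. The one at \<open>a\<close> has no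
  constant term, so the constant coefficient there is the value of all the others.\<close>

corollary laurent_coeff_0:
  assumes "finite A" "a \<in> A" "A \<noteq> {a}" "\<And>a. a \<in> A \<Longrightarrow> e a > 0"
  shows "laurent_coeff A e a 0 = (\<Sum>b\<in>A - {a}. \<Sum>i=1..e b. laurent_coeff A e b i / (a - b) ^ i)"
proof -
  define B where "B = A - {a}"
  have B: "finite B" "B \<noteq> {}" "a \<notin> B" "insert a B = A" using assms by (auto simp: B_def)
  have "laurent_coeff A e a 0 = (\<Sum>b\<in>B. \<Sum>j=1..e b. laurent_coeff B e b j * pole_fps (a - b) j $ e a)"
    using arg_cong[OF partial_fractions_fps[of B e a], of "\<lambda>f. fps_nth f (e a)"] assms B
    by (auto simp: laurent_coeff_def fps_sum_nth simp flip: B_def)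
  also have "\<dots> = (\<Sum>b\<in>B. \<Sum>i=1..e b. laurent_coeff A e b i / (a - b) ^ i)"
  proof (rule sum.cong[OF refl])
    fix b assume b: "b \<in> B"
    have "(\<Sum>j=1..e b. laurent_coeff B e b j * pole_fps (a - b) j $ e a) =
        (\<Sum>j=1..e b. \<Sum>i=1..j. laurent_coeff B e b j * pole_fps (b - a) (e a) $ (j - i) / (a - b) ^ i)"
      using b B by (intro sum.cong refl) (subst pole_fps_nth_eq_sum, auto simp: sum_distrib_left)
    also have "\<dots> = (\<Sum>i=1..e b. laurent_coeff A e b i / (a - b) ^ i)"
      unfolding sum_triangle_swap using laurent_coeff_insert[OF B(1,3) b] B(4)
      by (intro sum.cong refl) (simp add: sum_divide_distrib)
    finally show "(\<Sum>j=1..e b. laurent_coeff B e b j * pole_fps (a - b) j $ e a) =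
        (\<Sum>i=1..e b. laurent_coeff A e b i / (a - b) ^ i)" .
  qed
  finally show ?thesis by (simp add: B_def)
qed

section \<open>Symmetric lattice sums\<close>

lemma sum_int_symmetric_Suc:
  fixes f :: "int \<Rightarrow> 'a :: comm_monoid_add"
  shows "(\<Sum>m=- int (Suc M)..int (Suc M). f m) = (\<Sum>m=- int M..int M. f m) + f (int (Suc M)) + f (- int (Suc M))"
proof -
  have "{- int (Suc M)..int (Suc M)} = insert (int (Suc M)) (insert (- int (Suc M)) {- int M..int M})" by auto
  then show ?thesis by (simp add: add_ac)
qed

lemma sum_int_shift_Suc:
  fixes f :: "int \<Rightarrow> 'a :: ab_group_add"
  shows "(\<Sum>m=- int M..int M. f (m + (c + 1))) = (\<Sum>m=- int M..int M. f (m + c)) + f (int M + (c + 1)) - f (- int M + c)"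
proof (induction M)
  case (Suc M)
  have "- int (Suc M) + (c + 1) = - int M + c" "int (Suc M) + c = int M + (c + 1)" by auto
  then show ?case unfolding sum_int_symmetric_Suc Suc by (simp add: algebra_simps)
qed (simp add: add.commute)

lemma tendsto_symmetric_sum_shift:
  fixes f :: "int \<Rightarrow> complex"
  assumes lim: "(\<lambda>M. \<Sum>m=- int M..int M. f m) \<longlonglongrightarrow> L"
    and f: "\<And>c. (\<lambda>k. f (int k + c)) \<longlonglongrightarrow> 0" "\<And>c. (\<lambda>k. f (- int k + c)) \<longlonglongrightarrow> 0"
  shows "(\<lambda>M. \<Sum>m=- int M..int M. f (m + c)) \<longlonglongrightarrow> L"
proof (induction c rule: int_induct[where k = 0])
  case base
  then show ?case using lim by simp
next
  case (step1 c)
  then show ?case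
    unfolding sum_int_shift_Suc using tendsto_diff[OF tendsto_add[OF step1(2) f(1)] f(2)[of c]] by simp
next
  case (step2 c)
  have "(\<Sum>m=- int M..int M. f (m + (c - 1))) = (\<Sum>m=- int M..int M. f (m + c)) - f (int M + c) + f (- int M + (c - 1))" for M
    using sum_int_shift_Suc[where f = f and c = "c - 1" and M = M] by (simp add: algebra_simps)
  then show ?case
    using tendsto_add[OF tendsto_diff[OF step2(2) f(1)[of c]] f(2)[of "c - 1"]] by simp
qed

text \<open>For \<open>j > 0\<close> this is the limit of the symmetric sums of
  \<open>(m - h / 2) ^ (-j)\<close>, where a vanishing denominator contributes 0. For odd
  \<open>h\<close>, doubling leads to a sum over odd integers, whence the factor
  \<open>2 ^ j - 1\<close>. At \<open>j = 0\<close> the value is -1 or 0 and accounts for the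
  omission of a pole that is an integer.\<close>

definition pole_zeta :: "int \<Rightarrow> nat \<Rightarrow> complex" where
  "pole_zeta h j = (if odd j then 0 else 2 * zeta (of_nat j) * (if even h then 1 else 2 ^ j - 1))"

lemma tendsto_inverse_power_at_infinity:
  fixes b :: complex
  assumes "j > 0"
  shows "(\<lambda>k. 1 / (of_int (int k + c) - b) ^ j) \<longlonglongrightarrow> 0" "(\<lambda>k. 1 / (of_int (- int k + c) - b) ^ j) \<longlonglongrightarrow> 0"
proof -
  have inf: "filterlim (\<lambda>k. of_nat k + d :: complex) at_infinity sequentially" for d
    by (rule tendsto_add_filterlim_at_infinity'[OF tendsto_of_nat tendsto_const])
  have "((\<lambda>z :: complex. 1 / z) \<longlongrightarrow> 0) at_infinity"
    using tendsto_inverse_0[where 'a = complex] by (simp add: inverse_eq_divide[abs_def])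
  from filterlim_compose[OF this inf]
  have *: "(\<lambda>k. 1 / (of_nat k + d) :: complex) \<longlonglongrightarrow> 0" for d .
  have "(\<lambda>k. (1 / (of_nat k + (of_int c - b))) ^ j) \<longlonglongrightarrow> 0 ^ j"
    by (intro tendsto_power *)
  then show "(\<lambda>k. 1 / (of_int (int k + c) - b) ^ j) \<longlonglongrightarrow> 0"
    using assms by (simp add: power_one_over add_diff_eq zero_power)
  have "(\<lambda>k. (- (1 / (of_nat k + (b - of_int c)))) ^ j) \<longlonglongrightarrow> (- 0) ^ j"
    by (intro tendsto_power tendsto_minus *)
  moreover have "- (1 / (of_nat k + (b - of_int c))) = 1 / (of_int (- int k + c) - b)" for k
    unfolding minus_divide_right by (simp add: algebra_simps)
  ultimately show "(\<lambda>k. 1 / (of_int (- int k + c) - b) ^ j) \<longlonglongrightarrow> 0"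
    using assms by (simp add: power_one_over zero_power)
qed

lemma tendsto_sum_inverse_power:
  assumes "j > 0"
  shows "(\<lambda>M. \<Sum>m=- int M..int M. 1 / of_int m ^ j) \<longlonglongrightarrow> pole_zeta 0 j"
proof -
  \<comment> \<open>The term \<open>m = 0\<close> is 0 because division by zero gives 0; the terms
    at \<open>m\<close> and \<open>- m\<close> cancel or double according to the parity of
    \<open>j\<close>.\<close>
  have eq: "(\<Sum>m=- int M..int M. 1 / of_int m ^ j) = (1 + (-1) ^ j) * (\<Sum>n<M. 1 / of_nat (Suc n) ^ j :: complex)" for M
  proof (induction M)
    case (Suc M)
    have "(- of_nat (Suc M)) ^ j = (-1) ^ j * (of_nat (Suc M) :: complex) ^ j"
      by (rule power_minus)
    moreover have "1 / ((-1) ^ j * x) = (-1) ^ j * (1 / x)" for x :: complex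
      by (cases "even j") auto
    ultimately show ?case
      unfolding sum_int_symmetric_Suc Suc
      by (simp add: distrib_right distrib_left add_divide_distrib del: of_nat_Suc)
  qed (use assms in \<open>simp add: zero_power\<close>)
  show ?thesis
  proof (cases "odd j")
    case True
    then show ?thesis unfolding eq by (simp add: pole_zeta_def)
  next
    case False
    then have "j \<ge> 2" using assms by presburger
    then have "(\<lambda>n. 1 / of_nat (Suc n) powr of_nat j) sums zeta (of_nat j)"
      by (intro zeta_sums) auto
    then have "(\<lambda>n. 1 / of_nat (Suc n) ^ j) sums zeta (of_nat j)"
      using assms by (simp add: powr_nat' del: of_nat_Suc)
    then have "(\<lambda>M. (1 + (-1) ^ j) * (\<Sum>n<M. 1 / of_nat (Suc n) ^ j :: complex)) \<longlonglongrightarrow> (1 + (-1) ^ j) * zeta (of_nat j)"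
      unfolding sums_def by (intro tendsto_mult tendsto_const)
    then show ?thesis using False unfolding eq by (simp add: pole_zeta_def del: of_nat_Suc)
  qed
qed

text \<open>Up to the factor \<open>2 ^ j\<close> this is a sum over odd integers, obtained as the
  sum over all integers minus the sum over the even ones.\<close>

lemma tendsto_sum_inverse_power_half_odd:
  assumes "j > 0"
  shows "(\<lambda>M. \<Sum>m=- int M..int M. 1 / (of_int m - 1 / 2) ^ j) \<longlonglongrightarrow> pole_zeta 1 j"
proof -
  define G where "G = (\<lambda>M. \<Sum>m=- int M..int M. 1 / of_int m ^ j :: complex)"
  have half: "1 / (x - 1 / 2) ^ j = 2 ^ j * (1 / (2 * x - 1) ^ j)" for x :: complex
  proof -
    have "2 * x - 1 = 2 * (x - 1 / 2)" by simp
    then show ?thesis by (simp only: power_mult_distrib) simp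
  qed
  have dbl: "1 / x ^ j = 2 ^ j * (1 / (2 * x) ^ j)" for x :: complex
    by (simp add: power_mult_distrib)
  \<comment> \<open>While \<open>m\<close> runs through the window, \<open>2 * m - 1\<close> runs
    through the odd integers from \<open>- 2 * M - 1\<close> to \<open>2 * M - 1\<close>. The lowest
    one lies outside the window of \<open>G (2 * M)\<close> and is the last summand.\<close>
  have eq: "(\<Sum>m=- int M..int M. 1 / (of_int m - 1 / 2) ^ j) =
      2 ^ j * G (2 * M) - G M + 2 ^ j * (1 / (- 2 * of_nat M - 1) ^ j)" for M
  proof (induction M)
    case 0
    then show ?case using assms half[of 0] by (simp add: G_def zero_power)
  next
    case (Suc M)
    have "2 * Suc M = Suc (Suc (2 * M))" by simp
    then have "G (2 * Suc M) = G (2 * M) + 1 / of_int (int (Suc (2 * M))) ^ j + 1 / of_int (- int (Suc (2 * M))) ^ j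
        + 1 / of_int (int (Suc (Suc (2 * M)))) ^ j + 1 / of_int (- int (Suc (Suc (2 * M)))) ^ j"
      unfolding G_def by (simp only: sum_int_symmetric_Suc)
    moreover have "G (Suc M) = G M + 2 ^ j * (1 / of_int (int (Suc (Suc (2 * M)))) ^ j) + 2 ^ j * (1 / of_int (- int (Suc (Suc (2 * M)))) ^ j)"
      unfolding G_def sum_int_symmetric_Suc
      by (subst dbl[of "of_int (int (Suc M))"], subst dbl[of "of_int (- int (Suc M))"]) (simp add: algebra_simps)
    moreover have "2 * of_int (int (Suc M)) - 1 = (of_int (int (Suc (2 * M))) :: complex)"
      "2 * of_int (- int (Suc M)) - 1 = (- 2 * of_nat (Suc M) - 1 :: complex)"
      "- 2 * of_nat M - 1 = (of_int (- int (Suc (2 * M))) :: complex)" by simp_all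
    moreover have "x - y + b + a + z = x + a + b + c + d - (y + c + d) + z" for a b c d x y z :: complex
      by simp
    ultimately show ?case
      unfolding sum_int_symmetric_Suc Suc unfolding half by (simp only: distrib_left)
  qed
  have "(\<lambda>M. G (2 * M)) \<longlonglongrightarrow> pole_zeta 0 j"
    using tendsto_sum_inverse_power[OF assms] unfolding G_def
    by (rule filterlim_compose) (rule filterlim_subseq, simp add: strict_mono_def)
  moreover have "G \<longlonglongrightarrow> pole_zeta 0 j"
    using tendsto_sum_inverse_power[OF assms] by (simp add: G_def)
  moreover have "(\<lambda>M. 2 ^ j * (1 / (- 2 * of_nat M - 1) ^ j) :: complex) \<longlonglongrightarrow> 0"
    using tendsto_inverse_power_at_infinity(2)[OF assms, of 0 "1 / 2"] unfolding half by (simp add: mult.commute)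
  ultimately have "(\<lambda>M. 2 ^ j * G (2 * M) - G M + 2 ^ j * (1 / (- 2 * of_nat M - 1) ^ j)) \<longlonglongrightarrow>
      2 ^ j * pole_zeta 0 j - pole_zeta 0 j + 0"
    by (intro tendsto_intros)
  moreover have "2 ^ j * pole_zeta 0 j - pole_zeta 0 j + 0 = pole_zeta 1 j"
    by (simp add: pole_zeta_def algebra_simps)
  ultimately show ?thesis unfolding eq by (simp only:)
qed

lemma tendsto_sum_inverse_power_half:
  assumes "j > 0"
  shows "(\<lambda>M. \<Sum>m=- int M..int M. 1 / (of_int m - of_int h / 2) ^ j) \<longlonglongrightarrow> pole_zeta h j"
proof (cases "even h")
  case True
  then obtain c where h: "h = 2 * c" by blast
  have "(\<lambda>M. \<Sum>m=- int M..int M. 1 / of_int (m + (- c)) ^ j) \<longlonglongrightarrow> pole_zeta 0 j"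
    using tendsto_inverse_power_at_infinity[OF assms, where b = 0]
    by (intro tendsto_symmetric_sum_shift[where f = "\<lambda>m. 1 / of_int m ^ j"] tendsto_sum_inverse_power assms) simp_all
  moreover have "pole_zeta h j = pole_zeta 0 j" by (simp add: h pole_zeta_def)
  ultimately show ?thesis by (simp add: h)
next
  case False
  then obtain c where h: "h = 2 * c + 1" by (rule oddE)
  have "(\<lambda>M. \<Sum>m=- int M..int M. 1 / (of_int (m + (- c)) - 1 / 2) ^ j) \<longlonglongrightarrow> pole_zeta 1 j"
    using tendsto_inverse_power_at_infinity[OF assms, where b = "1 / 2"]
    by (intro tendsto_symmetric_sum_shift[where f = "\<lambda>m. 1 / (of_int m - 1 / 2) ^ j"]
        tendsto_sum_inverse_power_half_odd assms) simp_all
  moreover have "pole_zeta h j = pole_zeta 1 j" by (simp add: h pole_zeta_def)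
  ultimately show ?thesis by (simp add: h add_divide_distrib diff_diff_eq)
qed

lemma pole_zeta_0: "pole_zeta h 0 = (if even h then -1 else 0)"
  by (simp add: pole_zeta_def zeta_0)

text \<open>The partial fractions are summed over all integers, and the finitely many values at
  poles are subtracted afterwards. Those values are constant Laurent coefficients, so they enter the
  limit as the terms \<open>j = 0\<close>.\<close>

lemma tendsto_sum_rational:
  fixes A :: "complex set" and h :: "complex \<Rightarrow> int" and n :: nat
  assumes A: "finite A" "A \<noteq> {}" "\<And>a. A \<noteq> {a}" "\<And>a. a \<in> A \<Longrightarrow> e a > 0"
    and h: "\<And>a. a \<in> A \<Longrightarrow> a = of_int (h a) / 2" and n: "n > 0"
  shows "(\<lambda>M. \<Sum>m\<in>{m. of_int m / of_nat n \<notin> A} \<inter> {- int M..int M}. \<Prod>b\<in>A. 1 / (of_int m / of_nat n - b) ^ e b)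
    \<longlonglongrightarrow> (\<Sum>a\<in>A. \<Sum>j\<le>e a. laurent_coeff A e a j * of_nat n ^ j * pole_zeta (int n * h a) j)"
proof -
  define x :: "int \<Rightarrow> complex" where "x = (\<lambda>m. of_int m / of_nat n)"
  define F where "F = (\<lambda>m. \<Sum>a\<in>A. \<Sum>j=1..e a. laurent_coeff A e a j / (x m - a) ^ j)"
  define Bad where "Bad = {m. x m \<in> A}"
  have inj_x: "inj x" using n by (auto simp: x_def inj_on_def)
  have F_good: "(\<Prod>b\<in>A. 1 / (x m - b) ^ e b) = F m" if "m \<notin> Bad" for m
    using that A unfolding F_def by (intro partial_fractions) (auto simp: Bad_def)
  \<comment> \<open>Division by zero erases the principal part belonging to the pole
    \<open>x m\<close> itself; what is left of \<open>F m\<close> is the value of the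
    others.\<close>
  have F_bad: "F m = laurent_coeff A e (x m) 0" if "m \<in> Bad" for m
  proof -
    have "x m \<in> A" using that by (simp add: Bad_def)
    then have "F m = (\<Sum>a\<in>A - {x m}. \<Sum>j=1..e a. laurent_coeff A e a j / (x m - a) ^ j) +
        (\<Sum>j=1..e (x m). laurent_coeff A e (x m) j / 0 ^ j)"
      unfolding F_def using A by (simp add: sum.remove[of A "x m"])
    also have "(\<Sum>j=1..e (x m). laurent_coeff A e (x m) j / 0 ^ j) = 0"
      by (intro sum.neutral) (auto simp: zero_power)
    finally show ?thesis
      using laurent_coeff_0[OF A(1) \<open>x m \<in> A\<close> A(3,4)] by simp
  qed
  have F_eq: "F m = (\<Sum>a\<in>A. \<Sum>j=1..e a. laurent_coeff A e a j * of_nat n ^ j *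
      (1 / (of_int m - of_int (int n * h a) / 2) ^ j))" for m
    unfolding F_def
  proof (intro sum.cong refl)
    fix a j assume a: "a \<in> A"
    have "x m - a = (of_int m - of_int (int n * h a) / 2) / of_nat n"
      using n by (subst h[OF a]) (simp add: x_def field_simps)
    then have "(x m - a) ^ j = (of_int m - of_int (int n * h a) / 2) ^ j / of_nat n ^ j"
      by (simp add: power_divide)
    then show "laurent_coeff A e a j / (x m - a) ^ j =
        laurent_coeff A e a j * of_nat n ^ j * (1 / (of_int m - of_int (int n * h a) / 2) ^ j)"
      by simp
  qed
  have lim_F: "(\<lambda>M. \<Sum>m=- int M..int M. F m) \<longlonglongrightarrow>
      (\<Sum>a\<in>A. \<Sum>j=1..e a. laurent_coeff A e a j * of_nat n ^ j * pole_zeta (int n * h a) j)"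
  proof -
    have "(\<Sum>m=- int M..int M. F m) = (\<Sum>a\<in>A. \<Sum>j=1..e a. laurent_coeff A e a j * of_nat n ^ j *
      (\<Sum>m=- int M..int M. 1 / (of_int m - of_int (int n * h a) / 2) ^ j))" for M
      unfolding F_eq
      by (subst sum.swap, rule sum.cong[OF refl], subst sum.swap, simp only: sum_distrib_left)
    then show ?thesis
      by (simp only:) (intro tendsto_intros tendsto_sum_inverse_power_half, simp)
  qed
  have fin_Bad: "finite Bad"
    unfolding Bad_def using A(1) inj_x finite_vimageI[of A x] by (simp add: vimage_def)
  have sum_Bad: "(\<Sum>m\<in>Bad. F m) = - (\<Sum>a\<in>A. laurent_coeff A e a 0 * pole_zeta (int n * h a) 0)"
  proof -
    \<comment> \<open>A pole \<open>a = h a / 2\<close> is of the form \<open>m / n\<close> exactly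
      when \<open>n * h a\<close> is even, which is the condition under which
      \<open>pole_zeta\<close> is -1 at order 0.\<close>
    have x_Bad: "x ` Bad = {a \<in> A. even (int n * h a)}"
    proof (intro equalityI subsetI)
      fix a assume "a \<in> x ` Bad"
      then obtain m where m: "a = x m" "x m \<in> A" by (auto simp: Bad_def)
      then have "of_int m / of_nat n = (of_int (h a) / 2 :: complex)"
        using h[of a] by (simp add: x_def)
      then have "of_int (2 * m) = (of_int (int n * h a) :: complex)"
        using n by (simp add: field_simps)
      then have "2 * m = int n * h a" unfolding of_int_eq_iff .
      then show "a \<in> {a \<in> A. even (int n * h a)}" using m dvd_triv_left[of 2 m] by simp
    next
      fix a assume "a \<in> {a \<in> A. even (int n * h a)}"
      then obtain m where a: "a \<in> A" and m: "int n * h a = 2 * m" by (auto elim: evenE)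
      have "of_int (int n * h a) = (of_int (2 * m) :: complex)" using m by simp
      then have "x m = a" using n by (subst h[OF a]) (simp add: x_def field_simps)
      then show "a \<in> x ` Bad" using a by (auto simp: Bad_def)
    qed
    have "(\<Sum>m\<in>Bad. F m) = (\<Sum>m\<in>Bad. laurent_coeff A e (x m) 0)"
      using F_bad by (intro sum.cong) auto
    also have "\<dots> = (\<Sum>a\<in>x ` Bad. laurent_coeff A e a 0)"
      using inj_x by (subst sum.reindex) (auto intro: inj_on_subset)
    also have "\<dots> = (\<Sum>a\<in>A. if even (int n * h a) then laurent_coeff A e a 0 else 0)"
      unfolding x_Bad using A by (simp add: sum.inter_filter)
    also have "\<dots> = (\<Sum>a\<in>A. - (laurent_coeff A e a 0 * pole_zeta (int n * h a) 0))"
      by (intro sum.cong refl) (simp add: pole_zeta_0)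
    finally show ?thesis by (simp add: sum_negf)
  qed
  have lim: "(\<lambda>M. (\<Sum>m=- int M..int M. F m) - (\<Sum>m\<in>Bad. F m)) \<longlonglongrightarrow>
      (\<Sum>a\<in>A. \<Sum>j\<le>e a. laurent_coeff A e a j * of_nat n ^ j * pole_zeta (int n * h a) j)"
  proof -
    have split: "{..k} = insert 0 {1..k}" for k :: nat by auto
    show ?thesis
      using tendsto_diff[OF lim_F tendsto_const[of "\<Sum>m\<in>Bad. F m"]]
      unfolding sum_Bad by (simp add: split sum.distrib add.commute)
  qed
  obtain N where N: "\<forall>m\<in>Bad. \<bar>m\<bar> \<le> int N"
  proof -
    have "\<forall>m\<in>Bad. \<bar>m\<bar> \<le> int (nat (\<Sum>m\<in>Bad. \<bar>m\<bar>))"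
      using fin_Bad member_le_sum[of _ Bad abs] by (auto simp: sum_nonneg)
    then show ?thesis by (rule that)
  qed
  have "\<forall>\<^sub>F M in sequentially. (\<Sum>m=- int M..int M. F m) - (\<Sum>m\<in>Bad. F m) =
      (\<Sum>m\<in>{m. x m \<notin> A} \<inter> {- int M..int M}. \<Prod>b\<in>A. 1 / (x m - b) ^ e b)"
    using eventually_ge_at_top[of N]
  proof eventually_elim
    case (elim M)
    then have "Bad \<subseteq> {- int M..int M}" using N by fastforce
    then have "(\<Sum>m=- int M..int M. F m) - (\<Sum>m\<in>Bad. F m) = (\<Sum>m\<in>{- int M..int M} - Bad. F m)"
      by (subst sum_diff) auto
    also have "{- int M..int M} - Bad = {m. x m \<notin> A} \<inter> {- int M..int M}"
      by (auto simp: Bad_def)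
    also have "(\<Sum>m\<in>\<dots>. F m) = (\<Sum>m\<in>\<dots>. \<Prod>b\<in>A. 1 / (x m - b) ^ e b)"
      using F_good by (intro sum.cong) (auto simp: Bad_def)
    finally show ?case .
  qed
  from Lim_transform_eventually[OF lim this] show ?thesis by (simp only: x_def)
qed

text \<open>An unconditional sum is the limit along any exhaustion by finite sets. The symmetric
  exhaustion is the one along which the partial fractions can be summed separately.\<close>

lemma has_sum_imp_tendsto_symmetric_sum:
  fixes f :: "int \<Rightarrow> complex"
  assumes "(f has_sum S) V"
  shows "(\<lambda>M. \<Sum>m\<in>V \<inter> {- int M..int M}. f m) \<longlonglongrightarrow> S"
proof -
  have "filterlim (\<lambda>M. V \<inter> {- int M..int M}) (finite_subsets_at_top V) sequentially"
    unfolding filterlim_finite_subsets_at_top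
  proof safe
    fix X assume X: "finite X" "X \<subseteq> V"
    have "\<forall>m\<in>X. \<bar>m\<bar> \<le> int (nat (\<Sum>m\<in>X. \<bar>m\<bar>))"
      using X member_le_sum[of _ X abs] by (auto simp: sum_nonneg)
    then have "\<forall>m\<in>X. \<bar>m\<bar> \<le> int M" if "M \<ge> nat (\<Sum>m\<in>X. \<bar>m\<bar>)" for M
      using that by fastforce
    then have "\<forall>m\<in>X. m \<in> {- int M..int M}" if "M \<ge> nat (\<Sum>m\<in>X. \<bar>m\<bar>)" for M
      using that by fastforce
    then show "\<forall>\<^sub>F M in sequentially. finite (V \<inter> {- int M..int M}) \<and> X \<subseteq> V \<inter> {- int M..int M} \<and>
        V \<inter> {- int M..int M} \<subseteq> V"
      using X unfolding eventually_sequentially by blast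
  qed
  then show ?thesis
    using assms filterlim_compose unfolding has_sum_def by blast
qed

section \<open>The six chambers\<close>

lemma of_nat_powr_even: "k > 0 \<Longrightarrow> (of_nat k :: complex) powr (2 * of_nat p) = of_nat k ^ (2 * p)"
  using powr_nat'[of "of_nat k :: complex" "2 * p"] by simp

lemma summable_on_powr_product:
  "(\<lambda>(m, n). real m powr -2 * real n powr -2) summable_on {1..} \<times> {1..}"
proof -
  have "(\<lambda>n. real n powr -2) summable_on {1..}"
    by (rule summable_on_subset_banach[of _ UNIV])
      (auto intro!: norm_summable_imp_summable_on simp: summable_real_powr_iff)
  then obtain S where S: "((\<lambda>n. real n powr -2) has_sum S) {1..}" by (auto simp: summable_on_def)
  show ?thesis
  proof (rule summable_on_SigmaI)
    show "((\<lambda>n. case (m, n) of (m, n) \<Rightarrow> real m powr -2 * real n powr -2) has_sum real m powr -2 * S) {1..}" for m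
      using has_sum_cmult_right[OF S, of "real m powr -2"] by simp
    show "(\<lambda>m. real m powr -2 * S) summable_on {1..}"
      using has_sum_cmult_left[OF S, of S] by (auto simp: summable_on_def)
  qed auto
qed

lemma norm_G2_term:
  assumes "m > 0" "n > 0"
  shows "norm (G2_term (s1, s2, s3, s4, s5, s6) (m, n)) =
    1 / (real m powr Re s1 * real n powr Re s2 * real (m + n) powr Re s3 *
      real (m + 2 * n) powr Re s4 * real (m + 3 * n) powr Re s5 * real (2 * m + 3 * n) powr Re s6)"
  using assms by (simp only: G2_term_def prod.case norm_divide norm_mult norm_one)
    (simp add: norm_of_nat_powr del: of_nat_add of_nat_mult)

lemma G2_abs_summable:
  assumes "Re s1 \<ge> 2" "Re s2 \<ge> 2" "Re s3 \<ge> 0" "Re s4 \<ge> 0" "Re s5 \<ge> 0" "Re s6 \<ge> 0"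
  shows "(\<lambda>x. norm (G2_term (s1, s2, s3, s4, s5, s6) x)) summable_on {1..} \<times> {1..}"
proof (rule Infinite_Sum.abs_summable_on_comparison_test'[OF summable_on_powr_product])
  fix x :: "nat \<times> nat" assume "x \<in> {1..} \<times> {1..}"
  then obtain m n where x: "x = (m, n)" and mn: "m > 0" "n > 0" by auto
  have ge1: "real k powr Re s \<ge> 1" if "k > 0" "Re s \<ge> 0" for k s
    using that by (intro ge_one_powr_ge_zero) auto
  have powr_ge: "real m powr 2 * real n powr 2 * 1 * 1 * 1 * 1 \<le> real m powr Re s1 * real n powr Re s2 * real (m + n) powr Re s3 *
      real (m + 2 * n) powr Re s4 * real (m + 3 * n) powr Re s5 * real (2 * m + 3 * n) powr Re s6"
    using assms mn by (intro mult_mono ge1 powr_mono mult_nonneg_nonneg) auto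
  have "norm (G2_term (s1, s2, s3, s4, s5, s6) x) \<le> 1 / (real m powr 2 * real n powr 2)"
    unfolding x norm_G2_term[OF mn] using powr_ge mn by (intro divide_left_mono mult_pos_pos) auto
  also have "\<dots> = real m powr -2 * real n powr -2" by (simp add: powr_minus divide_inverse)
  finally show "norm (G2_term (s1, s2, s3, s4, s5, s6) x) \<le> (case x of (m, n) \<Rightarrow> real m powr -2 * real n powr -2)"
    by (simp add: x)
qed

text \<open>The complex exponent sits on \<open>n\<close> alone, which stays positive. The remaining
  exponents are even integers, so the other linear forms may take either sign and \<open>m\<close>
  may be any integer.\<close>

definition G2_summand :: "nat \<Rightarrow> nat \<Rightarrow> nat \<Rightarrow> nat \<Rightarrow> nat \<Rightarrow> complex \<Rightarrow> nat \<times> int \<Rightarrow> complex" where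
  "G2_summand p q r u v s = (\<lambda>(n, m). 1 / (of_nat n powr s * (of_int m ^ (2 * p) * of_int (m + int n) ^ (2 * q) *
     of_int (m + 2 * int n) ^ (2 * r) * of_int (m + 3 * int n) ^ (2 * u) * of_int (2 * m + 3 * int n) ^ (2 * v))))"

definition G2_regular_pairs :: "nat \<Rightarrow> int set" where
  "G2_regular_pairs n = {m. m \<noteq> 0 \<and> m + int n \<noteq> 0 \<and> m + 2 * int n \<noteq> 0 \<and> m + 3 * int n \<noteq> 0 \<and> 2 * m + 3 * int n \<noteq> 0}"

lemma G2_term_even_powr:
  assumes "m > 0" "n > 0"
  shows "G2_term (2 * of_nat a, s, 2 * of_nat b, 2 * of_nat c, 2 * of_nat d, 2 * of_nat e) (m, n) =
      1 / (of_nat n powr s * (of_nat m ^ (2 * a) * of_nat (m + n) ^ (2 * b) * of_nat (m + 2 * n) ^ (2 * c) *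
        of_nat (m + 3 * n) ^ (2 * d) * of_nat (2 * m + 3 * n) ^ (2 * e)))" (is ?T1)
    and "G2_term (2 * of_nat a, 2 * of_nat b, s, 2 * of_nat c, 2 * of_nat d, 2 * of_nat e) (m, n) =
      1 / (of_nat (m + n) powr s * (of_nat m ^ (2 * a) * of_nat n ^ (2 * b) * of_nat (m + 2 * n) ^ (2 * c) *
        of_nat (m + 3 * n) ^ (2 * d) * of_nat (2 * m + 3 * n) ^ (2 * e)))" (is ?T2)
    and "G2_term (2 * of_nat a, 2 * of_nat b, 2 * of_nat c, s, 2 * of_nat d, 2 * of_nat e) (m, n) =
      1 / (of_nat (m + 2 * n) powr s * (of_nat m ^ (2 * a) * of_nat n ^ (2 * b) * of_nat (m + n) ^ (2 * c) *
        of_nat (m + 3 * n) ^ (2 * d) * of_nat (2 * m + 3 * n) ^ (2 * e)))" (is ?T3)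
proof -
  have "m + n > 0" "m + 2 * n > 0" "m + 3 * n > 0" "2 * m + 3 * n > 0" using assms by auto
  note powr = of_nat_powr_even[OF assms(1)] of_nat_powr_even[OF assms(2)] this[THEN of_nat_powr_even]
  show "?T1" "?T2" "?T3"
    unfolding G2_term_def prod.case powr by (simp_all only: mult_ac)
qed

text \<open>Each chamber is the image of the positive pairs under a linear substitution of
  determinant 1 or -1. The form carrying the exponent \<open>s\<close> becomes the new
  \<open>n\<close>, and the other five become, up to sign, the five forms in the new pair; even
  exponents absorb the signs.\<close>

lemma has_sum_G2_chambers:
  assumes s: "Re s \<ge> 2" and pos: "p > 0" "q > 0" "r > 0" "u > 0" "v > 0"
  defines "D \<equiv> {1..} \<times> {1..}"
  shows "(G2_summand p q r u v s has_sum
     (infsum (G2_term (2 * of_nat p, s, 2 * of_nat q, 2 * of_nat r, 2 * of_nat u, 2 * of_nat v)) D +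
      infsum (G2_term (2 * of_nat p, 2 * of_nat q, s, 2 * of_nat r, 2 * of_nat v, 2 * of_nat u)) D +
      infsum (G2_term (2 * of_nat u, 2 * of_nat r, s, 2 * of_nat q, 2 * of_nat v, 2 * of_nat p)) D +
      infsum (G2_term (2 * of_nat u, s, 2 * of_nat r, 2 * of_nat q, 2 * of_nat p, 2 * of_nat v)) D +
      infsum (G2_term (2 * of_nat v, 2 * of_nat r, 2 * of_nat q, s, 2 * of_nat u, 2 * of_nat p)) D +
      infsum (G2_term (2 * of_nat v, 2 * of_nat q, 2 * of_nat r, s, 2 * of_nat p, 2 * of_nat u)) D))
     (Sigma {1..} G2_regular_pairs)"
proof -
  have summ: "(G2_term (s1, s2, s3, s4, s5, s6) has_sum infsum (G2_term (s1, s2, s3, s4, s5, s6)) D) D"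
    if "Re s1 \<ge> 2" "Re s2 \<ge> 2" "Re s3 \<ge> 0" "Re s4 \<ge> 0" "Re s5 \<ge> 0" "Re s6 \<ge> 0" for s1 s2 s3 s4 s5 s6
    using abs_summable_summable[OF G2_abs_summable[OF that]] unfolding D_def by (rule has_sum_infsum)
  have Re_ge: "Re (2 * of_nat k) \<ge> 2" if "k > 0" for k
    using that by simp
  note Re_ge = pos[THEN Re_ge] s
  have Re_ge0: "Re z \<ge> 0" if "Re z \<ge> 2" for z using that by linarith
  note summ = summ[OF _ _ Re_ge0 Re_ge0 Re_ge0 Re_ge0]
  let ?T = "G2_summand p q r u v s"
  \<comment> \<open>The numbering follows the order of the six series. Ordered by decreasing
    \<open>m / n\<close> the chambers are \<open>X1\<close>, \<open>X2\<close>, \<open>X6\<close>,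
    \<open>X5\<close>, \<open>X3\<close>, \<open>X4\<close>, separated by the poles 0, -1, -3/2, -2,
    -3.\<close>
  define X1 where "X1 = {(n::nat, m::int). n \<ge> 1 \<and> m > 0}"
  define X2 where "X2 = {(n::nat, m::int). n \<ge> 1 \<and> m < 0 \<and> m + int n > 0}"
  define X3 where "X3 = {(n::nat, m::int). n \<ge> 1 \<and> m + 2 * int n < 0 \<and> m + 3 * int n > 0}"
  define X4 where "X4 = {(n::nat, m::int). n \<ge> 1 \<and> m + 3 * int n < 0}"
  define X5 where "X5 = {(n::nat, m::int). n \<ge> 1 \<and> 2 * m + 3 * int n < 0 \<and> m + 2 * int n > 0}"
  define X6 where "X6 = {(n::nat, m::int). n \<ge> 1 \<and> m + int n < 0 \<and> 2 * m + 3 * int n > 0}"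
  have "(?T has_sum infsum (G2_term (2 * of_nat p, s, 2 * of_nat q, 2 * of_nat r, 2 * of_nat u, 2 * of_nat v)) D) X1"
    by (rule has_sum_reindex_bij_witness[THEN iffD1, OF _ _ _ _ _ refl
          summ[OF Re_ge(1) Re_ge(6) Re_ge(2) Re_ge(3) Re_ge(4) Re_ge(5)],
          of "\<lambda>(n, m). (nat m, n)" "\<lambda>(m, n). (n, int m)"])
      (auto simp: D_def X1_def G2_summand_def G2_term_even_powr Suc_le_eq)
  moreover have "(?T has_sum infsum (G2_term (2 * of_nat p, 2 * of_nat q, s, 2 * of_nat r, 2 * of_nat v, 2 * of_nat u)) D) X2"
  proof (rule has_sum_reindex_bij_witness[THEN iffD1, OF _ _ _ _ _ refl
          summ[OF Re_ge(1) Re_ge(2) Re_ge(6) Re_ge(3) Re_ge(5) Re_ge(4)],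
          of "\<lambda>(n, m). (nat (- m), nat (m + int n))" "\<lambda>(m, n). (m + n, - int m)"])
    fix a assume "a \<in> D"
    then obtain m n where a: "a = (m, n)" and mn: "m > 0" "n > 0" by (auto simp: D_def)
    have "- int m + int (m + n) = int n" "- int m + 2 * int (m + n) = int (m + 2 * n)"
      "- int m + 3 * int (m + n) = int (2 * m + 3 * n)" "2 * - int m + 3 * int (m + n) = int (m + 3 * n)" by auto
    then show "?T (case a of (m, n) \<Rightarrow> (m + n, - int m)) =
        G2_term (2 * of_nat p, 2 * of_nat q, s, 2 * of_nat r, 2 * of_nat v, 2 * of_nat u) a"
      unfolding a G2_summand_def prod.case G2_term_even_powr[OF mn]
      by (simp only: of_int_minus power_minus_even dvd_triv_left of_int_of_nat_eq) (simp only: mult_ac)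
  qed (auto simp: D_def X2_def)
  moreover have "(?T has_sum infsum (G2_term (2 * of_nat u, 2 * of_nat r, s, 2 * of_nat q, 2 * of_nat v, 2 * of_nat p)) D) X3"
  proof (rule has_sum_reindex_bij_witness[THEN iffD1, OF _ _ _ _ _ refl
          summ[OF Re_ge(4) Re_ge(3) Re_ge(6) Re_ge(2) Re_ge(5) Re_ge(1)],
          of "\<lambda>(n, m). (nat (m + 3 * int n), nat (- m - 2 * int n))" "\<lambda>(m, n). (m + n, - int (2 * m + 3 * n))"])
    fix a assume "a \<in> D"
    then obtain m n where a: "a = (m, n)" and mn: "m > 0" "n > 0" by (auto simp: D_def)
    have "- int (2 * m + 3 * n) + int (m + n) = - int (m + 2 * n)" "- int (2 * m + 3 * n) + 2 * int (m + n) = - int n"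
      "- int (2 * m + 3 * n) + 3 * int (m + n) = int m" "2 * - int (2 * m + 3 * n) + 3 * int (m + n) = - int (m + 3 * n)" by auto
    then show "?T (case a of (m, n) \<Rightarrow> (m + n, - int (2 * m + 3 * n))) =
        G2_term (2 * of_nat u, 2 * of_nat r, s, 2 * of_nat q, 2 * of_nat v, 2 * of_nat p) a"
      unfolding a G2_summand_def prod.case G2_term_even_powr[OF mn]
      by (simp only: of_int_minus power_minus_even dvd_triv_left of_int_of_nat_eq) (simp only: mult_ac)
  qed (auto simp: D_def X3_def)
  moreover have "(?T has_sum infsum (G2_term (2 * of_nat u, s, 2 * of_nat r, 2 * of_nat q, 2 * of_nat p, 2 * of_nat v)) D) X4"
  proof (rule has_sum_reindex_bij_witness[THEN iffD1, OF _ _ _ _ _ refl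
          summ[OF Re_ge(4) Re_ge(6) Re_ge(3) Re_ge(2) Re_ge(1) Re_ge(5)],
          of "\<lambda>(n, m). (nat (- m - 3 * int n), n)" "\<lambda>(m, n). (n, - int (m + 3 * n))"])
    fix a assume "a \<in> D"
    then obtain m n where a: "a = (m, n)" and mn: "m > 0" "n > 0" by (auto simp: D_def)
    have "- int (m + 3 * n) + int n = - int (m + 2 * n)" "- int (m + 3 * n) + 2 * int n = - int (m + n)"
      "- int (m + 3 * n) + 3 * int n = - int m" "2 * - int (m + 3 * n) + 3 * int n = - int (2 * m + 3 * n)" by auto
    then show "?T (case a of (m, n) \<Rightarrow> (n, - int (m + 3 * n))) =
        G2_term (2 * of_nat u, s, 2 * of_nat r, 2 * of_nat q, 2 * of_nat p, 2 * of_nat v) a"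
      unfolding a G2_summand_def prod.case G2_term_even_powr[OF mn]
      by (simp only: of_int_minus power_minus_even dvd_triv_left of_int_of_nat_eq) (simp only: mult_ac)
  qed (auto simp: D_def X4_def)
  moreover have "(?T has_sum infsum (G2_term (2 * of_nat v, 2 * of_nat r, 2 * of_nat q, s, 2 * of_nat u, 2 * of_nat p)) D) X5"
  proof (rule has_sum_reindex_bij_witness[THEN iffD1, OF _ _ _ _ _ refl
          summ[OF Re_ge(5) Re_ge(3) Re_ge(2) Re_ge(6) Re_ge(4) Re_ge(1)],
          of "\<lambda>(n, m). (nat (- (2 * m + 3 * int n)), nat (m + 2 * int n))" "\<lambda>(m, n). (m + 2 * n, - int (2 * m + 3 * n))"])
    fix a assume "a \<in> D"
    then obtain m n where a: "a = (m, n)" and mn: "m > 0" "n > 0" by (auto simp: D_def)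
    have "- int (2 * m + 3 * n) + int (m + 2 * n) = - int (m + n)" "- int (2 * m + 3 * n) + 2 * int (m + 2 * n) = int n"
      "- int (2 * m + 3 * n) + 3 * int (m + 2 * n) = int (m + 3 * n)" "2 * - int (2 * m + 3 * n) + 3 * int (m + 2 * n) = - int m" by auto
    then show "?T (case a of (m, n) \<Rightarrow> (m + 2 * n, - int (2 * m + 3 * n))) =
        G2_term (2 * of_nat v, 2 * of_nat r, 2 * of_nat q, s, 2 * of_nat u, 2 * of_nat p) a"
      unfolding a G2_summand_def prod.case G2_term_even_powr[OF mn]
      by (simp only: of_int_minus power_minus_even dvd_triv_left of_int_of_nat_eq) (simp only: mult_ac)
  qed (auto simp: D_def X5_def)
  moreover have "(?T has_sum infsum (G2_term (2 * of_nat v, 2 * of_nat q, 2 * of_nat r, s, 2 * of_nat p, 2 * of_nat u)) D) X6"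
  proof (rule has_sum_reindex_bij_witness[THEN iffD1, OF _ _ _ _ _ refl
          summ[OF Re_ge(5) Re_ge(2) Re_ge(3) Re_ge(6) Re_ge(1) Re_ge(4)],
          of "\<lambda>(n, m). (nat (2 * m + 3 * int n), nat (- m - int n))" "\<lambda>(m, n). (m + 2 * n, - int (m + 3 * n))"])
    fix a assume "a \<in> D"
    then obtain m n where a: "a = (m, n)" and mn: "m > 0" "n > 0" by (auto simp: D_def)
    have "- int (m + 3 * n) + int (m + 2 * n) = - int n" "- int (m + 3 * n) + 2 * int (m + 2 * n) = int (m + n)"
      "- int (m + 3 * n) + 3 * int (m + 2 * n) = int (2 * m + 3 * n)" "2 * - int (m + 3 * n) + 3 * int (m + 2 * n) = int m" by auto
    then show "?T (case a of (m, n) \<Rightarrow> (m + 2 * n, - int (m + 3 * n))) =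
        G2_term (2 * of_nat v, 2 * of_nat q, 2 * of_nat r, s, 2 * of_nat p, 2 * of_nat u) a"
      unfolding a G2_summand_def prod.case G2_term_even_powr[OF mn]
      by (simp only: of_int_minus power_minus_even dvd_triv_left of_int_of_nat_eq) (simp only: mult_ac)
  qed (auto simp: D_def X6_def)
  moreover have "X1 \<inter> X2 = {}" "(X1 \<union> X2) \<inter> X3 = {}" "(X1 \<union> X2 \<union> X3) \<inter> X4 = {}"
    "(X1 \<union> X2 \<union> X3 \<union> X4) \<inter> X5 = {}" "(X1 \<union> X2 \<union> X3 \<union> X4 \<union> X5) \<inter> X6 = {}"
    by (auto simp: X1_def X2_def X3_def X4_def X5_def X6_def)
  moreover have "Sigma {1..} G2_regular_pairs = X1 \<union> X2 \<union> X3 \<union> X4 \<union> X5 \<union> X6"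
    by (auto simp: G2_regular_pairs_def X1_def X2_def X3_def X4_def X5_def X6_def)
  ultimately show ?thesis by (simp only:) (intro has_sum_Un_disjoint)
qed

section \<open>Summation over the chambers\<close>

lemma phi_eq: "w \<noteq> 1 \<Longrightarrow> phi w = (2 powr (1 - w) - 1) * zeta w"
proof -
  assume "w \<noteq> 1"
  have "(\<lambda>s. (2 powr (1 - s) - 1) * zeta s) holomorphic_on - {1}"
    by (intro holomorphic_intros holomorphic_zeta) auto
  then have "(\<lambda>s. (2 powr (1 - s) - 1) * zeta s) analytic_on {w}"
    using \<open>w \<noteq> 1\<close> by (auto simp: analytic_at)
  then show ?thesis unfolding phi_def by (rule remove_sings_at_analytic)
qed

text \<open>The combination \<open>(zeta w + phi w) / 2\<close> equals
  \<open>2 powr (- w) * zeta w\<close>, the part of the Dirichlet series over even integers. The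
  index \<open>n\<close> stands for the integer \<open>Suc n\<close>.\<close>

lemma zeta_parity_sums:
  assumes "Re w > 1"
  shows zeta_even_sums: "(\<lambda>n. (if even (Suc n) then 1 else 0) / of_nat (Suc n) powr w) sums ((zeta w + phi w) / 2)"
    and zeta_odd_sums: "(\<lambda>n. (if odd (Suc n) then 1 else 0) / of_nat (Suc n) powr w) sums ((zeta w - phi w) / 2)"
proof -
  have "w \<noteq> 1" using assms by auto
  have half: "(zeta w + phi w) / 2 = 2 powr (- w) * zeta w"
    by (simp add: phi_eq[OF \<open>w \<noteq> 1\<close>] powr_diff powr_minus field_simps)
  define f :: "nat \<Rightarrow> complex" where "f = (\<lambda>n. (if even (Suc n) then 1 else 0) / of_nat (Suc n) powr w)"
  have "f (2 * n + 1) = 2 powr (- w) * (1 / of_nat (Suc n) powr w)" for n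
  proof -
    have "Suc (2 * n + 1) = 2 * Suc n" by simp
    moreover have "of_nat (2 * Suc n) powr w = (2 powr w * of_nat (Suc n) powr w :: complex)"
      unfolding of_nat_mult by (subst powr_times_real) auto
    ultimately show ?thesis
      by (simp only: f_def) (simp add: powr_minus divide_inverse del: of_nat_Suc)
  qed
  then have "(\<lambda>n. f (2 * n + 1)) sums (2 powr (- w) * zeta w)"
    using sums_mult[OF zeta_sums[OF assms], of "2 powr (- w)"] by (simp only:)
  moreover have "f n = 0" if "n \<notin> range (\<lambda>n. 2 * n + 1)" for n
  proof -
    have "odd (Suc n)"
    proof
      assume "even (Suc n)"
      then have "odd n" by simp
      then obtain k where "n = 2 * k + 1" by (rule oddE)
      with that show False by blast
    qed
    then show ?thesis by (simp add: f_def)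
  qed
  ultimately have even: "f sums (2 powr (- w) * zeta w)"
    using sums_mono_reindex[of "\<lambda>n. 2 * n + 1" f] by (simp add: strict_mono_def)
  then show "(\<lambda>n. (if even (Suc n) then 1 else 0) / of_nat (Suc n) powr w) sums ((zeta w + phi w) / 2)"
    unfolding half f_def .
  have "(\<lambda>n. 1 / of_nat (Suc n) powr w - f n) sums (zeta w - (zeta w + phi w) / 2)"
    using even unfolding half by (intro sums_diff zeta_sums assms)
  moreover have "1 / of_nat (Suc n) powr w - f n = (if odd (Suc n) then 1 else 0) / of_nat (Suc n) powr w" for n
    by (simp add: f_def)
  ultimately show "(\<lambda>n. (if odd (Suc n) then 1 else 0) / of_nat (Suc n) powr w) sums ((zeta w - phi w) / 2)"
    by (simp add: field_simps)
qed

definition G2_poles :: "complex set" where "G2_poles = {0, - 1, - 2, - 3, - 3 / 2}"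

definition G2_order :: "nat \<Rightarrow> nat \<Rightarrow> nat \<Rightarrow> nat \<Rightarrow> nat \<Rightarrow> complex \<Rightarrow> nat" where
  "G2_order p q r u v a = 2 * (if a = 0 then p else if a = - 1 then q else if a = - 2 then r else if a = - 3 then u else v)"

definition G2_coeff :: "nat \<Rightarrow> nat \<Rightarrow> nat \<Rightarrow> nat \<Rightarrow> nat \<Rightarrow> complex \<Rightarrow> nat \<Rightarrow> complex" where
  "G2_coeff p q r u v = laurent_coeff G2_poles (G2_order p q r u v)"

lemma sum_even_terms:
  fixes f :: "nat \<Rightarrow> 'a :: comm_monoid_add"
  assumes "\<And>j. odd j \<Longrightarrow> f j = 0"
  shows "(\<Sum>j\<le>2 * K. f j) = (\<Sum>k\<le>K. f (2 * k))"
  using assms by (induction K) (simp_all add: add_ac)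

text \<open>The powers of \<open>Suc n\<close> combine to the exponent \<open>- wk\<close>. At an
  integral pole \<open>2 * Re a\<close> is even and all \<open>n\<close> carry the same factor. At
  \<open>- 3 / 2\<close> it is -3, so even and odd \<open>n\<close> carry factors in the ratio of 1
  to \<open>2 ^ (2 * k) - 1\<close>, and the two halves of the Dirichlet series recombine to
  \<open>Lam\<close>. The factor 2 that is missing there reappears in
  \<open>G2_coeff_minus_3_half\<close>.\<close>

lemma sums_pole_zeta:
  assumes "Re s > 2" and pos: "p > 0" "q > 0" "r > 0" "u > 0" "v > 0" and a: "a \<in> G2_poles" and k: "2 * k \<le> G2_order p q r u v a"
  shows "(\<lambda>n. of_nat (Suc n) ^ (2 * k) / (of_nat (Suc n) powr s * of_nat (Suc n) ^ (2 * (p + q + r + u + v))) *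
      pole_zeta (int (Suc n) * \<lfloor>2 * Re a\<rfloor>) (2 * k)) sums
    (if a = - 3 / 2 then 2 ^ (2 * k) * Lam p q r u v s k else 2 * zeta (2 * of_nat k) * zeta (wk p q r u v s k))"
proof -
  define W where "W = 2 * (p + q + r + u + v)"
  define w where "w = wk p q r u v s k"
  have le: "2 * k \<le> W" using k by (auto simp: W_def G2_order_def split: if_splits)
  have w_eq: "w = s + of_nat (W - 2 * k)"
    using le unfolding w_def wk_def W_def by (simp add: of_nat_diff)
  have "Re w > 1" using assms by (simp add: w_eq)
  have term_eq: "of_nat (Suc n) ^ (2 * k) / (of_nat (Suc n) powr s * of_nat (Suc n) ^ W) = (1 / of_nat (Suc n) powr w :: complex)" for n
  proof -
    have nz: "(of_nat (Suc n) :: complex) \<noteq> 0" by (rule of_nat_neq_0)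
    have "(of_nat (Suc n) :: complex) ^ W = of_nat (Suc n) ^ (2 * k) * of_nat (Suc n) ^ (W - 2 * k)"
      using le by (simp flip: power_add)
    moreover have "of_nat (Suc n) powr w = (of_nat (Suc n) powr s * of_nat (Suc n) ^ (W - 2 * k) :: complex)"
      unfolding w_eq powr_add using nz by (simp add: powr_nat' del: of_nat_Suc)
    ultimately show ?thesis using nz by (simp add: field_simps del: of_nat_Suc)
  qed
  show ?thesis
  proof (cases "a = - 3 / 2")
    case True
    have "(\<lambda>n. 2 * zeta (of_nat (2 * k)) * ((if even (Suc n) then 1 else 0) / of_nat (Suc n) powr w) +
        2 * zeta (of_nat (2 * k)) * (2 ^ (2 * k) - 1) * ((if odd (Suc n) then 1 else 0) / of_nat (Suc n) powr w)) sums
        (2 * zeta (of_nat (2 * k)) * ((zeta w + phi w) / 2) + 2 * zeta (of_nat (2 * k)) * (2 ^ (2 * k) - 1) * ((zeta w - phi w) / 2))"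
      by (intro sums_add sums_mult zeta_parity_sums \<open>Re w > 1\<close>)
    moreover have "2 * zeta (of_nat (2 * k)) * ((if even (Suc n) then 1 else 0) / of_nat (Suc n) powr w) +
        2 * zeta (of_nat (2 * k)) * (2 ^ (2 * k) - 1) * ((if odd (Suc n) then 1 else 0) / of_nat (Suc n) powr w) =
        1 / of_nat (Suc n) powr w * pole_zeta (int (Suc n) * \<lfloor>2 * Re a\<rfloor>) (2 * k)" for n
      using True by (simp add: pole_zeta_def)
    moreover have "2 * zeta (of_nat (2 * k)) * ((zeta w + phi w) / 2) + 2 * zeta (of_nat (2 * k)) * (2 ^ (2 * k) - 1) * ((zeta w - phi w) / 2) =
        2 ^ (2 * k) * Lam p q r u v s k"
    proof -
      have "2 powi (- 2 * int k) = 1 / (2 :: complex) ^ (2 * k)"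
      proof -
        have "- 2 * int k = - int (2 * k)" by simp
        then show ?thesis by (simp only: power_int_minus power_int_of_nat divide_inverse mult_1)
      qed
      moreover have "2 * z * (x / 2) + 2 * z * (t - 1) * (y / 2) = t * (1 / t * z * x + (1 - 1 / t) * z * y)"
        if "t \<noteq> 0" for t x y z :: complex
      proof -
        have "t * (1 / t * z * x + (1 - 1 / t) * z * y) = (t * (1 / t)) * z * x + (t - t * (1 / t)) * z * y"
          by algebra
        then show ?thesis using that by (simp add: algebra_simps)
      qed
      ultimately show ?thesis
        unfolding Lam_def w_def[symmetric] by (simp only: of_nat_mult of_nat_numeral) simp
    qed
    ultimately show ?thesis using True by (simp only: term_eq if_True simp_thms flip: W_def)
  next
    case False
    then have "a \<in> {0, - 1, - 2, - 3}" using a by (auto simp: G2_poles_def)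
    then have "even \<lfloor>2 * Re a\<rfloor>" by auto
    then have "(\<lambda>n. 1 / of_nat (Suc n) powr w * pole_zeta (int (Suc n) * \<lfloor>2 * Re a\<rfloor>) (2 * k)) sums (zeta w * (2 * zeta (of_nat (2 * k))))"
      using sums_mult2[OF zeta_sums[OF \<open>Re w > 1\<close>]] by (simp add: pole_zeta_def)
    moreover have "zeta w * (2 * zeta (of_nat (2 * k))) = 2 * zeta (2 * of_nat k) * zeta w" by simp
    ultimately show ?thesis unfolding if_not_P[OF False] W_def[symmetric] w_def[symmetric] term_eq by (simp only:)
  qed
qed

text \<open>The divisor \<open>2 ^ (2 * v)\<close> arises because \<open>2 * m + 3 * n\<close> is
  \<open>2 * n * (x + 3 / 2)\<close> for \<open>x = m / n\<close>. Only even orders are listed,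
  since \<open>pole_zeta\<close> vanishes at odd ones.\<close>

definition G2_closed :: "nat \<Rightarrow> nat \<Rightarrow> nat \<Rightarrow> nat \<Rightarrow> nat \<Rightarrow> complex \<Rightarrow> complex" where
  "G2_closed p q r u v s = (\<Sum>a\<in>G2_poles. \<Sum>k\<le>G2_order p q r u v a div 2. G2_coeff p q r u v a (2 * k) *
     (if a = - 3 / 2 then 2 ^ (2 * k) * Lam p q r u v s k else 2 * zeta (2 * of_nat k) * zeta (wk p q r u v s k))) / 2 ^ (2 * v)"

lemma has_sum_imp_sums_Suc: "(f has_sum S) {1..} \<Longrightarrow> (\<lambda>n. f (Suc n)) sums (S :: 'a :: {comm_monoid_add, topological_comm_monoid_add, t2_space})"
proof -
  assume "(f has_sum S) {1..}"
  moreover have "(f has_sum S) {1..} = ((\<lambda>n. f (Suc n)) has_sum S) UNIV"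
    by (rule has_sum_reindex_bij_witness[of _ Suc "\<lambda>n. n - 1"]) auto
  ultimately show ?thesis by (simp add: has_sum_imp_sums)
qed

text \<open>The unconditional double sum may be evaluated row by row. For fixed \<open>n\<close>,
  dividing every linear form by \<open>n\<close> leaves a rational function of \<open>m / n\<close>
  times the power of \<open>n\<close> collected in \<open>N\<close>.\<close>

theorem G2_summand_total:
  assumes s: "Re s > 2" and pos: "p > 0" "q > 0" "r > 0" "u > 0" "v > 0"
    and total: "(G2_summand p q r u v s has_sum S) (Sigma {1..} G2_regular_pairs)"
  shows "S = G2_closed p q r u v s"
proof -
  define e where "e = G2_order p q r u v"
  define W where "W = 2 * (p + q + r + u + v)"
  define h where "h = (\<lambda>a. \<lfloor>2 * Re a\<rfloor>)"
  define c where "c = G2_coeff p q r u v"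
  define R where "R = (\<lambda>n. \<Sum>a\<in>G2_poles. \<Sum>j\<le>e a. c a j * of_nat n ^ j * pole_zeta (int n * h a) j)"
  define N where "N = (\<lambda>n::nat. 1 / (of_nat n powr s * of_nat n ^ W * 2 ^ (2 * v)) :: complex)"
  have e_pos: "e a > 0" for a using pos by (simp add: e_def G2_order_def)
  have h: "a = of_int (h a) / 2" if "a \<in> G2_poles" for a
    using that by (auto simp: G2_poles_def h_def complex_eq_iff)
  have slice: "((\<lambda>m. G2_summand p q r u v s (n, m)) has_sum N n * R n) (G2_regular_pairs n)" if n: "n \<in> {1..}" for n
  proof -
    have n0: "(of_nat n :: complex) \<noteq> 0" using n by simp
    define P where "P = (\<lambda>m::int. \<Prod>b\<in>G2_poles. 1 / (of_int m / of_nat n - b) ^ e b)"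
    have regular: "G2_regular_pairs n = {m. of_int m / of_nat n \<notin> G2_poles}"
    proof -
      have "of_int m / of_nat n = (of_int k / of_nat l :: complex) \<longleftrightarrow> int l * m = k * int n" if "l > 0" for m k l
      proof -
        have "of_int m / of_nat n = (of_int k / of_nat l :: complex) \<longleftrightarrow> of_int (int l * m) = (of_int (k * int n) :: complex)"
          using n0 that by (auto simp: field_simps)
        then show ?thesis unfolding of_int_eq_iff .
      qed
      from this[of 1 _ 0] this[of 1 _ "-1"] this[of 1 _ "-2"] this[of 1 _ "-3"] this[of 2 _ "-3"]
      show ?thesis by (auto simp: G2_regular_pairs_def G2_poles_def)
    qed
    have summand: "G2_summand p q r u v s (n, m) = N n * P m" for m
    proof -
      have "P m = 1 / (of_int m / of_nat n) ^ (2 * p) * (1 / (of_int m / of_nat n + 1) ^ (2 * q)) *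
          (1 / (of_int m / of_nat n + 2) ^ (2 * r)) * (1 / (of_int m / of_nat n + 3) ^ (2 * u)) *
          (1 / (of_int m / of_nat n + 3 / 2) ^ (2 * v))"
        by (simp add: P_def G2_poles_def e_def G2_order_def mult_ac)
      also have "of_int m / of_nat n + 1 = (of_int (m + int n) / of_nat n :: complex)" using n0 by (simp add: field_simps)
      also have "of_int m / of_nat n + 2 = (of_int (m + 2 * int n) / of_nat n :: complex)" using n0 by (simp add: field_simps)
      also have "of_int m / of_nat n + 3 = (of_int (m + 3 * int n) / of_nat n :: complex)" using n0 by (simp add: field_simps)
      also have "of_int m / of_nat n + 3 / 2 = (of_int (2 * m + 3 * int n) / (2 * of_nat n) :: complex)" using n0 by (simp add: field_simps)
      finally have P: "P m = of_nat n ^ W * 2 ^ (2 * v) / (of_int m ^ (2 * p) * of_int (m + int n) ^ (2 * q) *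
          of_int (m + 2 * int n) ^ (2 * r) * of_int (m + 3 * int n) ^ (2 * u) * of_int (2 * m + 3 * int n) ^ (2 * v))"
        by (simp add: power_divide power_mult_distrib W_def power_add distrib_left mult_ac del: of_int_add of_int_mult)
      show ?thesis unfolding P N_def G2_summand_def using n0 by simp
    qed
    \<comment> \<open>Summability of the row is inherited from the double sum. The value
      \<open>T\<close> is then found by comparing the limits along symmetric windows.\<close>
    have "(\<lambda>m. G2_summand p q r u v s (n, m)) summable_on G2_regular_pairs n"
      using total n by (intro summable_on_SigmaD1[where f = "\<lambda>n m. G2_summand p q r u v s (n, m)"]) (auto simp: summable_on_def)
    then obtain T where T: "((\<lambda>m. G2_summand p q r u v s (n, m)) has_sum T) (G2_regular_pairs n)"
      by (auto simp: summable_on_def)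
    have "(\<lambda>M. \<Sum>m\<in>G2_regular_pairs n \<inter> {- int M..int M}. P m) \<longlonglongrightarrow> R n"
      unfolding regular P_def R_def c_def G2_coeff_def e_def[symmetric]
      by (rule tendsto_sum_rational) (use n h e_pos in \<open>auto simp: G2_poles_def\<close>)
    then have "(\<lambda>M. N n * (\<Sum>m\<in>G2_regular_pairs n \<inter> {- int M..int M}. P m)) \<longlonglongrightarrow> N n * R n"
      by (intro tendsto_intros)
    moreover have "(\<lambda>M. N n * (\<Sum>m\<in>G2_regular_pairs n \<inter> {- int M..int M}. P m)) \<longlonglongrightarrow> T"
      using has_sum_imp_tendsto_symmetric_sum[OF T] by (simp add: summand sum_distrib_left)
    ultimately have "T = N n * R n" using LIMSEQ_unique by blast
    then show ?thesis using T by simp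
  qed
  have "((\<lambda>n. N n * R n) has_sum S) {1..}"
    using total slice by (rule has_sum_SigmaD)
  then have 1: "(\<lambda>n. N (Suc n) * R (Suc n)) sums S" by (rule has_sum_imp_sums_Suc)
  have R_eq: "R n = (\<Sum>a\<in>G2_poles. \<Sum>k\<le>e a div 2. c a (2 * k) * of_nat n ^ (2 * k) * pole_zeta (int n * h a) (2 * k))" for n
    unfolding R_def
  proof (rule sum.cong[OF refl])
    fix a
    have e_a: "e a = 2 * (e a div 2)" by (simp add: e_def G2_order_def)
    show "(\<Sum>j\<le>e a. c a j * of_nat n ^ j * pole_zeta (int n * h a) j) =
        (\<Sum>k\<le>e a div 2. c a (2 * k) * of_nat n ^ (2 * k) * pole_zeta (int n * h a) (2 * k))"
      by (subst e_a, rule sum_even_terms) (simp add: pole_zeta_def)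
  qed
  have "(\<lambda>n. (\<Sum>a\<in>G2_poles. \<Sum>k\<le>e a div 2. c a (2 * k) *
      (of_nat (Suc n) ^ (2 * k) / (of_nat (Suc n) powr s * of_nat (Suc n) ^ W) * pole_zeta (int (Suc n) * h a) (2 * k))) / 2 ^ (2 * v)) sums
      G2_closed p q r u v s"
    unfolding G2_closed_def W_def c_def h_def e_def
    by (intro sums_divide sums_sum sums_mult sums_pole_zeta s pos) auto
  moreover have "(\<Sum>a\<in>G2_poles. \<Sum>k\<le>e a div 2. c a (2 * k) *
      (of_nat (Suc n) ^ (2 * k) / (of_nat (Suc n) powr s * of_nat (Suc n) ^ W) * pole_zeta (int (Suc n) * h a) (2 * k))) / 2 ^ (2 * v)
      = N (Suc n) * R (Suc n)" for n
    unfolding R_eq N_def sum_distrib_left sum_divide_distrib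
    by (intro sum.cong refl) (simp add: mult_ac del: of_nat_Suc)
  ultimately have "(\<lambda>n. N (Suc n) * R (Suc n)) sums G2_closed p q r u v s" by (simp only:)
  with 1 show ?thesis by (rule sums_unique2)
qed

section \<open>Continuation in six variables\<close>

text \<open>Restriction to such a line turns a function holomorphic in six variables into one
  holomorphic in \<open>t\<close>. Both the six lines of the relation and the line joining two given
  points have this form.\<close>

definition complex6_line :: "complex6 \<Rightarrow> complex6 \<Rightarrow> complex \<Rightarrow> complex6" where
  "complex6_line = (\<lambda>(a1, a2, a3, a4, a5, a6) (b1, b2, b3, b4, b5, b6) t.
     (a1 + t * b1, a2 + t * b2, a3 + t * b3, a4 + t * b4, a5 + t * b5, a6 + t * b6))"

lemma continuous_complex6_line: "continuous_on UNIV (complex6_line a b)"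
  by (cases a, cases b) (auto simp: complex6_line_def intro!: continuous_intros)

lemma open_vimage_complex6_line: "open U \<Longrightarrow> open {t. complex6_line a b t \<in> U}"
  using open_vimage[OF _ continuous_complex6_line, of U a b] by (simp add: vimage_def)

lemma holomorphic_on_complex6_line:
  assumes "holomorphic6_on f U"
  shows "(\<lambda>t. f (complex6_line a b t)) holomorphic_on {t. complex6_line a b t \<in> U}"
proof -
  obtain a1 a2 a3 a4 a5 a6 where a: "a = (a1, a2, a3, a4, a5, a6)" by (metis surj_pair)
  obtain b1 b2 b3 b4 b5 b6 where b: "b = (b1, b2, b3, b4, b5, b6)" by (metis surj_pair)
  have line: "(complex6_line a b has_derivative (\<lambda>h. (h * b1, h * b2, h * b3, h * b4, h * b5, h * b6))) (at t)" for t
    unfolding a b complex6_line_def prod.case by (auto intro!: derivative_eq_intros)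
  have "\<exists>D. ((\<lambda>t. f (complex6_line a b t)) has_field_derivative D) (at t)" if t: "complex6_line a b t \<in> U" for t
  proof -
    obtain c1 c2 c3 c4 c5 c6 where f: "(f has_derivative
        (\<lambda>(h1, h2, h3, h4, h5, h6). c1 * h1 + c2 * h2 + c3 * h3 + c4 * h4 + c5 * h5 + c6 * h6)) (at (complex6_line a b t))"
      using assms t unfolding holomorphic6_on_def by blast
    have comp: "(\<lambda>(h1, h2, h3, h4, h5, h6). c1 * h1 + c2 * h2 + c3 * h3 + c4 * h4 + c5 * h5 + c6 * h6) \<circ>
        (\<lambda>h. (h * b1, h * b2, h * b3, h * b4, h * b5, h * b6)) = (*) (c1 * b1 + c2 * b2 + c3 * b3 + c4 * b4 + c5 * b5 + c6 * b6)"
      by (simp add: fun_eq_iff algebra_simps)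
    have "((\<lambda>t. f (complex6_line a b t)) has_derivative
        (*) (c1 * b1 + c2 * b2 + c3 * b3 + c4 * b4 + c5 * b5 + c6 * b6)) (at t)"
      using diff_chain_at[OF line f] unfolding comp by (simp only: comp_def)
    then show ?thesis unfolding has_field_derivative_def by blast
  qed
  moreover have "open {t. complex6_line a b t \<in> U}"
    using assms by (intro open_vimage_complex6_line) (simp add: holomorphic6_on_def)
  ultimately show ?thesis by (simp add: holomorphic_on_open)
qed

text \<open>The value at \<open>t0\<close> rules out that the equation holds identically: for
  \<open>B = 0\<close> it then has no solution, and otherwise at most one.\<close>

lemma countable_affine_solutions:
  fixes A B c :: complex
  assumes "A + t0 * B \<noteq> c"
  shows "countable {t. A + t * B = c}"
proof -
  have "t = t'" if "A + t * B = c" "A + t' * B = c" for t t'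
  proof -
    have "A + t * B = A + t' * B" by (simp only: that)
    moreover have "B \<noteq> 0" using assms that by auto
    ultimately show ?thesis by simp
  qed
  then have "{t. A + t * B = c} \<subseteq> {THE t. A + t * B = c}" by (auto intro: the_equality[symmetric])
  then show ?thesis using countable_subset by blast
qed

lemma countable_line_singularities:
  assumes "complex6_line a b t0 \<notin> G2_possible_singularities"
  shows "countable {t. complex6_line a b t \<in> G2_possible_singularities}"
proof -
  obtain a1 a2 a3 a4 a5 a6 where a: "a = (a1, a2, a3, a4, a5, a6)" by (metis surj_pair)
  obtain b1 b2 b3 b4 b5 b6 where b: "b = (b1, b2, b3, b4, b5, b6)" by (metis surj_pair)
  define A where "A = a3 + a4 + a5 + a6"
  define B where "B = b3 + b4 + b5 + b6"
  have forms: "(a1 + t * b1) + (a3 + t * b3) + (a4 + t * b4) + (a5 + t * b5) + (a6 + t * b6) = (a1 + A) + t * (b1 + B)"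
    "(a2 + t * b2) + (a3 + t * b3) + (a4 + t * b4) + (a5 + t * b5) + (a6 + t * b6) = (a2 + A) + t * (b2 + B)"
    "(a1 + t * b1) + (a2 + t * b2) + (a3 + t * b3) + (a4 + t * b4) + (a5 + t * b5) + (a6 + t * b6) = (a1 + a2 + A) + t * (b1 + b2 + B)" for t
    by (simp_all add: A_def B_def algebra_simps)
  have sing: "complex6_line a b t \<in> G2_possible_singularities \<longleftrightarrow>
      (\<exists>l::nat. (a1 + A) + t * (b1 + B) = 1 - of_nat l) \<or> (\<exists>l::nat. (a2 + A) + t * (b2 + B) = 1 - of_nat l) \<or>
      (a1 + a2 + A) + t * (b1 + b2 + B) = 2" for t
    by (simp only: a b complex6_line_def G2_possible_singularities_def prod.case mem_Collect_eq forms)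
  have "{t. complex6_line a b t \<in> G2_possible_singularities} =
      (\<Union>l::nat. {t. (a1 + A) + t * (b1 + B) = 1 - of_nat l}) \<union> (\<Union>l::nat. {t. (a2 + A) + t * (b2 + B) = 1 - of_nat l}) \<union>
      {t. (a1 + a2 + A) + t * (b1 + b2 + B) = 2}"
    unfolding sing by blast
  moreover have "countable {t. (a1 + A) + t * (b1 + B) = 1 - of_nat l}" "countable {t. (a2 + A) + t * (b2 + B) = 1 - of_nat l}"
    "countable {t. (a1 + a2 + A) + t * (b1 + b2 + B) = 2}" for l :: nat
    using assms by (auto simp: sing intro!: countable_affine_solutions[where ?t0.0 = t0])
  ultimately show ?thesis by auto
qed

lemma connected_cocountable:
  fixes C :: "complex set"
  assumes "countable C"
  shows "connected (- C)"
  using connected_open_diff_countable[of "UNIV :: complex set" C] connected_UNIV assms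
  by (simp add: Compl_eq_Diff_UNIV)

lemma G2_continuation_series:
  assumes "G2_continuation f" "Re s1 \<ge> 2" "Re s2 \<ge> 2" "Re s3 \<ge> 0" "Re s4 \<ge> 0" "Re s5 \<ge> 0" "Re s6 \<ge> 0"
  shows "f (s1, s2, s3, s4, s5, s6) = infsum (G2_term (s1, s2, s3, s4, s5, s6)) ({1..} \<times> {1..})"
  using assms(1) G2_abs_summable[OF assms(2-)] unfolding G2_continuation_def by blast

text \<open>A complex line joins \<open>z\<close> to a point where the series converges. It leaves
  the complement of the possible singularities only at countably many parameters, so what remains is
  connected and the one-variable identity theorem applies.\<close>

lemma G2_continuation_unique:
  assumes f: "G2_continuation f" and g: "G2_continuation g" and z: "z \<notin> G2_possible_singularities"
  shows "f z = g z"
proof -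
  obtain z1 z2 z3 z4 z5 z6 where z_eq: "z = (z1, z2, z3, z4, z5, z6)" by (metis surj_pair)
  \<comment> \<open>At \<open>t = 0\<close> all six coordinates are 3, so near there the series
    prescribes both values. The defining forms equal 15, 15 and 18 at that point and avoid the
    singular values.\<close>
  define L where "L = complex6_line (3, 3, 3, 3, 3, 3) (z1 - 3, z2 - 3, z3 - 3, z4 - 3, z5 - 3, z6 - 3)"
  define R where "R = {t. L t \<in> - G2_possible_singularities}"
  define V where "V = {t. Re (3 + t * (z1 - 3)) > 2} \<inter> {t. Re (3 + t * (z2 - 3)) > 2} \<inter> {t. Re (3 + t * (z3 - 3)) > 2} \<inter>
    {t. Re (3 + t * (z4 - 3)) > 2} \<inter> {t. Re (3 + t * (z5 - 3)) > 2} \<inter> {t. Re (3 + t * (z6 - 3)) > 2}"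
  have L1: "L 1 = z" by (simp add: L_def complex6_line_def z_eq)
  have countable: "countable {t. L t \<in> G2_possible_singularities}"
    unfolding L_def by (rule countable_line_singularities[where ?t0.0 = 1]) (use L1 z in \<open>simp add: L_def\<close>)
  have "L 0 \<notin> G2_possible_singularities"
  proof -
    have ne: "(15 :: complex) \<noteq> 1 - of_nat l" for l
    proof
      assume "(15 :: complex) = 1 - of_nat l"
      then have "of_nat (l + 14) = (0 :: complex)" by (simp add: algebra_simps)
      then show False by (simp only: of_nat_eq_0_iff)
    qed
    then show ?thesis by (simp add: L_def complex6_line_def G2_possible_singularities_def)
  qed
  then have "0 \<in> V \<inter> R" by (simp add: V_def R_def)
  have "R = - {t. L t \<in> G2_possible_singularities}" by (auto simp: R_def)
  then have "connected R" using connected_cocountable[OF countable] by simp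
  have "open V"
    unfolding V_def by (intro open_Int open_Collect_less continuous_intros)
  have "open R"
    unfolding R_def L_def using f by (intro open_vimage_complex6_line) (simp add: G2_continuation_def holomorphic6_on_def)
  have hol: "(\<lambda>t. h (L t)) holomorphic_on R" if "G2_continuation h" for h
    unfolding R_def L_def using that by (intro holomorphic_on_complex6_line) (simp add: G2_continuation_def)
  have "f (L 1) = g (L 1)"
  proof (rule analytic_continuation_open[of "V \<inter> R" R "\<lambda>t. f (L t)" "\<lambda>t. g (L t)"])
    show "f (L t) = g (L t)" if "t \<in> V \<inter> R" for t
    proof -
      have "h (L t) = infsum (G2_term (L t)) ({1..} \<times> {1..})" if "G2_continuation h" for h
        unfolding L_def complex6_line_def prod.case using that \<open>t \<in> V \<inter> R\<close>
        by (intro G2_continuation_series) (auto simp: V_def)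
      from this[OF f] this[OF g] show ?thesis by simp
    qed
    show "1 \<in> R" using L1 z by (simp add: R_def)
  qed (use \<open>0 \<in> V \<inter> R\<close> \<open>open V\<close> \<open>open R\<close> \<open>connected R\<close> hol f g in auto)
  then show ?thesis by (simp add: L1)
qed

lemma zeta_G2_eq:
  assumes f: "G2_continuation f" and z: "z \<notin> G2_possible_singularities"
  shows "zeta_G2 z = f z"
  unfolding zeta_G2_def
proof (rule the_equality)
  show "G2_regular_value z (f z)"
    unfolding G2_regular_value_def using f z
    by (intro exI[of _ f] exI[of _ "- G2_possible_singularities"]) (simp add: G2_continuation_def)
next
  fix c assume "G2_regular_value z c"
  then show "c = f z"
    unfolding G2_regular_value_def using G2_continuation_unique[OF _ f z] by blast
qed

text \<open>Off the possible singularities the restriction is already analytic, so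
  \<open>remove_sings\<close> does not change its value.\<close>

lemma zeta_G2_line_eq:
  assumes f: "G2_continuation f" and t: "complex6_line a b t \<notin> G2_possible_singularities"
  shows "zeta_G2_line (complex6_line a b) t = f (complex6_line a b t)"
proof -
  define R where "R = {t. complex6_line a b t \<in> - G2_possible_singularities}"
  have "(\<lambda>t. f (complex6_line a b t)) holomorphic_on R"
    unfolding R_def using f by (intro holomorphic_on_complex6_line) (simp add: G2_continuation_def)
  then have "(\<lambda>t. zeta_G2 (complex6_line a b t)) holomorphic_on R"
    by (rule holomorphic_transform) (simp add: R_def zeta_G2_eq[OF f])
  moreover have "open R"
    unfolding R_def using f by (intro open_vimage_complex6_line) (simp add: G2_continuation_def holomorphic6_on_def)
  ultimately have "(\<lambda>t. zeta_G2 (complex6_line a b t)) analytic_on {t}"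
    using t by (auto simp: analytic_at R_def)
  then have "zeta_G2_line (complex6_line a b) t = zeta_G2 (complex6_line a b t)"
    unfolding zeta_G2_line_def by (rule remove_sings_at_analytic)
  then show ?thesis using zeta_G2_eq[OF f t] by simp
qed

text \<open>Regularity at \<open>s\<close> makes nearby points of the line nonsingular, and a
  regular value at any one of them is by definition taken by some continuation.\<close>

lemma zeta_G2_line_regular_imp_continuation:
  assumes "zeta_G2_line_regular L s"
  obtains f where "G2_continuation f"
proof -
  have "\<forall>\<^sub>F t in at s. \<not> zeta_G2_singular (L t)" using assms by (simp add: zeta_G2_line_regular_def)
  then obtain t where "\<not> zeta_G2_singular (L t)"
    using eventually_happens trivial_limit_at by blast
  then show ?thesis using that unfolding zeta_G2_singular_def G2_regular_value_def by blast
qed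

text \<open>A nonzero value at \<open>s\<close> would persist on a disc by continuity, and that
  uncountable disc would have to lie inside \<open>C\<close>. The point \<open>s\<close> itself may
  belong to \<open>C\<close>.\<close>

lemma analytic_zero_off_countable:
  fixes F :: "complex \<Rightarrow> complex"
  assumes "F analytic_on {s}" "countable C" "\<And>t. t \<notin> C \<Longrightarrow> F t = 0"
  shows "F s = 0"
proof (rule ccontr)
  assume "F s \<noteq> 0"
  have "isCont F s" using assms(1) analytic_at_imp_isCont by blast
  then obtain e where "e > 0" and e: "\<And>t. dist s t < e \<Longrightarrow> F t \<noteq> 0"
    using continuous_at_avoid[of s F 0] \<open>F s \<noteq> 0\<close> by blast
  then have "ball s e \<subseteq> C" using assms(3) by (auto simp: subset_iff)
  then have "countable (ball s e)" using assms(2) countable_subset by blast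
  then show False using \<open>e > 0\<close> uncountable_ball by blast
qed

section \<open>Laurent coefficients in closed form\<close>

lemma pole_fps_minus_nth: "pole_fps (- c) n $ i = (-1) ^ n * of_nat ((n + i - 1) choose i) / c ^ (n + i)"
proof -
  have "(- c) ^ (n + i) = (-1) ^ n * (-1) ^ i * c ^ (n + i)"
    by (subst power_minus) (simp add: power_add)
  then show ?thesis
    by (cases "even n"; cases "even i") (simp_all add: pole_fps_nth)
qed

text \<open>The lower index of the binomial coefficient is switched from \<open>i\<close> to
  \<open>n\<close>, the pole order minus one. In this form \<open>n\<close> can serve as the
  summation index of the closed formulas.\<close>

lemma pole_fps_minus_Suc_nth:
  "pole_fps (- c) (Suc n) $ i = (-1) ^ Suc n * of_nat ((n + i) choose n) / c ^ (n + 1 + i)"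
  by (simp add: pole_fps_minus_nth binomial_symmetric[of i "n + i"])

lemma pole_fps_Suc_nth':
  "pole_fps c (Suc n) $ i = (-1) ^ i * of_nat ((n + i) choose n) / c ^ (n + 1 + i)"
  by (simp add: pole_fps_nth binomial_symmetric[of i "n + i"])

lemma pole_fps_1_nth:
  assumes "q > 0"
  shows "pole_fps 1 (2 * q) $ i = (-1) ^ i * of_nat ((i + 2 * q - 1) choose (2 * q - 1))"
proof -
  have "(i + 2 * q - 1) choose i = (i + 2 * q - 1) choose (2 * q - 1)"
    using assms by (subst binomial_symmetric) auto
  then show ?thesis by (simp add: pole_fps_nth add.commute)
qed

lemma pole_fps_minus_1_nth:
  assumes "p > 0"
  shows "pole_fps (- 1) (2 * p) $ i = of_nat ((i + 2 * p - 1) choose (2 * p - 1))"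
proof -
  have "(i + 2 * p - 1) choose i = (i + 2 * p - 1) choose (2 * p - 1)"
    using assms by (subst binomial_symmetric) auto
  then show ?thesis by (simp add: pole_fps_minus_nth add.commute)
qed

lemma sum_atLeast1_shift: "n > 0 \<Longrightarrow> (\<Sum>j=Suc 0..n. f j) = (\<Sum>i=0..n - Suc 0. f (Suc i) :: 'a :: comm_monoid_add)"
  by (rule sum.reindex_bij_witness[of _ Suc "\<lambda>j. j - 1"]) auto

lemma minus_one_power_mult_self: "(-1) ^ a * (-1) ^ b = (1 :: complex)" if "even (a + b)"
  using that by (simp flip: power_add)

text \<open>This is the Taylor coefficient at -2 of \<open>x ^ (-2p) * (x + 1) ^ (-2q)\<close>.
  Computing it by partial fractions instead of convolution gives one sum for each pole, of length
  \<open>2 * p\<close> and \<open>2 * q\<close>, with \<omega> the order of the principal part minus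
  one.\<close>

lemma pole_pair_nth:
  assumes "p > 0" "q > 0"
  shows "(pole_fps (- 2) (2 * p) * pole_fps (- 1) (2 * q)) $ N =
    (\<Sum>\<omega>=0..2 * p - 1. of_nat ((\<omega> + N) choose \<omega>) * of_nat ((2 * p + 2 * q - 2 - \<omega>) choose (2 * q - 1)) / 2 ^ (\<omega> + 1 + N)) -
    (\<Sum>\<omega>=0..2 * q - 1. of_nat ((\<omega> + N) choose \<omega>) * of_nat ((2 * p + 2 * q - 2 - \<omega>) choose (2 * p - 1)) * (-1) ^ \<omega>)"
proof -
  have "(pole_fps (- 2) (2 * p) * pole_fps (- 1) (2 * q)) $ N =
     (\<Sum>\<omega>=0..2 * p - 1. pole_fps 1 (2 * q) $ (2 * p - Suc \<omega>) * pole_fps (- 2) (Suc \<omega>) $ N) +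
     (\<Sum>\<omega>=0..2 * q - 1. pole_fps (- 1) (2 * p) $ (2 * q - Suc \<omega>) * pole_fps (- 1) (Suc \<omega>) $ N)"
    using pole_fps_mult[of "- 2" "- 1" "2 * p" "2 * q"] assms
    by (simp add: fps_sum_nth sum_atLeast1_shift)
  also have "(\<Sum>\<omega>=0..2 * p - 1. pole_fps 1 (2 * q) $ (2 * p - Suc \<omega>) * pole_fps (- 2) (Suc \<omega>) $ N) =
    (\<Sum>\<omega>=0..2 * p - 1. of_nat ((\<omega> + N) choose \<omega>) * of_nat ((2 * p + 2 * q - 2 - \<omega>) choose (2 * q - 1)) / 2 ^ (\<omega> + 1 + N))"
  proof (rule sum.cong[OF refl])
    fix \<omega> assume "\<omega> \<in> {0..2 * p - 1}"
    then have "2 * p - Suc \<omega> + 2 * q - 1 = 2 * p + 2 * q - 2 - \<omega>" and ev: "even (2 * p - Suc \<omega> + Suc \<omega>)"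
      using assms by auto
    then have "pole_fps 1 (2 * q) $ (2 * p - Suc \<omega>) * pole_fps (- 2) (Suc \<omega>) $ N =
        ((-1) ^ (2 * p - Suc \<omega>) * (-1) ^ Suc \<omega>) * (of_nat ((\<omega> + N) choose \<omega>) *
          of_nat ((2 * p + 2 * q - 2 - \<omega>) choose (2 * q - 1)) / 2 ^ (\<omega> + 1 + N))"
      by (simp only: pole_fps_1_nth[OF assms(2)] pole_fps_minus_Suc_nth, simp only: times_divide_eq_right)
        (simp only: mult_ac)
    then show "pole_fps 1 (2 * q) $ (2 * p - Suc \<omega>) * pole_fps (- 2) (Suc \<omega>) $ N =
        of_nat ((\<omega> + N) choose \<omega>) * of_nat ((2 * p + 2 * q - 2 - \<omega>) choose (2 * q - 1)) / 2 ^ (\<omega> + 1 + N)"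
      unfolding minus_one_power_mult_self[OF ev] by (simp only: mult_1)
  qed
  also have "(\<Sum>\<omega>=0..2 * q - 1. pole_fps (- 1) (2 * p) $ (2 * q - Suc \<omega>) * pole_fps (- 1) (Suc \<omega>) $ N) =
    - (\<Sum>\<omega>=0..2 * q - 1. of_nat ((\<omega> + N) choose \<omega>) * of_nat ((2 * p + 2 * q - 2 - \<omega>) choose (2 * p - 1)) * (-1) ^ \<omega>)"
    unfolding sum_negf[symmetric]
  proof (rule sum.cong[OF refl])
    fix \<omega> assume "\<omega> \<in> {0..2 * q - 1}"
    then have "2 * q - Suc \<omega> + 2 * p - 1 = 2 * p + 2 * q - 2 - \<omega>"
      using assms by auto
    then show "pole_fps (- 1) (2 * p) $ (2 * q - Suc \<omega>) * pole_fps (- 1) (Suc \<omega>) $ N =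
        - (of_nat ((\<omega> + N) choose \<omega>) * of_nat ((2 * p + 2 * q - 2 - \<omega>) choose (2 * p - 1)) * (-1) ^ \<omega>)"
      by (simp add: pole_fps_minus_1_nth[OF assms(1)] pole_fps_minus_Suc_nth)
  qed
  finally show ?thesis by simp
qed

text \<open>The same device for \<open>x ^ (-2p) * (x + 1) ^ (-2q) * (x + 2) ^ (-2r)\<close> at -3.
  The Laurent coefficients at 0 and -1 are convolutions and give one sum each; those at -2 are again
  values of \<open>pole_pair_nth\<close> and split into two sums, hence four in all.\<close>

lemma pole_triple_nth:
  assumes "p > 0" "q > 0" "r > 0"
  shows "(pole_fps (- 3) (2 * p) * pole_fps (- 2) (2 * q) * pole_fps (- 1) (2 * r)) $ N =
    (\<Sum>\<rho>=0..2 * p - 1. of_nat ((\<rho> + N) choose \<rho>) * (\<Sum>\<omega>=0..2 * p - 1 - \<rho>. of_nat ((\<omega> + 2 * r - 1) choose \<omega>) *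
        of_nat ((2 * p + 2 * q - 2 - \<rho> - \<omega>) choose (2 * q - 1)) / (2 ^ (2 * r + \<omega>) * 3 ^ (\<rho> + 1 + N)))) -
    (\<Sum>\<rho>=0..2 * q - 1. of_nat ((\<rho> + N) choose \<rho>) * (\<Sum>\<omega>=0..2 * q - 1 - \<rho>. of_nat ((\<omega> + 2 * r - 1) choose \<omega>) *
        of_nat ((2 * p + 2 * q - 2 - \<rho> - \<omega>) choose (2 * p - 1)) * (-1) ^ (\<rho> + \<omega>) / 2 ^ (\<rho> + 1 + N))) -
    (\<Sum>\<rho>=0..2 * r - 1. of_nat ((\<rho> + N) choose \<rho>) * (\<Sum>\<omega>=0..2 * p - 1. of_nat ((\<omega> + 2 * r - 1 - \<rho>) choose \<omega>) *
        of_nat ((2 * p + 2 * q - 2 - \<omega>) choose (2 * q - 1)) * (-1) ^ \<rho> / 2 ^ (\<omega> + 2 * r - \<rho>))) +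
    (\<Sum>\<rho>=0..2 * r - 1. of_nat ((\<rho> + N) choose \<rho>) * (\<Sum>\<omega>=0..2 * q - 1. of_nat ((\<omega> + 2 * r - 1 - \<rho>) choose \<omega>) *
        of_nat ((2 * p + 2 * q - 2 - \<omega>) choose (2 * p - 1)) * (-1) ^ (\<rho> + \<omega>)))"
    (is "_ = ?S1 - ?S2 - ?S3 + ?S4")
proof -
  define A :: "complex set" where "A = {0, - 1, - 2}"
  define e :: "complex \<Rightarrow> nat" where "e = (\<lambda>a. 2 * (if a = 0 then p else if a = - 1 then q else r))"
  have A_diff: "A - {0} = {- 1, - 2}" "A - {- 1} = {0, - 2}" "A - {- 2} = {0, - 1}"
    by (auto simp: A_def)
  have e: "e 0 = 2 * p" "e (- 1) = 2 * q" "e (- 2) = 2 * r" by (auto simp: e_def)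
  have lc0: "laurent_coeff A e 0 j = (pole_fps 2 (2 * r) * pole_fps 1 (2 * q)) $ (2 * p - j)" for j
    by (simp add: laurent_coeff_def A_diff e mult.commute)
  have lc1: "laurent_coeff A e (- 1) j = (pole_fps 1 (2 * r) * pole_fps (- 1) (2 * p)) $ (2 * q - j)" for j
    by (simp add: laurent_coeff_def A_diff e mult.commute)
  have lc2: "laurent_coeff A e (- 2) j = (pole_fps (- 2) (2 * p) * pole_fps (- 1) (2 * q)) $ (2 * r - j)" for j
    by (simp add: laurent_coeff_def A_diff e)
  have "(\<Prod>b\<in>A. pole_fps (- 3 - b) (e b)) = (\<Sum>a\<in>A. \<Sum>j=1..e a. fps_const (laurent_coeff A e a j) * pole_fps (- 3 - a) j)"
    by (rule partial_fractions_fps) (use assms in \<open>auto simp: A_def e_def\<close>)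
  then have "(pole_fps (- 3) (2 * p) * pole_fps (- 2) (2 * q) * pole_fps (- 1) (2 * r)) =
      (\<Sum>j=1..2 * p. fps_const (laurent_coeff A e 0 j) * pole_fps (- 3) j) +
      (\<Sum>j=1..2 * q. fps_const (laurent_coeff A e (- 1) j) * pole_fps (- 2) j) +
      (\<Sum>j=1..2 * r. fps_const (laurent_coeff A e (- 2) j) * pole_fps (- 1) j)"
    unfolding A_def by (simp add: e mult.assoc add.assoc)
  then have "(pole_fps (- 3) (2 * p) * pole_fps (- 2) (2 * q) * pole_fps (- 1) (2 * r)) $ N =
      (\<Sum>\<rho>=0..2 * p - 1. laurent_coeff A e 0 (Suc \<rho>) * pole_fps (- 3) (Suc \<rho>) $ N) +
      (\<Sum>\<rho>=0..2 * q - 1. laurent_coeff A e (- 1) (Suc \<rho>) * pole_fps (- 2) (Suc \<rho>) $ N) +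
      (\<Sum>\<rho>=0..2 * r - 1. laurent_coeff A e (- 2) (Suc \<rho>) * pole_fps (- 1) (Suc \<rho>) $ N)"
    using assms by (simp add: fps_sum_nth sum_atLeast1_shift)
  also have "(\<Sum>\<rho>=0..2 * p - 1. laurent_coeff A e 0 (Suc \<rho>) * pole_fps (- 3) (Suc \<rho>) $ N) = ?S1"
  proof (rule sum.cong[OF refl])
    fix \<rho> assume \<rho>: "\<rho> \<in> {0..2 * p - 1}"
    have "pole_fps 2 (2 * r) $ \<omega> * pole_fps 1 (2 * q) $ (2 * p - Suc \<rho> - \<omega>) * pole_fps (- 3) (Suc \<rho>) $ N =
        of_nat ((\<rho> + N) choose \<rho>) * (of_nat ((\<omega> + 2 * r - 1) choose \<omega>) *
        of_nat ((2 * p + 2 * q - 2 - \<rho> - \<omega>) choose (2 * q - 1)) / (2 ^ (2 * r + \<omega>) * 3 ^ (\<rho> + 1 + N)))"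
      if "\<omega> \<in> {0..2 * p - 1 - \<rho>}" for \<omega>
    proof -
      have "2 * p - Suc \<rho> - \<omega> + 2 * q - 1 = 2 * p + 2 * q - 2 - \<rho> - \<omega>" "2 * r + \<omega> - 1 = \<omega> + 2 * r - 1"
        using assms \<rho> that by auto
      moreover have "even (\<omega> + (2 * p - Suc \<rho> - \<omega>) + Suc \<rho>)" using assms \<rho> that by auto
      then have "(-1) ^ \<omega> * (-1) ^ (2 * p - Suc \<rho> - \<omega>) * (-1) ^ Suc \<rho> = (1 :: complex)"
        by (simp flip: power_add del: power_Suc)
      moreover have "s1 * c1 / x1 * (s2 * c2) * (s3 * c3 / x3) = (s1 * s2 * s3) * (c3 * (c1 * c2 / (x1 * x3)))"
        for s1 s2 s3 c1 c2 c3 x1 x3 :: complex by simp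
      ultimately show ?thesis
        by (simp only: pole_fps_nth[of 2] pole_fps_1_nth[OF assms(2)] pole_fps_minus_Suc_nth mult_1)
    qed
    then show "laurent_coeff A e 0 (Suc \<rho>) * pole_fps (- 3) (Suc \<rho>) $ N =
       of_nat ((\<rho> + N) choose \<rho>) * (\<Sum>\<omega>=0..2 * p - 1 - \<rho>. of_nat ((\<omega> + 2 * r - 1) choose \<omega>) *
        of_nat ((2 * p + 2 * q - 2 - \<rho> - \<omega>) choose (2 * q - 1)) / (2 ^ (2 * r + \<omega>) * 3 ^ (\<rho> + 1 + N)))"
      unfolding lc0 fps_mult_nth sum_distrib_left sum_distrib_right by (intro sum.cong) auto
  qed
  also have "(\<Sum>\<rho>=0..2 * q - 1. laurent_coeff A e (- 1) (Suc \<rho>) * pole_fps (- 2) (Suc \<rho>) $ N) = - ?S2"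
    unfolding sum_negf[symmetric]
  proof (rule sum.cong[OF refl])
    fix \<rho> assume \<rho>: "\<rho> \<in> {0..2 * q - 1}"
    have "pole_fps 1 (2 * r) $ \<omega> * pole_fps (- 1) (2 * p) $ (2 * q - Suc \<rho> - \<omega>) * pole_fps (- 2) (Suc \<rho>) $ N =
        - (of_nat ((\<rho> + N) choose \<rho>) * (of_nat ((\<omega> + 2 * r - 1) choose \<omega>) *
        of_nat ((2 * p + 2 * q - 2 - \<rho> - \<omega>) choose (2 * p - 1)) * (-1) ^ (\<rho> + \<omega>) / 2 ^ (\<rho> + 1 + N)))"
      if "\<omega> \<in> {0..2 * q - 1 - \<rho>}" for \<omega>
    proof -
      have "2 * q - Suc \<rho> - \<omega> + 2 * p - 1 = 2 * p + 2 * q - 2 - \<rho> - \<omega>" "2 * r + \<omega> - 1 = \<omega> + 2 * r - 1"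
        using assms \<rho> that by auto
      then show ?thesis
        by (simp add: pole_fps_nth[of 1] pole_fps_minus_1_nth[OF assms(1)] pole_fps_minus_Suc_nth power_add)
    qed
    then show "laurent_coeff A e (- 1) (Suc \<rho>) * pole_fps (- 2) (Suc \<rho>) $ N =
       - (of_nat ((\<rho> + N) choose \<rho>) * (\<Sum>\<omega>=0..2 * q - 1 - \<rho>. of_nat ((\<omega> + 2 * r - 1) choose \<omega>) *
        of_nat ((2 * p + 2 * q - 2 - \<rho> - \<omega>) choose (2 * p - 1)) * (-1) ^ (\<rho> + \<omega>) / 2 ^ (\<rho> + 1 + N)))"
      unfolding lc1 fps_mult_nth sum_distrib_left sum_distrib_right sum_negf[symmetric] by (intro sum.cong) auto
  qed
  also have "(\<Sum>\<rho>=0..2 * r - 1. laurent_coeff A e (- 2) (Suc \<rho>) * pole_fps (- 1) (Suc \<rho>) $ N) = - ?S3 + ?S4"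
    unfolding sum_negf[symmetric] sum.distrib[symmetric]
  proof (rule sum.cong[OF refl])
    fix \<rho> assume \<rho>: "\<rho> \<in> {0..2 * r - 1}"
    have "(\<omega> + (2 * r - Suc \<rho>)) = \<omega> + 2 * r - 1 - \<rho>" "\<omega> + 1 + (2 * r - Suc \<rho>) = \<omega> + 2 * r - \<rho>" for \<omega>
      using assms \<rho> by auto
    then have "laurent_coeff A e (- 2) (Suc \<rho>) =
        (\<Sum>\<omega>=0..2 * p - 1. of_nat ((\<omega> + 2 * r - 1 - \<rho>) choose \<omega>) * of_nat ((2 * p + 2 * q - 2 - \<omega>) choose (2 * q - 1)) / 2 ^ (\<omega> + 2 * r - \<rho>)) -
        (\<Sum>\<omega>=0..2 * q - 1. of_nat ((\<omega> + 2 * r - 1 - \<rho>) choose \<omega>) * of_nat ((2 * p + 2 * q - 2 - \<omega>) choose (2 * p - 1)) * (-1) ^ \<omega>)"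
      unfolding lc2 pole_pair_nth[OF assms(1,2)] by (simp only:)
    moreover have "pole_fps (- 1) (Suc \<rho>) $ N = - ((-1) ^ \<rho> * of_nat ((\<rho> + N) choose \<rho>))"
      by (simp add: pole_fps_minus_Suc_nth)
    ultimately show "laurent_coeff A e (- 2) (Suc \<rho>) * pole_fps (- 1) (Suc \<rho>) $ N =
      - (of_nat ((\<rho> + N) choose \<rho>) * (\<Sum>\<omega>=0..2 * p - 1. of_nat ((\<omega> + 2 * r - 1 - \<rho>) choose \<omega>) *
        of_nat ((2 * p + 2 * q - 2 - \<omega>) choose (2 * q - 1)) * (-1) ^ \<rho> / 2 ^ (\<omega> + 2 * r - \<rho>))) +
      of_nat ((\<rho> + N) choose \<rho>) * (\<Sum>\<omega>=0..2 * q - 1. of_nat ((\<omega> + 2 * r - 1 - \<rho>) choose \<omega>) *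
        of_nat ((2 * p + 2 * q - 2 - \<omega>) choose (2 * p - 1)) * (-1) ^ (\<rho> + \<omega>))"
      by (simp add: left_diff_distrib right_diff_distrib sum_distrib_left sum_distrib_right power_add mult_ac sum_negf)
  qed
  finally show ?thesis by simp
qed

section \<open>Half-integral distances and rearrangement of triple sums\<close>

lemma pole_fps_nth':
  "pole_fps c n $ i = (-1) ^ i * of_nat ((i + n - 1) choose i) / c ^ (n + i)"
  by (simp add: pole_fps_nth add.commute)

lemma pole_fps_1_nth': "pole_fps 1 n $ i = (-1) ^ i * of_nat ((i + n - 1) choose i)"
  by (simp add: pole_fps_nth')

lemma powi_eq_divide:
  assumes "x \<noteq> (0 :: complex)" "i = int a - int b"
  shows "x powi i = x ^ a / x ^ b"
  using assms by (simp add: power_int_diff)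

lemma power_half_odd: "(c / 2) ^ (n + i) * 2 ^ n = (c :: complex) ^ (n + i) / 2 ^ i"
  by (simp add: power_divide power_add)

text \<open>The distance between \<open>- 3 / 2\<close> and an integral pole is half of an odd
  number. For \<open>n = 2 * v\<close> the division by \<open>2 ^ n\<close> is the normalisation of
  the form \<open>2 * m + 3 * n\<close>; it clears the halves up to \<open>2 ^ i\<close>.\<close>

lemma pole_fps_half_nth:
  "pole_fps (c / 2) n $ i / 2 ^ n = (-1) ^ i * of_nat ((i + n - 1) choose i) * (2 ^ i / c ^ (n + i))"
  unfolding pole_fps_nth' divide_divide_eq_left power_half_odd by simp

lemma pole_fps_minus_half_nth:
  assumes "even n"
  shows "pole_fps (- c / 2) n $ i / 2 ^ n = of_nat ((i + n - 1) choose i) * (2 ^ i / c ^ (n + i))"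
proof -
  have "pole_fps (- (c / 2)) n $ i = of_nat ((i + n - 1) choose i) / (c / 2) ^ (n + i)"
    using assms by (simp add: pole_fps_minus_nth add.commute)
  then show ?thesis
    unfolding minus_divide_left divide_divide_eq_left power_half_odd by (simp add: power_half_odd)
qed

text \<open>The halves contribute \<open>2 ^ (n + 1 + M)\<close> with
  \<open>M = 2 * v - 2 * k\<close>, and the prefactor cancels \<open>2 ^ M\<close>. The surplus 2
  stands out in front: it is the factor that \<open>2 * zeta (2 * of_nat k)\<close> carries at the
  integral poles and \<open>Lam\<close> does not.\<close>

lemma pole_fps_half_Suc_nth:
  assumes "k \<le> v"
  shows "2 ^ (2 * k) / 2 ^ (2 * v) * pole_fps (c / 2) (Suc n) $ (2 * v - 2 * k) =
      2 * (of_nat ((n + 2 * v - 2 * k) choose n) * (2 ^ n / c ^ (n + 1 + (2 * v - 2 * k))))"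
    and "2 ^ (2 * k) / 2 ^ (2 * v) * pole_fps (- c / 2) (Suc n) $ (2 * v - 2 * k) =
      2 * ((-1) ^ Suc n * of_nat ((n + 2 * v - 2 * k) choose n) * (2 ^ n / c ^ (n + 1 + (2 * v - 2 * k))))"
proof -
  define M where "M = 2 * v - 2 * k"
  have "even M" and M: "n + M = n + 2 * v - 2 * k" and v: "2 * v = 2 * k + M"
    using assms by (auto simp: M_def)
  have pow: "2 ^ (2 * k) / 2 ^ (2 * v) * (x / (c / 2) ^ (n + 1 + M)) = 2 * (x * (2 ^ n / c ^ (n + 1 + M)))" for x
    unfolding v power_add power_divide by simp
  have "pole_fps (c / 2) (Suc n) $ M = of_nat ((n + M) choose n) / (c / 2) ^ (n + 1 + M)"
    using \<open>even M\<close> by (simp add: pole_fps_Suc_nth')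
  then show "2 ^ (2 * k) / 2 ^ (2 * v) * pole_fps (c / 2) (Suc n) $ (2 * v - 2 * k) =
      2 * (of_nat ((n + 2 * v - 2 * k) choose n) * (2 ^ n / c ^ (n + 1 + (2 * v - 2 * k))))"
    unfolding M_def[symmetric] M[symmetric] by (simp only: pow)
  have "pole_fps (- (c / 2)) (Suc n) $ M = (-1) ^ Suc n * of_nat ((n + M) choose n) / (c / 2) ^ (n + 1 + M)"
    by (rule pole_fps_minus_Suc_nth)
  then show "2 ^ (2 * k) / 2 ^ (2 * v) * pole_fps (- c / 2) (Suc n) $ (2 * v - 2 * k) =
      2 * ((-1) ^ Suc n * of_nat ((n + 2 * v - 2 * k) choose n) * (2 ^ n / c ^ (n + 1 + (2 * v - 2 * k))))"
    unfolding M_def[symmetric] M[symmetric] minus_divide_left by (simp only: pow)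
qed

text \<open>The hypothesis compares only the full products. Convolution distributes powers and signs
  over the three levels, whereas the closed formulas collect them in the innermost one, so the
  levels need not agree separately.\<close>

lemma triple_sum_cong:
  fixes f f' :: "nat \<Rightarrow> complex"
  assumes "\<And>i j k. i \<in> I \<Longrightarrow> j \<in> J i \<Longrightarrow> k \<in> K i j \<Longrightarrow> f i * (g i j * h i j k) = f' i * (g' i j * h' i j k)"
  shows "(\<Sum>i\<in>I. f i * (\<Sum>j\<in>J i. g i j * (\<Sum>k\<in>K i j. h i j k))) =
    (\<Sum>i\<in>I. f' i * (\<Sum>j\<in>J i. g' i j * (\<Sum>k\<in>K i j. h' i j k)))"
  unfolding sum_distrib_left using assms by (intro sum.cong refl) auto

lemma fps_mult3_nth:
  "((A :: complex fps) * (B * (C * D))) $ N =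
    (\<Sum>i=0..N. A $ i * (\<Sum>j=0..N - i. B $ j * (\<Sum>k=0..N - i - j. C $ k * D $ (N - i - j - k))))"
  by (simp add: fps_mult_nth)

lemma fps_mult2_nth:
  "((A :: complex fps) * (B * C)) $ N = (\<Sum>i=0..N. A $ i * (\<Sum>j=0..N - i. B $ j * C $ (N - i - j)))"
  by (simp add: fps_mult_nth[of A] fps_mult_nth[of B])

text \<open>The inner sums are named, one family multiplying \<open>zeta\<close> and one multiplying
  \<open>Lam\<close>, so that each is matched with a Laurent coefficient for fixed \<open>k\<close>
  and the final assembly is linear algebra in opaque symbols.\<close>

definition I1_zeta_coeff :: "nat \<Rightarrow> nat \<Rightarrow> nat \<Rightarrow> nat \<Rightarrow> nat \<Rightarrow> nat \<Rightarrow> complex" where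
  "I1_zeta_coeff p q r u v k =
     (\<Sum>\<sigma>=0..2 * p - 2 * k. of_nat ((\<sigma> + 2 * v - 1) choose \<sigma>) *
     (\<Sum>\<rho>=0..2 * p - 2 * k - \<sigma>. of_nat ((\<rho> + 2 * u - 1) choose \<rho>) *
     (\<Sum>\<omega>=0..2 * p - 2 * k - \<sigma> - \<rho>. of_nat ((\<omega> + 2 * r - 1) choose \<omega>) *
     of_nat ((2 * p + 2 * q - 1 - 2 * k - \<sigma> - \<rho> - \<omega>) choose (2 * q - 1)) * 2 powi (int \<sigma> - 2 * int r - int \<omega>) * 3 powi (- 2 * int u - 2 * int v - int \<sigma> - int \<rho>))))"

definition I2_zeta_coeff :: "nat \<Rightarrow> nat \<Rightarrow> nat \<Rightarrow> nat \<Rightarrow> nat \<Rightarrow> nat \<Rightarrow> complex" where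
  "I2_zeta_coeff p q r u v k =
     (\<Sum>\<sigma>=0..2 * u - 2 * k. of_nat ((\<sigma> + 2 * v - 1) choose \<sigma>) *
     (\<Sum>\<rho>=0..2 * p - 1. of_nat ((\<rho> + 2 * u - 2 * k - \<sigma>) choose \<rho>) *
     (\<Sum>\<omega>=0..2 * p - 1 - \<rho>. of_nat ((\<omega> + 2 * r - 1) choose \<omega>) *
     of_nat ((2 * p + 2 * q - 2 - \<rho> - \<omega>) choose (2 * q - 1)) * 2 powi (int \<sigma> - 2 * int r - int \<omega>) * 3 powi (- 2 * int u - 2 * int v + 2 * int k - int \<rho> - 1))))"

definition I3_zeta_coeff :: "nat \<Rightarrow> nat \<Rightarrow> nat \<Rightarrow> nat \<Rightarrow> nat \<Rightarrow> nat \<Rightarrow> complex" where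
  "I3_zeta_coeff p q r u v k =
     (\<Sum>\<sigma>=0..2 * q - 2 * k. of_nat ((\<sigma> + 2 * v - 1) choose \<sigma>) *
     (\<Sum>\<rho>=0..2 * q - 2 * k - \<sigma>. of_nat ((\<rho> + 2 * u - 1) choose \<rho>) *
     (\<Sum>\<omega>=0..2 * q - 2 * k - \<sigma> - \<rho>. of_nat ((\<omega> + 2 * r - 1) choose \<omega>) *
     of_nat ((2 * p + 2 * q - 1 - 2 * k - \<sigma> - \<rho> - \<omega>) choose (2 * p - 1)) * (- 1) ^ (\<sigma> + \<rho> + \<omega>) * 2 powi (int \<sigma> - 2 * int u - int \<rho>))))"

definition I4_zeta_coeff :: "nat \<Rightarrow> nat \<Rightarrow> nat \<Rightarrow> nat \<Rightarrow> nat \<Rightarrow> nat \<Rightarrow> complex" where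
  "I4_zeta_coeff p q r u v k =
     (\<Sum>\<sigma>=0..2 * u - 2 * k. of_nat ((\<sigma> + 2 * v - 1) choose \<sigma>) *
     (\<Sum>\<rho>=0..2 * q - 1. of_nat ((\<rho> + 2 * u - 2 * k - \<sigma>) choose \<rho>) *
     (\<Sum>\<omega>=0..2 * q - 1 - \<rho>. of_nat ((\<omega> + 2 * r - 1) choose \<omega>) *
     of_nat ((2 * p + 2 * q - 2 - \<rho> - \<omega>) choose (2 * p - 1)) * (- 1) ^ (\<rho> + \<omega>) * 2 powi (- 2 * int u + 2 * int k + 2 * int \<sigma> - int \<rho> - 1) * 3 powi (- 2 * int v - int \<sigma>))))"

definition I5_zeta_coeff :: "nat \<Rightarrow> nat \<Rightarrow> nat \<Rightarrow> nat \<Rightarrow> nat \<Rightarrow> nat \<Rightarrow> complex" where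
  "I5_zeta_coeff p q r u v k =
     (\<Sum>\<sigma>=0..2 * r - 2 * k. of_nat ((\<sigma> + 2 * v - 1) choose \<sigma>) *
     (\<Sum>\<rho>=0..2 * r - 2 * k - \<sigma>. of_nat ((\<rho> + 2 * u - 1) choose \<rho>) *
     (\<Sum>\<omega>=0..2 * p - 1. of_nat ((\<omega> + 2 * r - 2 * k - \<sigma> - \<rho>) choose \<omega>) *
     of_nat ((2 * p + 2 * q - 2 - \<omega>) choose (2 * q - 1)) * (- 1) ^ \<rho> * 2 powi (- 2 * int r + 2 * int k + 2 * int \<sigma> + int \<rho> - int \<omega> - 1))))"

definition I6_zeta_coeff :: "nat \<Rightarrow> nat \<Rightarrow> nat \<Rightarrow> nat \<Rightarrow> nat \<Rightarrow> nat \<Rightarrow> complex" where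
  "I6_zeta_coeff p q r u v k =
     (\<Sum>\<sigma>=0..2 * u - 2 * k. of_nat ((\<sigma> + 2 * v - 1) choose \<sigma>) *
     (\<Sum>\<rho>=0..2 * r - 1. of_nat ((\<rho> + 2 * u - 2 * k - \<sigma>) choose \<rho>) *
     (\<Sum>\<omega>=0..2 * p - 1. of_nat ((\<omega> + 2 * r - 1 - \<rho>) choose \<omega>) *
     of_nat ((2 * p + 2 * q - 2 - \<omega>) choose (2 * q - 1)) * (- 1) ^ \<rho> * 2 powi (- 2 * int r + int \<sigma> + int \<rho> - int \<omega>) * 3 powi (- 2 * int v - int \<sigma>))))"

definition I7_zeta_coeff :: "nat \<Rightarrow> nat \<Rightarrow> nat \<Rightarrow> nat \<Rightarrow> nat \<Rightarrow> nat \<Rightarrow> complex" where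
  "I7_zeta_coeff p q r u v k =
     (\<Sum>\<sigma>=0..2 * r - 2 * k. of_nat ((\<sigma> + 2 * v - 1) choose \<sigma>) *
     (\<Sum>\<rho>=0..2 * r - 2 * k - \<sigma>. of_nat ((\<rho> + 2 * u - 1) choose \<rho>) *
     (\<Sum>\<omega>=0..2 * q - 1. of_nat ((\<omega> + 2 * r - 2 * k - \<sigma> - \<rho>) choose \<omega>) *
     of_nat ((2 * p + 2 * q - 2 - \<omega>) choose (2 * p - 1)) * (- 1) ^ (\<rho> + \<omega>) * 2 powi (int \<sigma>))))"

definition I8_zeta_coeff :: "nat \<Rightarrow> nat \<Rightarrow> nat \<Rightarrow> nat \<Rightarrow> nat \<Rightarrow> nat \<Rightarrow> complex" where
  "I8_zeta_coeff p q r u v k =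
     (\<Sum>\<sigma>=0..2 * u - 2 * k. of_nat ((\<sigma> + 2 * v - 1) choose \<sigma>) *
     (\<Sum>\<rho>=0..2 * r - 1. of_nat ((\<rho> + 2 * u - 2 * k - \<sigma>) choose \<rho>) *
     (\<Sum>\<omega>=0..2 * q - 1. of_nat ((\<omega> + 2 * r - 1 - \<rho>) choose \<omega>) *
     of_nat ((2 * p + 2 * q - 2 - \<omega>) choose (2 * p - 1)) * (- 1) ^ (\<rho> + \<omega>) * 2 powi (int \<sigma>) * 3 powi (- 2 * int v - int \<sigma>))))"

definition I1_Lam_coeff :: "nat \<Rightarrow> nat \<Rightarrow> nat \<Rightarrow> nat \<Rightarrow> nat \<Rightarrow> nat \<Rightarrow> complex" where
  "I1_Lam_coeff p q r u v k =
     (\<Sum>\<sigma>=0..2 * p - 1. of_nat ((\<sigma> + 2 * v - 2 * k) choose \<sigma>) *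
     (\<Sum>\<rho>=0..2 * p - 1 - \<sigma>. of_nat ((\<rho> + 2 * u - 1) choose \<rho>) *
     (\<Sum>\<omega>=0..2 * p - 1 - \<sigma> - \<rho>. of_nat ((\<omega> + 2 * r - 1) choose \<omega>) *
     of_nat ((2 * p + 2 * q - 2 - \<sigma> - \<rho> - \<omega>) choose (2 * q - 1)) * 2 powi (int \<sigma> - 2 * int r - int \<omega>) * 3 powi (- 2 * int u - 2 * int v + 2 * int k - int \<sigma> - int \<rho> - 1))))"

definition I2_Lam_coeff :: "nat \<Rightarrow> nat \<Rightarrow> nat \<Rightarrow> nat \<Rightarrow> nat \<Rightarrow> nat \<Rightarrow> complex" where
  "I2_Lam_coeff p q r u v k =
     (\<Sum>\<sigma>=0..2 * u - 1. of_nat ((\<sigma> + 2 * v - 2 * k) choose \<sigma>) *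
     (\<Sum>\<rho>=0..2 * p - 1. of_nat ((\<rho> + 2 * u - 1 - \<sigma>) choose \<rho>) *
     (\<Sum>\<omega>=0..2 * p - 1 - \<rho>. of_nat ((\<omega> + 2 * r - 1) choose \<omega>) *
     of_nat ((2 * p + 2 * q - 2 - \<rho> - \<omega>) choose (2 * q - 1)) * 2 powi (int \<sigma> - 2 * int r - int \<omega>) * 3 powi (- 2 * int u - 2 * int v + 2 * int k - int \<rho> - 1))))"

definition I3_Lam_coeff :: "nat \<Rightarrow> nat \<Rightarrow> nat \<Rightarrow> nat \<Rightarrow> nat \<Rightarrow> nat \<Rightarrow> complex" where
  "I3_Lam_coeff p q r u v k =
     (\<Sum>\<sigma>=0..2 * q - 1. of_nat ((\<sigma> + 2 * v - 2 * k) choose \<sigma>) *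
     (\<Sum>\<rho>=0..2 * q - 1 - \<sigma>. of_nat ((\<rho> + 2 * u - 1) choose \<rho>) *
     (\<Sum>\<omega>=0..2 * q - 1 - \<sigma> - \<rho>. of_nat ((\<omega> + 2 * r - 1) choose \<omega>) *
     of_nat ((2 * p + 2 * q - 2 - \<sigma> - \<rho> - \<omega>) choose (2 * p - 1)) * (- 1) ^ (\<sigma> + \<rho> + \<omega>) * 2 powi (int \<sigma> - 2 * int u - int \<rho>))))"

definition I4_Lam_coeff :: "nat \<Rightarrow> nat \<Rightarrow> nat \<Rightarrow> nat \<Rightarrow> nat \<Rightarrow> nat \<Rightarrow> complex" where
  "I4_Lam_coeff p q r u v k =
     (\<Sum>\<sigma>=0..2 * u - 1. of_nat ((\<sigma> + 2 * v - 2 * k) choose \<sigma>) *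
     (\<Sum>\<rho>=0..2 * q - 1. of_nat ((\<rho> + 2 * u - 1 - \<sigma>) choose \<rho>) *
     (\<Sum>\<omega>=0..2 * q - 1 - \<rho>. of_nat ((\<omega> + 2 * r - 1) choose \<omega>) *
     of_nat ((2 * p + 2 * q - 2 - \<rho> - \<omega>) choose (2 * p - 1)) * (- 1) ^ (\<rho> + \<omega>) * 2 powi (- 2 * int u + 2 * int \<sigma> - int \<rho>) * 3 powi (- 2 * int v + 2 * int k - int \<sigma> - 1))))"

definition I5_Lam_coeff :: "nat \<Rightarrow> nat \<Rightarrow> nat \<Rightarrow> nat \<Rightarrow> nat \<Rightarrow> nat \<Rightarrow> complex" where
  "I5_Lam_coeff p q r u v k =
     (\<Sum>\<sigma>=0..2 * r - 1. of_nat ((\<sigma> + 2 * v - 2 * k) choose \<sigma>) *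
     (\<Sum>\<rho>=0..2 * r - 1 - \<sigma>. of_nat ((\<rho> + 2 * u - 1) choose \<rho>) *
     (\<Sum>\<omega>=0..2 * p - 1. of_nat ((\<omega> + 2 * r - 1 - \<sigma> - \<rho>) choose \<omega>) *
     of_nat ((2 * p + 2 * q - 2 - \<omega>) choose (2 * q - 1)) * (- 1) ^ \<rho> * 2 powi (- 2 * int r + 2 * int \<sigma> + int \<rho> - int \<omega>))))"

definition I6_Lam_coeff :: "nat \<Rightarrow> nat \<Rightarrow> nat \<Rightarrow> nat \<Rightarrow> nat \<Rightarrow> nat \<Rightarrow> complex" where
  "I6_Lam_coeff p q r u v k =
     (\<Sum>\<sigma>=0..2 * u - 1. of_nat ((\<sigma> + 2 * v - 2 * k) choose \<sigma>) *
     (\<Sum>\<rho>=0..2 * r - 1. of_nat ((\<rho> + 2 * u - 1 - \<sigma>) choose \<rho>) *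
     (\<Sum>\<omega>=0..2 * p - 1. of_nat ((\<omega> + 2 * r - 1 - \<rho>) choose \<omega>) *
     of_nat ((2 * p + 2 * q - 2 - \<omega>) choose (2 * q - 1)) * (- 1) ^ \<rho> * 2 powi (- 2 * int r + int \<sigma> + int \<rho> - int \<omega>) * 3 powi (- 2 * int v + 2 * int k - int \<sigma> - 1))))"

definition I7_Lam_coeff :: "nat \<Rightarrow> nat \<Rightarrow> nat \<Rightarrow> nat \<Rightarrow> nat \<Rightarrow> nat \<Rightarrow> complex" where
  "I7_Lam_coeff p q r u v k =
     (\<Sum>\<sigma>=0..2 * r - 1. of_nat ((\<sigma> + 2 * v - 2 * k) choose \<sigma>) *
     (\<Sum>\<rho>=0..2 * r - 1 - \<sigma>. of_nat ((\<rho> + 2 * u - 1) choose \<rho>) *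
     (\<Sum>\<omega>=0..2 * q - 1. of_nat ((\<omega> + 2 * r - 1 - \<sigma> - \<rho>) choose \<omega>) *
     of_nat ((2 * p + 2 * q - 2 - \<omega>) choose (2 * p - 1)) * (- 1) ^ (\<rho> + \<omega>) * 2 powi (int \<sigma>))))"

definition I8_Lam_coeff :: "nat \<Rightarrow> nat \<Rightarrow> nat \<Rightarrow> nat \<Rightarrow> nat \<Rightarrow> nat \<Rightarrow> complex" where
  "I8_Lam_coeff p q r u v k =
     (\<Sum>\<sigma>=0..2 * u - 1. of_nat ((\<sigma> + 2 * v - 2 * k) choose \<sigma>) *
     (\<Sum>\<rho>=0..2 * r - 1. of_nat ((\<rho> + 2 * u - 1 - \<sigma>) choose \<rho>) *
     (\<Sum>\<omega>=0..2 * q - 1. of_nat ((\<omega> + 2 * r - 1 - \<rho>) choose \<omega>) *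
     of_nat ((2 * p + 2 * q - 2 - \<omega>) choose (2 * p - 1)) * (- 1) ^ (\<rho> + \<omega>) * 2 powi (int \<sigma>) * 3 powi (- 2 * int v + 2 * int k - int \<sigma> - 1))))"

text \<open>At 0 all four other factors are simply convolved; they lie at the distances
  \<open>3 / 2\<close>, 3, 2 and 1.\<close>

lemma G2_coeff_0:
  assumes "p > 0" "q > 0" "k \<le> p"
  shows "G2_coeff p q r u v 0 (2 * k) / 2 ^ (2 * v) = I1_zeta_coeff p q r u v k"
proof -
  define N where "N = 2 * p - 2 * k"
  have "G2_poles - {0} = {- 3 / 2, - 3, - 2, - 1}" by (auto simp: G2_poles_def)
  then have "G2_coeff p q r u v 0 (2 * k) =
      (pole_fps (3 / 2) (2 * v) * (pole_fps 3 (2 * u) * (pole_fps 2 (2 * r) * pole_fps 1 (2 * q)))) $ N"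
    by (simp add: G2_coeff_def laurent_coeff_def G2_order_def N_def)
  then have "G2_coeff p q r u v 0 (2 * k) / 2 ^ (2 * v) =
      (\<Sum>\<sigma>=0..N. pole_fps (3 / 2) (2 * v) $ \<sigma> / 2 ^ (2 * v) * (\<Sum>\<rho>=0..N - \<sigma>. pole_fps 3 (2 * u) $ \<rho> *
        (\<Sum>\<omega>=0..N - \<sigma> - \<rho>. pole_fps 2 (2 * r) $ \<omega> * pole_fps 1 (2 * q) $ (N - \<sigma> - \<rho> - \<omega>))))"
    by (simp add: fps_mult3_nth sum_divide_distrib)
  also have "\<dots> = I1_zeta_coeff p q r u v k"
    unfolding I1_zeta_coeff_def N_def[symmetric]
  proof (rule triple_sum_cong, goal_cases)
    case (1 \<sigma> \<rho> \<omega>)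
    from 1 have le: "\<sigma> + \<rho> + \<omega> \<le> N" by auto
    \<comment> \<open>The four indices of the convolution add up to the even number
      \<open>N\<close>, so the alternating signs of the four expansions cancel.\<close>
    have "even (\<sigma> + \<rho> + \<omega> + (N - \<sigma> - \<rho> - \<omega>))" using le assms by (simp add: N_def)
    then have sgn: "(-1) ^ \<sigma> * (-1) ^ \<rho> * (-1) ^ \<omega> * (-1) ^ (N - \<sigma> - \<rho> - \<omega>) = (1 :: complex)"
      by (simp flip: power_add)
    have top: "2 * p + 2 * q - 1 - 2 * k - \<sigma> - \<rho> - \<omega> = N - \<sigma> - \<rho> - \<omega> + 2 * q - 1"
      using le assms by (auto simp: N_def)
    have powi: "2 powi (int \<sigma> - 2 * int r - int \<omega>) = (2 :: complex) ^ \<sigma> / 2 ^ (2 * r + \<omega>)"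
      "3 powi (- 2 * int u - 2 * int v - int \<sigma> - int \<rho>) = (3 :: complex) ^ 0 / 3 ^ (2 * v + \<sigma> + (2 * u + \<rho>))"
      by (rule powi_eq_divide; simp)+
    have regroup: "s1 * c1 * (x / y) * (s2 * c2 / b * (s3 * c3 / d * (s4 * c4))) =
        (s1 * s2 * s3 * s4) * (c1 * (c2 * (c3 * c4 * (x / d) * (1 / (y * b)))))" for s1 s2 s3 s4 c1 c2 c3 c4 x y b d :: complex
      by (simp add: divide_inverse mult_ac)
    show ?case
      unfolding pole_fps_half_nth pole_fps_1_nth[OF assms(2)] pole_fps_nth'[of 3] pole_fps_nth'[of 2] regroup sgn top powi power_add[of 3] power_0 mult_1
      by (rule refl)
  qed
  finally show ?thesis .
qed

text \<open>The pole 0 lies at distance -1, where the expansion has positive coefficients. The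
  alternating signs of the other three factors remain.\<close>

lemma G2_coeff_minus_1:
  assumes "p > 0" "q > 0" "k \<le> q"
  shows "G2_coeff p q r u v (- 1) (2 * k) / 2 ^ (2 * v) = I3_zeta_coeff p q r u v k"
proof -
  define N where "N = 2 * q - 2 * k"
  have "G2_poles - {- 1} = {- 3 / 2, - 3, - 2, 0}" by (auto simp: G2_poles_def)
  then have "G2_coeff p q r u v (- 1) (2 * k) =
      (pole_fps (1 / 2) (2 * v) * (pole_fps 2 (2 * u) * (pole_fps 1 (2 * r) * pole_fps (- 1) (2 * p)))) $ N"
    by (simp add: G2_coeff_def laurent_coeff_def G2_order_def N_def)
  then have "G2_coeff p q r u v (- 1) (2 * k) / 2 ^ (2 * v) =
      (\<Sum>\<sigma>=0..N. pole_fps (1 / 2) (2 * v) $ \<sigma> / 2 ^ (2 * v) * (\<Sum>\<rho>=0..N - \<sigma>. pole_fps 2 (2 * u) $ \<rho> *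
        (\<Sum>\<omega>=0..N - \<sigma> - \<rho>. pole_fps 1 (2 * r) $ \<omega> * pole_fps (- 1) (2 * p) $ (N - \<sigma> - \<rho> - \<omega>))))"
    by (simp add: fps_mult3_nth sum_divide_distrib)
  also have "\<dots> = I3_zeta_coeff p q r u v k"
    unfolding I3_zeta_coeff_def N_def[symmetric]
  proof (rule triple_sum_cong, goal_cases)
    case (1 \<sigma> \<rho> \<omega>)
    from 1 have le: "\<sigma> + \<rho> + \<omega> \<le> N" by auto
    have top: "2 * p + 2 * q - 1 - 2 * k - \<sigma> - \<rho> - \<omega> = N - \<sigma> - \<rho> - \<omega> + 2 * p - 1"
      using le assms by (auto simp: N_def)
    have powi: "2 powi (int \<sigma> - 2 * int u - int \<rho>) = (2 :: complex) ^ \<sigma> / 2 ^ (2 * u + \<rho>)"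
      by (rule powi_eq_divide; simp)
    have regroup: "s1 * c1 * (x / 1) * (s2 * c2 / b * (s3 * c3 * c4)) =
        c1 * (c2 * (c3 * c4 * (s1 * s2 * s3) * (x / b)))" for s1 s2 s3 c1 c2 c3 c4 x b :: complex
      by (simp add: divide_inverse mult_ac)
    show ?case
      unfolding pole_fps_half_nth pole_fps_minus_1_nth[OF assms(1)] pole_fps_nth'[of 2] pole_fps_1_nth' power_one regroup top powi power_add[of "- 1"]
      by (rule refl)
  qed
  finally show ?thesis .
qed

text \<open>Only the factors of \<open>- 3 / 2\<close> and -3 are convolved. The remaining two are
  treated together by \<open>pole_pair_nth\<close>, whose two sums lead to \<open>I5\<close> and
  \<open>I7\<close> with opposite signs.\<close>

lemma G2_coeff_minus_2:
  assumes "p > 0" "q > 0" "k \<le> r"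
  shows "G2_coeff p q r u v (- 2) (2 * k) / 2 ^ (2 * v) = I5_zeta_coeff p q r u v k - I7_zeta_coeff p q r u v k"
proof -
  define N where "N = 2 * r - 2 * k"
  define X where "X = (\<lambda>n. \<Sum>\<omega>=0..2 * p - 1. of_nat ((\<omega> + n) choose \<omega>) * of_nat ((2 * p + 2 * q - 2 - \<omega>) choose (2 * q - 1)) / 2 ^ (\<omega> + 1 + n) :: complex)"
  define Y where "Y = (\<lambda>n. \<Sum>\<omega>=0..2 * q - 1. of_nat ((\<omega> + n) choose \<omega>) * of_nat ((2 * p + 2 * q - 2 - \<omega>) choose (2 * p - 1)) * (-1) ^ \<omega> :: complex)"
  define f where "f = (\<lambda>\<sigma>. pole_fps (- 1 / 2) (2 * v) $ \<sigma> / 2 ^ (2 * v))"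
  have "G2_poles - {- 2} = {- 3 / 2, - 3, 0, - 1}" by (auto simp: G2_poles_def)
  then have "G2_coeff p q r u v (- 2) (2 * k) =
      (pole_fps (- 1 / 2) (2 * v) * (pole_fps 1 (2 * u) * (pole_fps (- 2) (2 * p) * pole_fps (- 1) (2 * q)))) $ N"
    by (simp add: G2_coeff_def laurent_coeff_def G2_order_def N_def)
  then have "G2_coeff p q r u v (- 2) (2 * k) / 2 ^ (2 * v) =
      (\<Sum>\<sigma>=0..N. f \<sigma> * (\<Sum>\<rho>=0..N - \<sigma>. pole_fps 1 (2 * u) $ \<rho> *
        (pole_fps (- 2) (2 * p) * pole_fps (- 1) (2 * q)) $ (N - \<sigma> - \<rho>)))"
    by (simp only: fps_mult2_nth sum_divide_distrib f_def times_divide_eq_left)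
  also have "\<dots> = (\<Sum>\<sigma>=0..N. f \<sigma> * (\<Sum>\<rho>=0..N - \<sigma>. pole_fps 1 (2 * u) $ \<rho> * X (N - \<sigma> - \<rho>))) -
      (\<Sum>\<sigma>=0..N. f \<sigma> * (\<Sum>\<rho>=0..N - \<sigma>. pole_fps 1 (2 * u) $ \<rho> * Y (N - \<sigma> - \<rho>)))"
    unfolding pole_pair_nth[OF assms(1,2)] X_def Y_def right_diff_distrib sum_subtractf by (rule refl)
  also have "(\<Sum>\<sigma>=0..N. f \<sigma> * (\<Sum>\<rho>=0..N - \<sigma>. pole_fps 1 (2 * u) $ \<rho> * X (N - \<sigma> - \<rho>))) = I5_zeta_coeff p q r u v k"
    unfolding I5_zeta_coeff_def X_def N_def[symmetric]
  proof (rule triple_sum_cong, goal_cases)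
    case (1 \<sigma> \<rho> \<omega>)
    from 1 have le: "\<sigma> + \<rho> \<le> N" by auto
    have top: "\<omega> + 2 * r - 2 * k - \<sigma> - \<rho> = \<omega> + (N - \<sigma> - \<rho>)"
      using le assms by (auto simp: N_def)
    have powi: "2 powi (- 2 * int r + 2 * int k + 2 * int \<sigma> + int \<rho> - int \<omega> - 1) = (2 :: complex) ^ \<sigma> / 2 ^ (\<omega> + 1 + (N - \<sigma> - \<rho>))"
      using le assms by (intro powi_eq_divide) (simp_all add: N_def of_nat_diff)
    have regroup: "c1 * (x / 1) * (s2 * c2 * (c3 * c4 / b)) =
        c1 * (c2 * (c3 * c4 * s2 * (x / b)))" for s2 c1 c2 c3 c4 x b :: complex
      by (simp add: divide_inverse mult_ac)
    show ?case
      unfolding f_def pole_fps_minus_half_nth[OF dvd_triv_left] pole_fps_1_nth' power_one regroup top powi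
      by (rule refl)
  qed
  also have "(\<Sum>\<sigma>=0..N. f \<sigma> * (\<Sum>\<rho>=0..N - \<sigma>. pole_fps 1 (2 * u) $ \<rho> * Y (N - \<sigma> - \<rho>))) = I7_zeta_coeff p q r u v k"
    unfolding I7_zeta_coeff_def Y_def N_def[symmetric]
  proof (rule triple_sum_cong, goal_cases)
    case (1 \<sigma> \<rho> \<omega>)
    from 1 have le: "\<sigma> + \<rho> \<le> N" by auto
    have top: "\<omega> + 2 * r - 2 * k - \<sigma> - \<rho> = \<omega> + (N - \<sigma> - \<rho>)"
      using le assms by (auto simp: N_def)
    have regroup: "c1 * (x / 1) * (s2 * c2 * (c3 * c4 * s3)) =
        c1 * (c2 * (c3 * c4 * (s2 * s3) * x))" for s2 s3 c1 c2 c3 c4 x :: complex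
      by (simp add: divide_inverse mult_ac)
    show ?case
      unfolding f_def pole_fps_minus_half_nth[OF dvd_triv_left] pole_fps_1_nth' power_one regroup top power_add[of "- 1"] power_int_of_nat
      by (rule refl)
  qed
  finally show ?thesis .
qed

text \<open>Only the factor of \<open>- 3 / 2\<close> is convolved. The other three form the product
  of \<open>pole_triple_nth\<close>, whose four sums account for the four terms and their
  signs.\<close>

lemma G2_coeff_minus_3:
  assumes "p > 0" "q > 0" "r > 0" "k \<le> u"
  shows "G2_coeff p q r u v (- 3) (2 * k) / 2 ^ (2 * v) = I2_zeta_coeff p q r u v k - I4_zeta_coeff p q r u v k - I6_zeta_coeff p q r u v k + I8_zeta_coeff p q r u v k"
proof -
  define N where "N = 2 * u - 2 * k"
  define X1 where "X1 = (\<lambda>n. \<Sum>\<rho>=0..2 * p - 1. of_nat ((\<rho> + n) choose \<rho>) * (\<Sum>\<omega>=0..2 * p - 1 - \<rho>. of_nat ((\<omega> + 2 * r - 1) choose \<omega>) *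
        of_nat ((2 * p + 2 * q - 2 - \<rho> - \<omega>) choose (2 * q - 1)) / (2 ^ (2 * r + \<omega>) * 3 ^ (\<rho> + 1 + n))) :: complex)"
  define X2 where "X2 = (\<lambda>n. \<Sum>\<rho>=0..2 * q - 1. of_nat ((\<rho> + n) choose \<rho>) * (\<Sum>\<omega>=0..2 * q - 1 - \<rho>. of_nat ((\<omega> + 2 * r - 1) choose \<omega>) *
        of_nat ((2 * p + 2 * q - 2 - \<rho> - \<omega>) choose (2 * p - 1)) * (-1) ^ (\<rho> + \<omega>) / 2 ^ (\<rho> + 1 + n)) :: complex)"
  define X3 where "X3 = (\<lambda>n. \<Sum>\<rho>=0..2 * r - 1. of_nat ((\<rho> + n) choose \<rho>) * (\<Sum>\<omega>=0..2 * p - 1. of_nat ((\<omega> + 2 * r - 1 - \<rho>) choose \<omega>) *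
        of_nat ((2 * p + 2 * q - 2 - \<omega>) choose (2 * q - 1)) * (-1) ^ \<rho> / 2 ^ (\<omega> + 2 * r - \<rho>)) :: complex)"
  define X4 where "X4 = (\<lambda>n. \<Sum>\<rho>=0..2 * r - 1. of_nat ((\<rho> + n) choose \<rho>) * (\<Sum>\<omega>=0..2 * q - 1. of_nat ((\<omega> + 2 * r - 1 - \<rho>) choose \<omega>) *
        of_nat ((2 * p + 2 * q - 2 - \<omega>) choose (2 * p - 1)) * (-1) ^ (\<rho> + \<omega>)) :: complex)"
  define f where "f = (\<lambda>\<sigma>. pole_fps (- 3 / 2) (2 * v) $ \<sigma> / 2 ^ (2 * v))"
  have "G2_poles - {- 3} = {- 3 / 2, 0, - 1, - 2}" by (auto simp: G2_poles_def)
  then have "G2_coeff p q r u v (- 3) (2 * k) =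
      (pole_fps (- 3 / 2) (2 * v) * (pole_fps (- 3) (2 * p) * pole_fps (- 2) (2 * q) * pole_fps (- 1) (2 * r))) $ N"
    by (simp add: G2_coeff_def laurent_coeff_def G2_order_def N_def mult.assoc)
  then have "G2_coeff p q r u v (- 3) (2 * k) / 2 ^ (2 * v) =
      (\<Sum>\<sigma>=0..N. f \<sigma> * (pole_fps (- 3) (2 * p) * pole_fps (- 2) (2 * q) * pole_fps (- 1) (2 * r)) $ (N - \<sigma>))"
    by (simp only: fps_mult_nth[of "pole_fps (- 3 / 2) (2 * v)"] sum_divide_distrib f_def times_divide_eq_left)
  also have "\<dots> = (\<Sum>\<sigma>=0..N. f \<sigma> * X1 (N - \<sigma>)) - (\<Sum>\<sigma>=0..N. f \<sigma> * X2 (N - \<sigma>)) -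
      (\<Sum>\<sigma>=0..N. f \<sigma> * X3 (N - \<sigma>)) + (\<Sum>\<sigma>=0..N. f \<sigma> * X4 (N - \<sigma>))"
    unfolding pole_triple_nth[OF assms(1-3)] X1_def X2_def X3_def X4_def
      right_diff_distrib distrib_left sum_subtractf sum.distrib by (rule refl)
  also have "(\<Sum>\<sigma>=0..N. f \<sigma> * X1 (N - \<sigma>)) = I2_zeta_coeff p q r u v k"
    unfolding I2_zeta_coeff_def X1_def N_def[symmetric]
  proof (rule triple_sum_cong, goal_cases)
    case (1 \<sigma> \<rho> \<omega>)
    note le = 1(1)
    have top: "\<rho> + 2 * u - 2 * k - \<sigma> = \<rho> + (N - \<sigma>)"
      using le assms by (auto simp: N_def)
    have powi: "2 powi (int \<sigma> - 2 * int r - int \<omega>) = (2 :: complex) ^ \<sigma> / 2 ^ (2 * r + \<omega>)"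
      "3 powi (- 2 * int u - 2 * int v + 2 * int k - int \<rho> - 1) = (3 :: complex) ^ 0 / 3 ^ (2 * v + \<sigma> + (\<rho> + 1 + (N - \<sigma>)))"
      using le assms by (intro powi_eq_divide; simp add: N_def of_nat_diff)+
    have regroup: "c1 * (x / y) * (c2 * (c3 * c4 / (d * b))) =
        c1 * (c2 * (c3 * c4 * (x / d) * (1 / (y * b))))" for c1 c2 c3 c4 x y b d :: complex
      by (simp add: divide_inverse mult_ac)
    show ?case
      unfolding f_def pole_fps_minus_half_nth[OF dvd_triv_left] regroup top powi power_add[of 3 "2 * v + \<sigma>"] power_0
      by (rule refl)
  qed
  also have "(\<Sum>\<sigma>=0..N. f \<sigma> * X2 (N - \<sigma>)) = I4_zeta_coeff p q r u v k"
    unfolding I4_zeta_coeff_def X2_def N_def[symmetric]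
  proof (rule triple_sum_cong, goal_cases)
    case (1 \<sigma> \<rho> \<omega>)
    note le = 1(1)
    have top: "\<rho> + 2 * u - 2 * k - \<sigma> = \<rho> + (N - \<sigma>)"
      using le assms by (auto simp: N_def)
    have powi: "2 powi (- 2 * int u + 2 * int k + 2 * int \<sigma> - int \<rho> - 1) = (2 :: complex) ^ \<sigma> / 2 ^ (\<rho> + 1 + (N - \<sigma>))"
      "3 powi (- 2 * int v - int \<sigma>) = (3 :: complex) ^ 0 / 3 ^ (2 * v + \<sigma>)"
      using le assms by (intro powi_eq_divide; simp add: N_def of_nat_diff)+
    have regroup: "c1 * (x / y) * (c2 * (c3 * c4 * s / b)) =
        c1 * (c2 * (c3 * c4 * s * (x / b) * (1 / y)))" for s c1 c2 c3 c4 x y b :: complex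
      by (simp add: divide_inverse mult_ac)
    show ?case
      unfolding f_def pole_fps_minus_half_nth[OF dvd_triv_left] regroup top powi power_0
      by (rule refl)
  qed
  also have "(\<Sum>\<sigma>=0..N. f \<sigma> * X3 (N - \<sigma>)) = I6_zeta_coeff p q r u v k"
    unfolding I6_zeta_coeff_def X3_def N_def[symmetric]
  proof (rule triple_sum_cong, goal_cases)
    case (1 \<sigma> \<rho> \<omega>)
    note le = 1(1,2)
    have top: "\<rho> + 2 * u - 2 * k - \<sigma> = \<rho> + (N - \<sigma>)"
      using le assms by (auto simp: N_def)
    have powi: "2 powi (- 2 * int r + int \<sigma> + int \<rho> - int \<omega>) = (2 :: complex) ^ \<sigma> / 2 ^ (\<omega> + 2 * r - \<rho>)"
      "3 powi (- 2 * int v - int \<sigma>) = (3 :: complex) ^ 0 / 3 ^ (2 * v + \<sigma>)"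
      using le assms by (intro powi_eq_divide; simp add: N_def of_nat_diff)+
    have regroup: "c1 * (x / y) * (c2 * (c3 * c4 * s / b)) =
        c1 * (c2 * (c3 * c4 * s * (x / b) * (1 / y)))" for s c1 c2 c3 c4 x y b :: complex
      by (simp add: divide_inverse mult_ac)
    show ?case
      unfolding f_def pole_fps_minus_half_nth[OF dvd_triv_left] regroup top powi power_0
      by (rule refl)
  qed
  also have "(\<Sum>\<sigma>=0..N. f \<sigma> * X4 (N - \<sigma>)) = I8_zeta_coeff p q r u v k"
    unfolding I8_zeta_coeff_def X4_def N_def[symmetric]
  proof (rule triple_sum_cong, goal_cases)
    case (1 \<sigma> \<rho> \<omega>)
    note le = 1(1)
    have top: "\<rho> + 2 * u - 2 * k - \<sigma> = \<rho> + (N - \<sigma>)"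
      using le assms by (auto simp: N_def)
    have powi: "3 powi (- 2 * int v - int \<sigma>) = (3 :: complex) ^ 0 / 3 ^ (2 * v + \<sigma>)"
      by (rule powi_eq_divide; simp)
    have regroup: "c1 * (x / y) * (c2 * (c3 * c4 * s)) =
        c1 * (c2 * (c3 * c4 * s * x * (1 / y)))" for s c1 c2 c3 c4 x y :: complex
      by (simp add: divide_inverse mult_ac)
    show ?case
      unfolding f_def pole_fps_minus_half_nth[OF dvd_triv_left] regroup top powi power_0 power_int_of_nat
      by (rule refl)
  qed
  finally show ?thesis .
qed

text \<open>The product over the four integral poles is decomposed into partial fractions and
  expanded at \<open>- 3 / 2\<close>, with \<sigma> the order of a principal part minus one. The
  pole 0 yields \<open>I1\<close>, the pole -1 yields \<open>I3\<close>, the pole -2 yields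
  \<open>I5\<close> and \<open>I7\<close>, and the pole -3 yields the rest.\<close>

lemma G2_coeff_minus_3_half:
  assumes "p > 0" "q > 0" "r > 0" "u > 0" "k \<le> v"
  shows "2 ^ (2 * k) * G2_coeff p q r u v (- 3 / 2) (2 * k) / 2 ^ (2 * v) =
    2 * (I1_Lam_coeff p q r u v k + I2_Lam_coeff p q r u v k - I3_Lam_coeff p q r u v k - I4_Lam_coeff p q r u v k + I5_Lam_coeff p q r u v k - I6_Lam_coeff p q r u v k - I7_Lam_coeff p q r u v k + I8_Lam_coeff p q r u v k)"
proof -
  define M where "M = 2 * v - 2 * k"
  define A :: "complex set" where "A = {0, - 1, - 2, - 3}"
  define e where "e = G2_order p q r u v"
  \<comment> \<open>Combines the weight of the half-integral pole with the normalisation of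
    \<open>2 * m + 3 * n\<close>. Attaching it to the expansions at half-integral distances makes
    all fractional bases disappear.\<close>
  define K :: complex where "K = 2 ^ (2 * k) / 2 ^ (2 * v)"
  \<comment> \<open>From the poles 0, -1, -2, -3 the point \<open>- 3 / 2\<close> is at distance
    \<open>- 3 / 2\<close>, \<open>- 1 / 2\<close>, \<open>1 / 2\<close>, \<open>3 / 2\<close>. The
    two negative distances produce the signs in \<open>h0\<close> and \<open>h1\<close>; for the
    other two the sign is gone because \<open>M\<close> is even.\<close>
  define h0 where "h0 = (\<lambda>\<sigma>. (-1) ^ Suc \<sigma> * of_nat ((\<sigma> + 2 * v - 2 * k) choose \<sigma>) * (2 ^ \<sigma> / 3 ^ (\<sigma> + 1 + M)) :: complex)"
  define h1 where "h1 = (\<lambda>\<sigma>. (-1) ^ Suc \<sigma> * of_nat ((\<sigma> + 2 * v - 2 * k) choose \<sigma>) * (2 ^ \<sigma> / 1 ^ (\<sigma> + 1 + M)) :: complex)"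
  define h2 where "h2 = (\<lambda>\<sigma>. of_nat ((\<sigma> + 2 * v - 2 * k) choose \<sigma>) * (2 ^ \<sigma> / 1 ^ (\<sigma> + 1 + M)) :: complex)"
  define h3 where "h3 = (\<lambda>\<sigma>. of_nat ((\<sigma> + 2 * v - 2 * k) choose \<sigma>) * (2 ^ \<sigma> / 3 ^ (\<sigma> + 1 + M)) :: complex)"
  note half = pole_fps_half_Suc_nth[OF assms(5), folded K_def M_def]
  have K: "K * pole_fps (- 3 / 2) (Suc \<sigma>) $ M = 2 * h0 \<sigma>" "K * pole_fps (- 1 / 2) (Suc \<sigma>) $ M = 2 * h1 \<sigma>"
    "K * pole_fps (1 / 2) (Suc \<sigma>) $ M = 2 * h2 \<sigma>" "K * pole_fps (3 / 2) (Suc \<sigma>) $ M = 2 * h3 \<sigma>" for \<sigma>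
    unfolding half(2)[of 3] half(2)[of 1] half(1)[of 1] half(1)[of 3] h0_def h1_def h2_def h3_def by (rule refl)+
  have A_diff: "A - {0} = {- 1, - 2, - 3}" "A - {- 1} = {0, - 2, - 3}" "A - {- 2} = {0, - 1, - 3}" "A - {- 3} = {0, - 1, - 2}"
    by (auto simp: A_def)
  have e: "e 0 = 2 * p" "e (- 1) = 2 * q" "e (- 2) = 2 * r" "e (- 3) = 2 * u" by (auto simp: e_def G2_order_def)
  have lc0: "laurent_coeff A e 0 (Suc \<sigma>) = (pole_fps 3 (2 * u) * (pole_fps 2 (2 * r) * pole_fps 1 (2 * q))) $ (2 * p - 1 - \<sigma>)" for \<sigma>
    by (simp add: laurent_coeff_def A_diff e mult_ac)
  have lc1: "laurent_coeff A e (- 1) (Suc \<sigma>) = (pole_fps 2 (2 * u) * (pole_fps 1 (2 * r) * pole_fps (- 1) (2 * p))) $ (2 * q - 1 - \<sigma>)" for \<sigma>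
    by (simp add: laurent_coeff_def A_diff e mult_ac)
  have lc2: "laurent_coeff A e (- 2) (Suc \<sigma>) = (pole_fps 1 (2 * u) * (pole_fps (- 2) (2 * p) * pole_fps (- 1) (2 * q))) $ (2 * r - 1 - \<sigma>)" for \<sigma>
    by (simp add: laurent_coeff_def A_diff e mult_ac)
  have lc3: "laurent_coeff A e (- 3) (Suc \<sigma>) = (pole_fps (- 3) (2 * p) * pole_fps (- 2) (2 * q) * pole_fps (- 1) (2 * r)) $ (2 * u - 1 - \<sigma>)" for \<sigma>
    by (simp add: laurent_coeff_def A_diff e mult.assoc)
  have "G2_poles - {- 3 / 2} = A" by (auto simp: G2_poles_def A_def)
  then have "G2_coeff p q r u v (- 3 / 2) (2 * k) = (\<Prod>b\<in>A. pole_fps (- 3 / 2 - b) (e b)) $ M"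
    by (simp add: G2_coeff_def laurent_coeff_def e_def M_def G2_order_def)
  also have "(\<Prod>b\<in>A. pole_fps (- 3 / 2 - b) (e b)) = (\<Sum>a\<in>A. \<Sum>j=1..e a. fps_const (laurent_coeff A e a j) * pole_fps (- 3 / 2 - a) j)"
    by (rule partial_fractions_fps) (use assms in \<open>auto simp: A_def e\<close>)
  also have "\<dots> = (\<Sum>j=1..2 * p. fps_const (laurent_coeff A e 0 j) * pole_fps (- 3 / 2) j) +
      (\<Sum>j=1..2 * q. fps_const (laurent_coeff A e (- 1) j) * pole_fps (- 1 / 2) j) +
      (\<Sum>j=1..2 * r. fps_const (laurent_coeff A e (- 2) j) * pole_fps (1 / 2) j) +
      (\<Sum>j=1..2 * u. fps_const (laurent_coeff A e (- 3) j) * pole_fps (3 / 2) j)"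
    unfolding A_def by (simp add: e add.assoc)
  finally have "G2_coeff p q r u v (- 3 / 2) (2 * k) =
      (\<Sum>\<sigma>=0..2 * p - 1. laurent_coeff A e 0 (Suc \<sigma>) * pole_fps (- 3 / 2) (Suc \<sigma>) $ M) +
      (\<Sum>\<sigma>=0..2 * q - 1. laurent_coeff A e (- 1) (Suc \<sigma>) * pole_fps (- 1 / 2) (Suc \<sigma>) $ M) +
      (\<Sum>\<sigma>=0..2 * r - 1. laurent_coeff A e (- 2) (Suc \<sigma>) * pole_fps (1 / 2) (Suc \<sigma>) $ M) +
      (\<Sum>\<sigma>=0..2 * u - 1. laurent_coeff A e (- 3) (Suc \<sigma>) * pole_fps (3 / 2) (Suc \<sigma>) $ M)"
    using assms by (simp add: fps_sum_nth sum_atLeast1_shift)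
  then have "K * G2_coeff p q r u v (- 3 / 2) (2 * k) =
      (\<Sum>\<sigma>=0..2 * p - 1. laurent_coeff A e 0 (Suc \<sigma>) * (K * pole_fps (- 3 / 2) (Suc \<sigma>) $ M)) +
      (\<Sum>\<sigma>=0..2 * q - 1. laurent_coeff A e (- 1) (Suc \<sigma>) * (K * pole_fps (- 1 / 2) (Suc \<sigma>) $ M)) +
      (\<Sum>\<sigma>=0..2 * r - 1. laurent_coeff A e (- 2) (Suc \<sigma>) * (K * pole_fps (1 / 2) (Suc \<sigma>) $ M)) +
      (\<Sum>\<sigma>=0..2 * u - 1. laurent_coeff A e (- 3) (Suc \<sigma>) * (K * pole_fps (3 / 2) (Suc \<sigma>) $ M))"
    by (simp only: distrib_left sum_distrib_left mult.left_commute[of K])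
  then have total: "K * G2_coeff p q r u v (- 3 / 2) (2 * k) = 2 * (
      (\<Sum>\<sigma>=0..2 * p - 1. h0 \<sigma> * laurent_coeff A e 0 (Suc \<sigma>)) +
      (\<Sum>\<sigma>=0..2 * q - 1. h1 \<sigma> * laurent_coeff A e (- 1) (Suc \<sigma>)) +
      (\<Sum>\<sigma>=0..2 * r - 1. h2 \<sigma> * laurent_coeff A e (- 2) (Suc \<sigma>)) +
      (\<Sum>\<sigma>=0..2 * u - 1. h3 \<sigma> * laurent_coeff A e (- 3) (Suc \<sigma>)))"
    unfolding K by (simp only: distrib_left sum_distrib_left mult_ac)
  have "(\<Sum>\<sigma>=0..2 * p - 1. h0 \<sigma> * laurent_coeff A e 0 (Suc \<sigma>)) = I1_Lam_coeff p q r u v k"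
    unfolding I1_Lam_coeff_def lc0 fps_mult2_nth
  proof (rule triple_sum_cong, goal_cases)
    case (1 \<sigma> \<rho> \<omega>)
    from 1 have le: "\<sigma> + \<rho> + \<omega> \<le> 2 * p - 1" by auto
    have "Suc \<sigma> + \<rho> + \<omega> + (2 * p - 1 - \<sigma> - \<rho> - \<omega>) = 2 * p" using le assms(1) by auto
    then have sgn: "(-1) ^ Suc \<sigma> * (-1) ^ \<rho> * (-1) ^ \<omega> * (-1) ^ (2 * p - 1 - \<sigma> - \<rho> - \<omega>) = (1 :: complex)"
      unfolding power_add[symmetric] by simp
    have top: "2 * p + 2 * q - 2 - \<sigma> - \<rho> - \<omega> = 2 * p - 1 - \<sigma> - \<rho> - \<omega> + 2 * q - 1"
      using le assms(1,2) by auto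
    have powi: "2 powi (int \<sigma> - 2 * int r - int \<omega>) = (2 :: complex) ^ \<sigma> / 2 ^ (2 * r + \<omega>)"
      "3 powi (- 2 * int u - 2 * int v + 2 * int k - int \<sigma> - int \<rho> - 1) = (3 :: complex) ^ 0 / 3 ^ (\<sigma> + 1 + M + (2 * u + \<rho>))"
      using assms(5) by (intro powi_eq_divide; simp add: M_def of_nat_diff)+
    have regroup: "s1 * c1 * (x / y) * (s2 * c2 / b * (s3 * c3 / d * (s4 * c4))) =
        (s1 * s2 * s3 * s4) * (c1 * (c2 * (c3 * c4 * (x / d) * (1 / (y * b)))))" for s1 s2 s3 s4 c1 c2 c3 c4 x y b d :: complex
      by (simp add: divide_inverse mult_ac)
    show ?case
      unfolding h0_def pole_fps_1_nth[OF assms(2)] pole_fps_nth'[of 3] pole_fps_nth'[of 2] regroup sgn top powi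
        power_add[of 3 "\<sigma> + 1 + M"] power_0 mult_1
      by (rule refl)
  qed
  moreover have "(\<Sum>\<sigma>=0..2 * q - 1. h1 \<sigma> * laurent_coeff A e (- 1) (Suc \<sigma>)) = - I3_Lam_coeff p q r u v k"
    unfolding I3_Lam_coeff_def lc1 fps_mult2_nth sum_negf[symmetric] minus_mult_left
  proof (rule triple_sum_cong, goal_cases)
    case (1 \<sigma> \<rho> \<omega>)
    from 1 have le: "\<sigma> + \<rho> + \<omega> \<le> 2 * q - 1" by auto
    have top: "2 * p + 2 * q - 2 - \<sigma> - \<rho> - \<omega> = 2 * q - 1 - \<sigma> - \<rho> - \<omega> + 2 * p - 1"
      using le assms(1,2) by auto
    have powi: "2 powi (int \<sigma> - 2 * int u - int \<rho>) = (2 :: complex) ^ \<sigma> / 2 ^ (2 * u + \<rho>)"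
      by (rule powi_eq_divide; simp)
    have regroup: "- 1 * s1 * c1 * (x / 1) * (s2 * c2 / b * (s3 * c3 * c4)) =
        - c1 * (c2 * (c3 * c4 * (s1 * s2 * s3) * (x / b)))" for s1 s2 s3 c1 c2 c3 c4 x b :: complex
      by (simp add: divide_inverse mult_ac)
    show ?case
      unfolding h1_def power_Suc[of "- 1"] pole_fps_minus_1_nth[OF assms(1)] pole_fps_nth'[of 2] pole_fps_1_nth' power_one regroup top powi power_add[of "- 1"]
      by (rule refl)
  qed
  moreover have "(\<Sum>\<sigma>=0..2 * r - 1. h2 \<sigma> * laurent_coeff A e (- 2) (Suc \<sigma>)) = I5_Lam_coeff p q r u v k - I7_Lam_coeff p q r u v k"
  proof -
    define X where "X = (\<lambda>n. \<Sum>\<omega>=0..2 * p - 1. of_nat ((\<omega> + n) choose \<omega>) * of_nat ((2 * p + 2 * q - 2 - \<omega>) choose (2 * q - 1)) / 2 ^ (\<omega> + 1 + n) :: complex)"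
    define Y where "Y = (\<lambda>n. \<Sum>\<omega>=0..2 * q - 1. of_nat ((\<omega> + n) choose \<omega>) * of_nat ((2 * p + 2 * q - 2 - \<omega>) choose (2 * p - 1)) * (-1) ^ \<omega> :: complex)"
    have "(\<Sum>\<sigma>=0..2 * r - 1. h2 \<sigma> * laurent_coeff A e (- 2) (Suc \<sigma>)) =
        (\<Sum>\<sigma>=0..2 * r - 1. h2 \<sigma> * (\<Sum>\<rho>=0..2 * r - 1 - \<sigma>. pole_fps 1 (2 * u) $ \<rho> * X (2 * r - 1 - \<sigma> - \<rho>))) -
        (\<Sum>\<sigma>=0..2 * r - 1. h2 \<sigma> * (\<Sum>\<rho>=0..2 * r - 1 - \<sigma>. pole_fps 1 (2 * u) $ \<rho> * Y (2 * r - 1 - \<sigma> - \<rho>)))"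
      unfolding lc2 fps_mult_nth[of "pole_fps 1 (2 * u)"] pole_pair_nth[OF assms(1,2)] X_def Y_def right_diff_distrib sum_subtractf by (rule refl)
    also have "(\<Sum>\<sigma>=0..2 * r - 1. h2 \<sigma> * (\<Sum>\<rho>=0..2 * r - 1 - \<sigma>. pole_fps 1 (2 * u) $ \<rho> * X (2 * r - 1 - \<sigma> - \<rho>))) = I5_Lam_coeff p q r u v k"
      unfolding I5_Lam_coeff_def X_def
    proof (rule triple_sum_cong, goal_cases)
      case (1 \<sigma> \<rho> \<omega>)
      from 1 have le: "\<sigma> + \<rho> \<le> 2 * r - 1" by auto
      have top: "\<omega> + 2 * r - 1 - \<sigma> - \<rho> = \<omega> + (2 * r - 1 - \<sigma> - \<rho>)"
        using le assms(3) by auto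
      have powi: "2 powi (- 2 * int r + 2 * int \<sigma> + int \<rho> - int \<omega>) = (2 :: complex) ^ \<sigma> / 2 ^ (\<omega> + 1 + (2 * r - 1 - \<sigma> - \<rho>))"
        using le assms(3) by (intro powi_eq_divide) (simp_all add: of_nat_diff)
      have regroup: "c1 * (x / 1) * (s2 * c2 * (c3 * c4 / b)) =
          c1 * (c2 * (c3 * c4 * s2 * (x / b)))" for s2 c1 c2 c3 c4 x b :: complex
        by (simp add: divide_inverse mult_ac)
      show ?case
        unfolding h2_def pole_fps_1_nth' power_one regroup top powi
        by (rule refl)
    qed
    also have "(\<Sum>\<sigma>=0..2 * r - 1. h2 \<sigma> * (\<Sum>\<rho>=0..2 * r - 1 - \<sigma>. pole_fps 1 (2 * u) $ \<rho> * Y (2 * r - 1 - \<sigma> - \<rho>))) = I7_Lam_coeff p q r u v k"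
      unfolding I7_Lam_coeff_def Y_def
    proof (rule triple_sum_cong, goal_cases)
      case (1 \<sigma> \<rho> \<omega>)
      from 1 have le: "\<sigma> + \<rho> \<le> 2 * r - 1" by auto
      have top: "\<omega> + 2 * r - 1 - \<sigma> - \<rho> = \<omega> + (2 * r - 1 - \<sigma> - \<rho>)"
        using le assms(3) by auto
      have regroup: "c1 * (x / 1) * (s2 * c2 * (c3 * c4 * s3)) =
          c1 * (c2 * (c3 * c4 * (s2 * s3) * x))" for s2 s3 c1 c2 c3 c4 x :: complex
        by (simp add: divide_inverse mult_ac)
      show ?case
        unfolding h2_def pole_fps_1_nth' power_one regroup top power_add[of "- 1"] power_int_of_nat
        by (rule refl)
    qed
    finally show ?thesis .
  qed
  moreover have "(\<Sum>\<sigma>=0..2 * u - 1. h3 \<sigma> * laurent_coeff A e (- 3) (Suc \<sigma>)) = I2_Lam_coeff p q r u v k - I4_Lam_coeff p q r u v k - I6_Lam_coeff p q r u v k + I8_Lam_coeff p q r u v k"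
  proof -
    define X1 where "X1 = (\<lambda>n. \<Sum>\<rho>=0..2 * p - 1. of_nat ((\<rho> + n) choose \<rho>) * (\<Sum>\<omega>=0..2 * p - 1 - \<rho>. of_nat ((\<omega> + 2 * r - 1) choose \<omega>) *
          of_nat ((2 * p + 2 * q - 2 - \<rho> - \<omega>) choose (2 * q - 1)) / (2 ^ (2 * r + \<omega>) * 3 ^ (\<rho> + 1 + n))) :: complex)"
    define X2 where "X2 = (\<lambda>n. \<Sum>\<rho>=0..2 * q - 1. of_nat ((\<rho> + n) choose \<rho>) * (\<Sum>\<omega>=0..2 * q - 1 - \<rho>. of_nat ((\<omega> + 2 * r - 1) choose \<omega>) *
          of_nat ((2 * p + 2 * q - 2 - \<rho> - \<omega>) choose (2 * p - 1)) * (-1) ^ (\<rho> + \<omega>) / 2 ^ (\<rho> + 1 + n)) :: complex)"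
    define X3 where "X3 = (\<lambda>n. \<Sum>\<rho>=0..2 * r - 1. of_nat ((\<rho> + n) choose \<rho>) * (\<Sum>\<omega>=0..2 * p - 1. of_nat ((\<omega> + 2 * r - 1 - \<rho>) choose \<omega>) *
          of_nat ((2 * p + 2 * q - 2 - \<omega>) choose (2 * q - 1)) * (-1) ^ \<rho> / 2 ^ (\<omega> + 2 * r - \<rho>)) :: complex)"
    define X4 where "X4 = (\<lambda>n. \<Sum>\<rho>=0..2 * r - 1. of_nat ((\<rho> + n) choose \<rho>) * (\<Sum>\<omega>=0..2 * q - 1. of_nat ((\<omega> + 2 * r - 1 - \<rho>) choose \<omega>) *
          of_nat ((2 * p + 2 * q - 2 - \<omega>) choose (2 * p - 1)) * (-1) ^ (\<rho> + \<omega>)) :: complex)"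
    have "(\<Sum>\<sigma>=0..2 * u - 1. h3 \<sigma> * laurent_coeff A e (- 3) (Suc \<sigma>)) = (\<Sum>\<sigma>=0..2 * u - 1. h3 \<sigma> * X1 (2 * u - 1 - \<sigma>)) - (\<Sum>\<sigma>=0..2 * u - 1. h3 \<sigma> * X2 (2 * u - 1 - \<sigma>)) -
        (\<Sum>\<sigma>=0..2 * u - 1. h3 \<sigma> * X3 (2 * u - 1 - \<sigma>)) + (\<Sum>\<sigma>=0..2 * u - 1. h3 \<sigma> * X4 (2 * u - 1 - \<sigma>))"
      unfolding lc3 pole_triple_nth[OF assms(1-3)] X1_def X2_def X3_def X4_def
        right_diff_distrib distrib_left sum_subtractf sum.distrib by (rule refl)
    also have "(\<Sum>\<sigma>=0..2 * u - 1. h3 \<sigma> * X1 (2 * u - 1 - \<sigma>)) = I2_Lam_coeff p q r u v k"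
      unfolding I2_Lam_coeff_def X1_def
    proof (rule triple_sum_cong, goal_cases)
      case (1 \<sigma> \<rho> \<omega>)
      note le = 1(1)
      have top: "\<rho> + 2 * u - 1 - \<sigma> = \<rho> + (2 * u - 1 - \<sigma>)"
        using le assms by (auto simp: M_def)
      have powi: "2 powi (int \<sigma> - 2 * int r - int \<omega>) = (2 :: complex) ^ \<sigma> / 2 ^ (2 * r + \<omega>)"
        "3 powi (- 2 * int u - 2 * int v + 2 * int k - int \<rho> - 1) = (3 :: complex) ^ 0 / 3 ^ (\<sigma> + 1 + M + (\<rho> + 1 + (2 * u - 1 - \<sigma>)))"
        using le assms by (intro powi_eq_divide; simp add: M_def of_nat_diff)+
      have regroup: "c1 * (x / y) * (c2 * (c3 * c4 / (d * b))) =
          c1 * (c2 * (c3 * c4 * (x / d) * (1 / (y * b))))" for c1 c2 c3 c4 x y b d :: complex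
        by (simp add: divide_inverse mult_ac)
      show ?case
        unfolding h3_def regroup top powi power_add[of 3 "\<sigma> + 1 + M"] power_0
        by (rule refl)
    qed
    also have "(\<Sum>\<sigma>=0..2 * u - 1. h3 \<sigma> * X2 (2 * u - 1 - \<sigma>)) = I4_Lam_coeff p q r u v k"
      unfolding I4_Lam_coeff_def X2_def
    proof (rule triple_sum_cong, goal_cases)
      case (1 \<sigma> \<rho> \<omega>)
      note le = 1(1)
      have top: "\<rho> + 2 * u - 1 - \<sigma> = \<rho> + (2 * u - 1 - \<sigma>)"
        using le assms by (auto simp: M_def)
      have powi: "2 powi (- 2 * int u + 2 * int \<sigma> - int \<rho>) = (2 :: complex) ^ \<sigma> / 2 ^ (\<rho> + 1 + (2 * u - 1 - \<sigma>))"
        "3 powi (- 2 * int v + 2 * int k - int \<sigma> - 1) = (3 :: complex) ^ 0 / 3 ^ (\<sigma> + 1 + M)"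
        using le assms by (intro powi_eq_divide; simp add: M_def of_nat_diff)+
      have regroup: "c1 * (x / y) * (c2 * (c3 * c4 * s / b)) =
          c1 * (c2 * (c3 * c4 * s * (x / b) * (1 / y)))" for s c1 c2 c3 c4 x y b :: complex
        by (simp add: divide_inverse mult_ac)
      show ?case
        unfolding h3_def regroup top powi power_0
        by (rule refl)
    qed
    also have "(\<Sum>\<sigma>=0..2 * u - 1. h3 \<sigma> * X3 (2 * u - 1 - \<sigma>)) = I6_Lam_coeff p q r u v k"
      unfolding I6_Lam_coeff_def X3_def
    proof (rule triple_sum_cong, goal_cases)
      case (1 \<sigma> \<rho> \<omega>)
      note le = 1(1,2)
      have top: "\<rho> + 2 * u - 1 - \<sigma> = \<rho> + (2 * u - 1 - \<sigma>)"
        using le assms by (auto simp: M_def)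
      have powi: "2 powi (- 2 * int r + int \<sigma> + int \<rho> - int \<omega>) = (2 :: complex) ^ \<sigma> / 2 ^ (\<omega> + 2 * r - \<rho>)"
        "3 powi (- 2 * int v + 2 * int k - int \<sigma> - 1) = (3 :: complex) ^ 0 / 3 ^ (\<sigma> + 1 + M)"
        using le assms by (intro powi_eq_divide; simp add: M_def of_nat_diff)+
      have regroup: "c1 * (x / y) * (c2 * (c3 * c4 * s / b)) =
          c1 * (c2 * (c3 * c4 * s * (x / b) * (1 / y)))" for s c1 c2 c3 c4 x y b :: complex
        by (simp add: divide_inverse mult_ac)
      show ?case
        unfolding h3_def regroup top powi power_0
        by (rule refl)
    qed
    also have "(\<Sum>\<sigma>=0..2 * u - 1. h3 \<sigma> * X4 (2 * u - 1 - \<sigma>)) = I8_Lam_coeff p q r u v k"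
      unfolding I8_Lam_coeff_def X4_def
    proof (rule triple_sum_cong, goal_cases)
      case (1 \<sigma> \<rho> \<omega>)
      note le = 1(1)
      have top: "\<rho> + 2 * u - 1 - \<sigma> = \<rho> + (2 * u - 1 - \<sigma>)"
        using le assms by (auto simp: M_def)
      have powi: "3 powi (- 2 * int v + 2 * int k - int \<sigma> - 1) = (3 :: complex) ^ 0 / 3 ^ (\<sigma> + 1 + M)"
        using assms by (intro powi_eq_divide; simp add: M_def of_nat_diff)
      have regroup: "c1 * (x / y) * (c2 * (c3 * c4 * s)) =
          c1 * (c2 * (c3 * c4 * s * x * (1 / y)))" for s c1 c2 c3 c4 x y :: complex
        by (simp add: divide_inverse mult_ac)
      show ?case
        unfolding h3_def regroup top powi power_0 power_int_of_nat
        by (rule refl)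
    qed
    finally show ?thesis .
  qed
  ultimately show ?thesis
    using total by (simp only: K_def times_divide_eq_left) (simp only: diff_conv_add_uminus minus_add_distrib minus_minus add_ac)
qed

section \<open>The functional relation\<close>

text \<open>Both sides are the same linear combination of products of zeta values, compared
  coefficient by coefficient. Therefore the equality holds at every \<open>s\<close>, even where an
  argument of \<open>zeta\<close> is 1 and the value is conventional.\<close>

lemma sum_I_eq_G2_closed:
  assumes pos: "p > 0" "q > 0" "r > 0" "u > 0"
  shows "I1 p q r u v s + I2 p q r u v s + I3 p q r u v s + I4 p q r u v s +
    I5 p q r u v s + I6 p q r u v s + I7 p q r u v s + I8 p q r u v s = - G2_closed p q r u v s"
proof -
  define z where "z = (\<lambda>k. zeta (2 * of_nat k) * zeta (wk p q r u v s k))"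
  define L where "L = (\<lambda>k. Lam p q r u v s k)"
  define T1 where "T1 = I1_zeta_coeff p q r u v"
  define T2 where "T2 = I2_zeta_coeff p q r u v"
  define T3 where "T3 = I3_zeta_coeff p q r u v"
  define T4 where "T4 = I4_zeta_coeff p q r u v"
  define T5 where "T5 = I5_zeta_coeff p q r u v"
  define T6 where "T6 = I6_zeta_coeff p q r u v"
  define T7 where "T7 = I7_zeta_coeff p q r u v"
  define T8 where "T8 = I8_zeta_coeff p q r u v"
  define U1 where "U1 = I1_Lam_coeff p q r u v"
  define U2 where "U2 = I2_Lam_coeff p q r u v"
  define U3 where "U3 = I3_Lam_coeff p q r u v"
  define U4 where "U4 = I4_Lam_coeff p q r u v"
  define U5 where "U5 = I5_Lam_coeff p q r u v"
  define U6 where "U6 = I6_Lam_coeff p q r u v"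
  define U7 where "U7 = I7_Lam_coeff p q r u v"
  define U8 where "U8 = I8_Lam_coeff p q r u v"
  define c where "c = G2_coeff p q r u v"
  have I: "I1 p q r u v s = - 2 * (\<Sum>k=0..p. z k * T1 k) - 2 * (\<Sum>k=0..v. L k * U1 k)"
    "I2 p q r u v s = - 2 * (\<Sum>k=0..u. z k * T2 k) - 2 * (\<Sum>k=0..v. L k * U2 k)"
    "I3 p q r u v s = - 2 * (\<Sum>k=0..q. z k * T3 k) + 2 * (\<Sum>k=0..v. L k * U3 k)"
    "I4 p q r u v s = 2 * (\<Sum>k=0..u. z k * T4 k) + 2 * (\<Sum>k=0..v. L k * U4 k)"
    "I5 p q r u v s = - 2 * (\<Sum>k=0..r. z k * T5 k) - 2 * (\<Sum>k=0..v. L k * U5 k)"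
    "I6 p q r u v s = 2 * (\<Sum>k=0..u. z k * T6 k) + 2 * (\<Sum>k=0..v. L k * U6 k)"
    "I7 p q r u v s = 2 * (\<Sum>k=0..r. z k * T7 k) + 2 * (\<Sum>k=0..v. L k * U7 k)"
    "I8 p q r u v s = - 2 * (\<Sum>k=0..u. z k * T8 k) - 2 * (\<Sum>k=0..v. L k * U8 k)"
    by (simp_all only: I1_def I2_def I3_def I4_def I5_def I6_def I7_def I8_def z_def L_def T1_def T2_def T3_def T4_def T5_def T6_def T7_def T8_def U1_def U2_def U3_def U4_def U5_def U6_def U7_def U8_def
      I1_zeta_coeff_def I2_zeta_coeff_def I3_zeta_coeff_def I4_zeta_coeff_def I5_zeta_coeff_def I6_zeta_coeff_def I7_zeta_coeff_def I8_zeta_coeff_def I1_Lam_coeff_def I2_Lam_coeff_def I3_Lam_coeff_def I4_Lam_coeff_def I5_Lam_coeff_def I6_Lam_coeff_def I7_Lam_coeff_def I8_Lam_coeff_def mult.assoc)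
  have simple: "(\<Sum>k\<le>G2_order p q r u v a div 2. c a (2 * k) *
      (if a = - 3 / 2 then 2 ^ (2 * k) * Lam p q r u v s k else 2 * zeta (2 * of_nat k) * zeta (wk p q r u v s k))) / 2 ^ (2 * v) =
      2 * (\<Sum>k=0..K. z k * T k)"
    if "a \<noteq> - 3 / 2" "G2_order p q r u v a div 2 = K" "\<And>k. k \<le> K \<Longrightarrow> c a (2 * k) / 2 ^ (2 * v) = T k" for a K T
    unfolding that(2) if_not_P[OF that(1)] sum_divide_distrib sum_distrib_left atMost_atLeast0
  proof (rule sum.cong[OF refl])
    fix k assume "k \<in> {0..K}"
    then have "T k = c a (2 * k) / 2 ^ (2 * v)" using that(3) by simp
    then show "c a (2 * k) * (2 * zeta (2 * of_nat k) * zeta (wk p q r u v s k)) / 2 ^ (2 * v) = 2 * (z k * T k)"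
      by (simp add: z_def mult_ac)
  qed
  have half: "(\<Sum>k\<le>G2_order p q r u v a div 2. c a (2 * k) *
      (if a = - 3 / 2 then 2 ^ (2 * k) * Lam p q r u v s k else 2 * zeta (2 * of_nat k) * zeta (wk p q r u v s k))) / 2 ^ (2 * v) =
      2 * (\<Sum>k=0..v. L k * (U1 k + U2 k - U3 k - U4 k + U5 k - U6 k - U7 k + U8 k))"
    if a: "a = - 3 / 2" for a
  proof -
    have order: "G2_order p q r u v a div 2 = v" by (simp add: a G2_order_def)
    show ?thesis
      unfolding order if_P[OF a] sum_divide_distrib sum_distrib_left atMost_atLeast0
    proof (rule sum.cong[OF refl])
      fix k assume "k \<in> {0..v}"
      then have "2 ^ (2 * k) * c a (2 * k) / 2 ^ (2 * v) = 2 * (U1 k + U2 k - U3 k - U4 k + U5 k - U6 k - U7 k + U8 k)"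
        unfolding c_def a U1_def U2_def U3_def U4_def U5_def U6_def U7_def U8_def using pos by (intro G2_coeff_minus_3_half) auto
      moreover have "c a (2 * k) * (2 ^ (2 * k) * Lam p q r u v s k) / 2 ^ (2 * v) =
          L k * (2 ^ (2 * k) * c a (2 * k) / 2 ^ (2 * v))"
        by (simp add: L_def mult_ac)
      ultimately show "c a (2 * k) * (2 ^ (2 * k) * Lam p q r u v s k) / 2 ^ (2 * v) =
          2 * (L k * (U1 k + U2 k - U3 k - U4 k + U5 k - U6 k - U7 k + U8 k))"
        by (simp only: mult.left_commute)
    qed
  qed
  have at_0: "c 0 (2 * k) / 2 ^ (2 * v) = T1 k" if "k \<le> p" for k
    unfolding c_def T1_def using pos that by (intro G2_coeff_0)
  have at_1: "c (- 1) (2 * k) / 2 ^ (2 * v) = T3 k" if "k \<le> q" for k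
    unfolding c_def T3_def using pos that by (intro G2_coeff_minus_1)
  have at_2: "c (- 2) (2 * k) / 2 ^ (2 * v) = T5 k - T7 k" if "k \<le> r" for k
    unfolding c_def T5_def T7_def using pos that by (intro G2_coeff_minus_2)
  have at_3: "c (- 3) (2 * k) / 2 ^ (2 * v) = T2 k - T4 k - T6 k + T8 k" if "k \<le> u" for k
    unfolding c_def T2_def T4_def T6_def T8_def using pos that by (intro G2_coeff_minus_3)
  have poles: "(\<Sum>a\<in>G2_poles. f a) = f 0 + f (- 1) + f (- 2) + f (- 3) + f (- 3 / 2)" for f :: "complex \<Rightarrow> complex"
    by (simp add: G2_poles_def add_ac)
  have orders: "G2_order p q r u v 0 div 2 = p" "G2_order p q r u v (- 1) div 2 = q"
    "G2_order p q r u v (- 2) div 2 = r" "G2_order p q r u v (- 3) div 2 = u"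
    by (simp_all add: G2_order_def)
  have ne: "(0 :: complex) \<noteq> - 3 / 2" "(- 1 :: complex) \<noteq> - 3 / 2" "(- 2 :: complex) \<noteq> - 3 / 2" "(- 3 :: complex) \<noteq> - 3 / 2"
    by auto
  have part0: "(\<Sum>k\<le>G2_order p q r u v 0 div 2. c 0 (2 * k) *
      (if (0 :: complex) = - 3 / 2 then 2 ^ (2 * k) * Lam p q r u v s k else 2 * zeta (2 * of_nat k) * zeta (wk p q r u v s k))) / 2 ^ (2 * v) = 2 * (\<Sum>k=0..p. z k * T1 k)"
    by (rule simple[OF ne(1) orders(1) at_0])
  have part1: "(\<Sum>k\<le>G2_order p q r u v (- 1) div 2. c (- 1) (2 * k) *
      (if (- 1 :: complex) = - 3 / 2 then 2 ^ (2 * k) * Lam p q r u v s k else 2 * zeta (2 * of_nat k) * zeta (wk p q r u v s k))) / 2 ^ (2 * v) = 2 * (\<Sum>k=0..q. z k * T3 k)"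
    by (rule simple[OF ne(2) orders(2) at_1])
  have part2: "(\<Sum>k\<le>G2_order p q r u v (- 2) div 2. c (- 2) (2 * k) *
      (if (- 2 :: complex) = - 3 / 2 then 2 ^ (2 * k) * Lam p q r u v s k else 2 * zeta (2 * of_nat k) * zeta (wk p q r u v s k))) / 2 ^ (2 * v) = 2 * (\<Sum>k=0..r. z k * (T5 k - T7 k))"
    by (rule simple[OF ne(3) orders(3) at_2])
  have part3: "(\<Sum>k\<le>G2_order p q r u v (- 3) div 2. c (- 3) (2 * k) *
      (if (- 3 :: complex) = - 3 / 2 then 2 ^ (2 * k) * Lam p q r u v s k else 2 * zeta (2 * of_nat k) * zeta (wk p q r u v s k))) / 2 ^ (2 * v) = 2 * (\<Sum>k=0..u. z k * (T2 k - T4 k - T6 k + T8 k))"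
    by (rule simple[OF ne(4) orders(4) at_3])
  have "G2_closed p q r u v s = 2 * (\<Sum>k=0..p. z k * T1 k) + 2 * (\<Sum>k=0..q. z k * T3 k) + 2 * (\<Sum>k=0..r. z k * (T5 k - T7 k)) +
      2 * (\<Sum>k=0..u. z k * (T2 k - T4 k - T6 k + T8 k)) +
      2 * (\<Sum>k=0..v. L k * (U1 k + U2 k - U3 k - U4 k + U5 k - U6 k - U7 k + U8 k))"
    unfolding G2_closed_def poles add_divide_distrib c_def[symmetric]
      part0 part1 part2 part3 half[OF refl] by (rule refl)
  then show ?thesis
    unfolding I distrib_left right_diff_distrib sum.distrib sum_subtractf by simp
qed

section \<open>Holomorphy and regularity for the analytic continuation\<close>

lemma holomorphic_phi: "phi holomorphic_on - {1}"
proof (rule holomorphic_transform)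
  show "(\<lambda>w. (2 powr (1 - w) - 1) * zeta w) holomorphic_on - {1}"
    by (intro holomorphic_intros holomorphic_zeta) auto
qed (simp add: phi_eq)

text \<open>The number \<open>p + q + r + u + v\<close> is a common bound for the ranges of
  \<open>k\<close> at all five poles, so finitely many conditions on \<open>t\<close> keep every
  argument of \<open>zeta\<close> and \<open>phi\<close> away from 1.\<close>

lemma holomorphic_G2_closed:
  assumes "\<And>t k. t \<in> R \<Longrightarrow> k \<le> p + q + r + u + v \<Longrightarrow> wk p q r u v t k \<noteq> 1"
  shows "G2_closed p q r u v holomorphic_on R"
proof -
  have wk: "(\<lambda>t. wk p q r u v t k) holomorphic_on R" for k
    unfolding wk_def by (intro holomorphic_intros)
  have comp: "(\<lambda>t. f (wk p q r u v t k)) holomorphic_on R" if "k \<le> p + q + r + u + v" "f holomorphic_on - {1}" for f k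
  proof -
    have "(\<lambda>t. wk p q r u v t k) ` R \<subseteq> - {1}"
      by (rule image_subsetI) (simp add: assms that(1))
    from holomorphic_on_compose_gen[OF wk that(2) this] show ?thesis by (simp add: comp_def)
  qed
  have order: "k \<le> p + q + r + u + v" if "k \<in> {..G2_order p q r u v a div 2}" for a k
    using that by (auto simp: G2_order_def split: if_splits)
  have Lam: "(\<lambda>t. Lam p q r u v t k) holomorphic_on R" if "k \<le> p + q + r + u + v" for k
    unfolding Lam_def by (intro holomorphic_intros comp that holomorphic_zeta holomorphic_phi)
  have "(\<lambda>t. if a = - 3 / 2 then 2 ^ (2 * k) * Lam p q r u v t k else 2 * zeta (2 * of_nat k) * zeta (wk p q r u v t k))
      holomorphic_on R" if "k \<in> {..G2_order p q r u v a div 2}" for a k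
    using order[OF that] Lam comp[OF _ holomorphic_zeta]
    by (cases "a = - 3 / 2") (auto intro!: holomorphic_intros)
  then show ?thesis
    unfolding G2_closed_def[abs_def] by (intro holomorphic_intros) auto
qed

lemma even_line_regular:
  assumes "Re s > 2" "a > 0" "b > 0" "c > 0" "d > 0" "e > 0"
  shows "(2 * of_nat a, s, 2 * of_nat b, 2 * of_nat c, 2 * of_nat d, 2 * of_nat e) \<notin> G2_possible_singularities"
    and "(2 * of_nat a, 2 * of_nat b, s, 2 * of_nat c, 2 * of_nat d, 2 * of_nat e) \<notin> G2_possible_singularities"
    and "(2 * of_nat a, 2 * of_nat b, 2 * of_nat c, s, 2 * of_nat d, 2 * of_nat e) \<notin> G2_possible_singularities"
proof -
  have regular: "(s1, s2, s3, s4, s5, s6) \<notin> G2_possible_singularities"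
    if "Re s1 \<ge> 2" "Re s2 \<ge> 2" "Re s3 \<ge> 2" "Re s4 \<ge> 2" "Re s5 \<ge> 2" "Re s6 \<ge> 2" for s1 s2 s3 s4 s5 s6
  proof -
    have "s1 + s3 + s4 + s5 + s6 \<noteq> 1 - of_nat l" "s2 + s3 + s4 + s5 + s6 \<noteq> 1 - of_nat l" "s1 + s2 + s3 + s4 + s5 + s6 \<noteq> 2" for l
      using that by (auto dest!: arg_cong[where f = Re])
    then show ?thesis by (simp add: G2_possible_singularities_def)
  qed
  show "(2 * of_nat a, s, 2 * of_nat b, 2 * of_nat c, 2 * of_nat d, 2 * of_nat e) \<notin> G2_possible_singularities"
    "(2 * of_nat a, 2 * of_nat b, s, 2 * of_nat c, 2 * of_nat d, 2 * of_nat e) \<notin> G2_possible_singularities"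
    "(2 * of_nat a, 2 * of_nat b, 2 * of_nat c, s, 2 * of_nat d, 2 * of_nat e) \<notin> G2_possible_singularities"
    using assms by (intro regular; simp)+
qed

theorem theorem5p1:
  fixes p q r u v :: nat and s :: complex
  assumes "p > 0" "q > 0" "r > 0" "u > 0" "v > 0"
    and "zeta_G2_line_regular (\<lambda>t. (2 * of_nat p, t, 2 * of_nat q, 2 * of_nat r, 2 * of_nat u, 2 * of_nat v)) s"
    and "zeta_G2_line_regular (\<lambda>t. (2 * of_nat p, 2 * of_nat q, t, 2 * of_nat r, 2 * of_nat v, 2 * of_nat u)) s"
    and "zeta_G2_line_regular (\<lambda>t. (2 * of_nat u, 2 * of_nat r, t, 2 * of_nat q, 2 * of_nat v, 2 * of_nat p)) s"
    and "zeta_G2_line_regular (\<lambda>t. (2 * of_nat u, t, 2 * of_nat r, 2 * of_nat q, 2 * of_nat p, 2 * of_nat v)) s"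
    and "zeta_G2_line_regular (\<lambda>t. (2 * of_nat v, 2 * of_nat r, 2 * of_nat q, t, 2 * of_nat u, 2 * of_nat p)) s"
    and "zeta_G2_line_regular (\<lambda>t. (2 * of_nat v, 2 * of_nat q, 2 * of_nat r, t, 2 * of_nat p, 2 * of_nat u)) s"
    and "I1 p q r u v analytic_on {s}"
    and "I2 p q r u v analytic_on {s}"
    and "I3 p q r u v analytic_on {s}"
    and "I4 p q r u v analytic_on {s}"
    and "I5 p q r u v analytic_on {s}"
    and "I6 p q r u v analytic_on {s}"
    and "I7 p q r u v analytic_on {s}"
    and "I8 p q r u v analytic_on {s}"
  shows "zeta_G2_line (\<lambda>t. (2 * of_nat p, t, 2 * of_nat q, 2 * of_nat r, 2 * of_nat u, 2 * of_nat v)) s +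
     zeta_G2_line (\<lambda>t. (2 * of_nat p, 2 * of_nat q, t, 2 * of_nat r, 2 * of_nat v, 2 * of_nat u)) s +
     zeta_G2_line (\<lambda>t. (2 * of_nat u, 2 * of_nat r, t, 2 * of_nat q, 2 * of_nat v, 2 * of_nat p)) s +
     zeta_G2_line (\<lambda>t. (2 * of_nat u, t, 2 * of_nat r, 2 * of_nat q, 2 * of_nat p, 2 * of_nat v)) s +
     zeta_G2_line (\<lambda>t. (2 * of_nat v, 2 * of_nat r, 2 * of_nat q, t, 2 * of_nat u, 2 * of_nat p)) s +
     zeta_G2_line (\<lambda>t. (2 * of_nat v, 2 * of_nat q, 2 * of_nat r, t, 2 * of_nat p, 2 * of_nat u)) s +
     I1 p q r u v s + I2 p q r u v s + I3 p q r u v s + I4 p q r u v s + I5 p q r u v s + I6 p q r u v s + I7 p q r u v s + I8 p q r u v s = 0"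
proof -
  note pos = assms(1-5)
  note lines = assms(6-11)
  define L1 where "L1 = (\<lambda>t::complex. (2 * of_nat p, t, 2 * of_nat q, 2 * of_nat r, 2 * of_nat u, 2 * of_nat v) :: complex6)"
  define L2 where "L2 = (\<lambda>t::complex. (2 * of_nat p, 2 * of_nat q, t, 2 * of_nat r, 2 * of_nat v, 2 * of_nat u) :: complex6)"
  define L3 where "L3 = (\<lambda>t::complex. (2 * of_nat u, 2 * of_nat r, t, 2 * of_nat q, 2 * of_nat v, 2 * of_nat p) :: complex6)"
  define L4 where "L4 = (\<lambda>t::complex. (2 * of_nat u, t, 2 * of_nat r, 2 * of_nat q, 2 * of_nat p, 2 * of_nat v) :: complex6)"
  define L5 where "L5 = (\<lambda>t::complex. (2 * of_nat v, 2 * of_nat r, 2 * of_nat q, t, 2 * of_nat u, 2 * of_nat p) :: complex6)"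
  define L6 where "L6 = (\<lambda>t::complex. (2 * of_nat v, 2 * of_nat q, 2 * of_nat r, t, 2 * of_nat p, 2 * of_nat u) :: complex6)"
  note L_defs = L1_def L2_def L3_def L4_def L5_def L6_def
  define Ls where "Ls = {L1, L2, L3, L4, L5, L6}"
  have affine: "\<exists>a b. L = complex6_line a b" if "L \<in> Ls" for L
  proof -
    have "(\<lambda>t. (a1, t, a3, a4, a5, a6)) = complex6_line (a1, 0, a3, a4, a5, a6) (0, 1, 0, 0, 0, 0)"
      "(\<lambda>t. (a1, a3, t, a4, a5, a6)) = complex6_line (a1, a3, 0, a4, a5, a6) (0, 0, 1, 0, 0, 0)"
      "(\<lambda>t. (a1, a3, a4, t, a5, a6)) = complex6_line (a1, a3, a4, 0, a5, a6) (0, 0, 0, 1, 0, 0)" for a1 a3 a4 a5 a6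
      by (simp_all add: complex6_line_def)
    then show ?thesis using that unfolding Ls_def L_defs by blast
  qed
  have L_regular: "L t \<notin> G2_possible_singularities" if "L \<in> Ls" "Re t > 2" for L t
    using that pos unfolding Ls_def L_defs by (auto simp: even_line_regular)
  \<comment> \<open>A continuation is a function of all six variables, so the one obtained from the
    first line serves the other five as well.\<close>
  obtain f where f: "G2_continuation f"
    using lines(1) zeta_G2_line_regular_imp_continuation by blast
  \<comment> \<open>The points at which the closed form may have a pole, or only a conventional
    value.\<close>
  define E where "E = (\<Union>k\<in>{..p + q + r + u + v}. {t. wk p q r u v t k = 1})"
  define C where "C = (\<Union>L\<in>Ls. {t. L t \<in> G2_possible_singularities}) \<union> E"
  have "finite E"
  proof -
    have "{t. wk p q r u v t k = 1} \<subseteq> {1 - (wk p q r u v 0 k)}" for k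
      by (auto simp: wk_def algebra_simps)
    then have "finite {t. wk p q r u v t k = 1}" for k using finite_subset by blast
    then show ?thesis by (simp add: E_def)
  qed
  have countable_L: "countable {t. L t \<in> G2_possible_singularities}" if "L \<in> Ls" for L
  proof -
    obtain a b where L: "L = complex6_line a b" using affine[OF \<open>L \<in> Ls\<close>] by blast
    show ?thesis unfolding L
      by (rule countable_line_singularities[where ?t0.0 = 3]) (use L_regular[OF that, of 3] in \<open>simp add: L\<close>)
  qed
  have "finite Ls" by (simp add: Ls_def)
  then have countable_C: "countable C"
    unfolding C_def using countable_L \<open>finite E\<close>
    by (simp add: \<open>finite Ls\<close> countable_finite)
  define R where "R = - C"
  have R_L: "L t \<notin> G2_possible_singularities" if "L \<in> Ls" "t \<in> R" for L t
    using that by (auto simp: R_def C_def)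
  have hol_L: "(\<lambda>t. f (L t)) holomorphic_on R" and line_eq: "\<And>t. t \<in> R \<Longrightarrow> zeta_G2_line L t = f (L t)"
    if "L \<in> Ls" for L
  proof -
    obtain a b where L: "L = complex6_line a b" using affine[OF \<open>L \<in> Ls\<close>] by blast
    have "(\<lambda>t. f (L t)) holomorphic_on {t. L t \<in> - G2_possible_singularities}"
      unfolding L using f by (intro holomorphic_on_complex6_line) (simp add: G2_continuation_def)
    then show "(\<lambda>t. f (L t)) holomorphic_on R"
      by (rule holomorphic_on_subset) (use R_L[OF that] in auto)
    show "zeta_G2_line L t = f (L t)" if "t \<in> R" for t
      using zeta_G2_line_eq[OF f] R_L[OF \<open>L \<in> Ls\<close> that] unfolding L by blast
  qed
  have "open R"
  proof -
    have "closed {t. L t \<in> G2_possible_singularities}" if "L \<in> Ls" for L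
    proof -
      obtain a b where L: "L = complex6_line a b" using affine[OF \<open>L \<in> Ls\<close>] by blast
      have "open {t. L t \<in> - G2_possible_singularities}"
        unfolding L using f by (intro open_vimage_complex6_line) (simp add: G2_continuation_def holomorphic6_on_def)
      moreover have "{t. L t \<in> - G2_possible_singularities} = - {t. L t \<in> G2_possible_singularities}" by auto
      ultimately show ?thesis by (simp add: closed_def)
    qed
    then have "closed C"
      unfolding C_def using \<open>finite Ls\<close> \<open>finite E\<close> by (intro closed_Un closed_UN finite_imp_closed) auto
    then show ?thesis by (simp add: R_def open_Compl)
  qed
  \<comment> \<open>The continuation argument is run for \<open>f\<close> and the closed form, which
    are holomorphic on \<open>R\<close>. The given analyticity at \<open>s\<close>, in contrast,
    concerns the line functions and the \<open>I\<close> functions, which make up \<open>H\<close>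
    below.\<close>
  define F where "F = (\<lambda>t. f (L1 t) + f (L2 t) + f (L3 t) + f (L4 t) + f (L5 t) + f (L6 t) - G2_closed p q r u v t)"
  have F_right: "F t = 0" if "Re t > 2" for t
  proof -
    have series: "f (L t) = infsum (G2_term (L t)) ({1..} \<times> {1..})" if "L \<in> Ls" for L
      using that \<open>Re t > 2\<close> pos unfolding Ls_def L_defs by (auto simp: G2_continuation_series[OF f])
    show ?thesis
      \<comment> \<open>The two evaluations of the same double sum meet: chamber by chamber it is
        the sum of the six series, row by row it is the closed form.\<close>
      using G2_summand_total[OF that pos has_sum_G2_chambers[OF _ pos]] that
      unfolding F_def by (simp add: series Ls_def) (simp add: L_defs)
  qed
  have F_R: "F t = 0" if "t \<in> R" for t
  proof (rule analytic_continuation_open[of "{t. Re t > 2} \<inter> R" R F "\<lambda>_. 0"])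
    have "wk p q r u v t k \<noteq> 1" if "t \<in> R" "k \<le> p + q + r + u + v" for t k
      using that by (auto simp: R_def C_def E_def)
    then show "F holomorphic_on R"
      unfolding F_def by (intro holomorphic_intros hol_L holomorphic_G2_closed) (auto simp: Ls_def)
    show "open ({t. Re t > 2} \<inter> R)" using \<open>open R\<close> open_halfspace_Re_gt by blast
    show "{t. Re t > 2} \<inter> R \<noteq> {}"
    proof
      assume "{t. Re t > 2} \<inter> R = {}"
      then have "ball 4 1 \<subseteq> C"
      proof (intro subsetI)
        fix t :: complex assume *: "{t. Re t > 2} \<inter> R = {}" and "t \<in> ball 4 1"
        then have "\<bar>Re (4 - t)\<bar> < 1" using abs_Re_le_cmod[of "4 - t"] by (simp add: dist_norm)
        then have "Re t > 2" by simp
        then show "t \<in> C" using * by (auto simp: R_def)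
      qed
      then have "countable (ball (4 :: complex) 1)" using countable_C countable_subset by blast
      then show False using uncountable_ball[of 1 "4 :: complex"] by simp
    qed
    show "connected R" unfolding R_def by (rule connected_cocountable[OF countable_C])
  qed (use \<open>open R\<close> \<open>t \<in> R\<close> F_right in auto)
  define H where "H = (\<lambda>t. zeta_G2_line L1 t + zeta_G2_line L2 t + zeta_G2_line L3 t + zeta_G2_line L4 t +
    zeta_G2_line L5 t + zeta_G2_line L6 t + I1 p q r u v t + I2 p q r u v t + I3 p q r u v t + I4 p q r u v t +
    I5 p q r u v t + I6 p q r u v t + I7 p q r u v t + I8 p q r u v t)"
  have "H analytic_on {s}"
    unfolding H_def using assms(12-19) lines[folded L_defs, unfolded zeta_G2_line_regular_def]
    by (intro analytic_intros) auto
  moreover have "H t = 0" if "t \<notin> C" for t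
  proof -
    have "t \<in> R" using that by (simp add: R_def)
    have "H t = F t"
      unfolding H_def F_def using sum_I_eq_G2_closed[OF pos(1-4), of v t] line_eq[OF _ \<open>t \<in> R\<close>]
      by (simp add: Ls_def algebra_simps)
    then show ?thesis using F_R[OF \<open>t \<in> R\<close>] by simp
  qed
  \<comment> \<open>The point \<open>s\<close> may itself lie in \<open>C\<close>, for instance
    where a singularity of one of the restrictions is removable; continuity of \<open>H\<close> at
    \<open>s\<close> covers this case.\<close>
  ultimately have "H s = 0" using analytic_zero_off_countable countable_C by blast
  then show ?thesis by (simp only: H_def L_defs)
qed

end
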